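(* Let $X$ be a Cantor space. Assume that $K \subset P(X)$ is compact and convex, that all elements of $K$ are atomless and have full support, and that $K$ satisfies the Glasner--Weiss condition. Then $K$ is approximately divisible (hence $K$ is a dynamical simplex).
   Context: $P(X)$ denotes the space of Borel probability measures on the Cantor space $X$, with the topology induced by the maps $\mu \mapsto \mu(A)$ as $A$ runs over all clopen subsets of $X$. A set $K\subset P(X)$ satisfies the Glasner--Weiss condition if whenever $A,B$ are clopen subsets of $X$ and $\mu(A)<\mu(B)$ for all $\mu\in K$, there exists a clopen $C\subseteq B$ such that $\mu(A)=\mu(C)$ for all $\mu \in K$. $K$ is approximately divisible if for any clopen $A\subseteq X$, any positive integer $n$ and any $\varepsilon>0$ there exists a clopen $B\subseteq A$ such that $\mu(A)-\varepsilon\le n\mu(B)\le\mu(A)$ for all $\mu\in K$. A homeomorphism of $X$ is minimal if all its orbits are dense. A set $K\subset P(X)$ is a dynamical simplex if there exists a minimal homeomorphism of $X$ whose set of invariant Borel probability measures coincides with $K$. *)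

theory Defs
  imports "HOL-Probability.Probability"
begin

text \<open>A Cantor space is a topological space homeomorphic to the countable power of the
  two-point discrete space.\<close>

definition cantor_space :: "'a::topological_space itself \<Rightarrow> bool" where
  "cantor_space _ \<longleftrightarrow> (UNIV :: 'a set) homeomorphic (UNIV :: (nat \<Rightarrow> bool) set)"

definition clopen :: "'a::topological_space set \<Rightarrow> bool" where
  "clopen A \<longleftrightarrow> open A \<and> closed A"

definition borel_probs :: "'a::topological_space measure set" where
  "borel_probs = {\<mu>. sets \<mu> = sets borel \<and> prob_space \<mu>}"

text \<open>The coarsest topology on \<^const>\<open>borel_probs\<close> for which every map
  \<open>\<mu> \<mapsto> \<mu>(A)\<close>, with \<open>A\<close> clopen, is continuous. The choice \<open>U = UNIV\<close>
  makes \<^const>\<open>borel_probs\<close> the underlying set.\<close>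

definition prob_topology :: "'a::topological_space measure topology" where
  "prob_topology = topology_generated_by
     {{\<mu> \<in> borel_probs. measure \<mu> A \<in> U} | A (U :: real set). clopen A \<and> open U}"

lemma topspace_prob_topology: "topspace prob_topology = borel_probs"
proof -
  have "clopen ({} :: 'a set)" by (simp add: clopen_def)
  then have "borel_probs \<in> {{\<mu> \<in> borel_probs. measure \<mu> A \<in> U} | A (U :: real set).
      clopen (A :: 'a set) \<and> open U}"
    by (intro CollectI exI[of _ "{} :: 'a set"] exI[of _ "UNIV :: real set"]) auto
  then show ?thesis
    unfolding prob_topology_def topology_generated_by_topspace by blast
qed

text \<open>The type of measures carries no vector space structure, so convex combinations are
  formed setwise.\<close>

definition mixture :: "real \<Rightarrow> 'a measure \<Rightarrow> 'a measure \<Rightarrow> 'a::topological_space measure" where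
  "mixture t \<mu> \<nu> = measure_of UNIV (sets borel)
     (\<lambda>A. ennreal t * emeasure \<mu> A + ennreal (1 - t) * emeasure \<nu> A)"

lemma sets_mixture [simp]: "sets (mixture t \<mu> \<nu>) = sets borel"
  unfolding mixture_def by (metis sets.sigma_sets_eq sets_measure_of space_borel top_greatest Pow_UNIV)

lemma emeasure_mixture:
  assumes "sets \<mu> = sets borel" "sets \<nu> = sets borel" "A \<in> sets borel"
  shows "emeasure (mixture t \<mu> \<nu>) A =
    ennreal t * emeasure \<mu> A + ennreal (1 - t) * emeasure \<nu> A"
proof (rule emeasure_measure_of[OF mixture_def])
  show "sets borel \<subseteq> Pow (UNIV :: 'a set)" by simp
  show "A \<in> sets (mixture t \<mu> \<nu>)" using assms by simp
  show "positive (sets (mixture t \<mu> \<nu>))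
      (\<lambda>A. ennreal t * emeasure \<mu> A + ennreal (1 - t) * emeasure \<nu> A)"
    by (simp add: positive_def)
  show "countably_additive (sets (mixture t \<mu> \<nu>))
      (\<lambda>A. ennreal t * emeasure \<mu> A + ennreal (1 - t) * emeasure \<nu> A)"
    unfolding countably_additive_def
  proof (intro allI impI)
    fix F :: "nat \<Rightarrow> 'a set"
    assume F: "range F \<subseteq> sets (mixture t \<mu> \<nu>)" "disjoint_family F"
    have "(\<Sum>i. emeasure \<mu> (F i)) = emeasure \<mu> (\<Union>i. F i)"
      using F assms by (intro suminf_emeasure) auto
    moreover have "(\<Sum>i. emeasure \<nu> (F i)) = emeasure \<nu> (\<Union>i. F i)"
      using F assms by (intro suminf_emeasure) auto
    ultimately show "(\<Sum>i. ennreal t * emeasure \<mu> (F i) + ennreal (1 - t) * emeasure \<nu> (F i)) =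
        ennreal t * emeasure \<mu> (\<Union> (range F)) + ennreal (1 - t) * emeasure \<nu> (\<Union> (range F))"
      by (subst suminf_add[symmetric]) (auto simp: ennreal_suminf_cmult)
  qed
qed

definition convex_measures :: "'a::topological_space measure set \<Rightarrow> bool" where
  "convex_measures K \<longleftrightarrow>
     (\<forall>\<mu>\<in>K. \<forall>\<nu>\<in>K. \<forall>t. 0 \<le> t \<and> t \<le> 1 \<longrightarrow> mixture t \<mu> \<nu> \<in> K)"

definition atom :: "'a measure \<Rightarrow> 'a set \<Rightarrow> bool" where
  "atom \<mu> A \<longleftrightarrow> A \<in> sets \<mu> \<and> 0 < measure \<mu> A \<and>
     (\<forall>B\<in>sets \<mu>. B \<subseteq> A \<longrightarrow> measure \<mu> B = 0 \<or> measure \<mu> B = measure \<mu> A)"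

definition atomless :: "'a measure \<Rightarrow> bool" where
  "atomless \<mu> \<longleftrightarrow> (\<nexists>A. atom \<mu> A)"

definition full_support :: "'a::topological_space measure \<Rightarrow> bool" where
  "full_support \<mu> \<longleftrightarrow> (\<forall>U. open U \<and> U \<noteq> {} \<longrightarrow> 0 < measure \<mu> U)"

definition glasner_weiss :: "'a::topological_space measure set \<Rightarrow> bool" where
  "glasner_weiss K \<longleftrightarrow>
     (\<forall>A B. clopen A \<and> clopen B \<and> (\<forall>\<mu>\<in>K. measure \<mu> A < measure \<mu> B) \<longrightarrow>
        (\<exists>C. clopen C \<and> C \<subseteq> B \<and> (\<forall>\<mu>\<in>K. measure \<mu> A = measure \<mu> C)))"

definition approximately_divisible :: "'a::topological_space measure set \<Rightarrow> bool" where
  "approximately_divisible K \<longleftrightarrow>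
     (\<forall>A (n::nat) (\<epsilon>::real). clopen A \<and> 0 < n \<and> 0 < \<epsilon> \<longrightarrow>
        (\<exists>B. clopen B \<and> B \<subseteq> A \<and>
           (\<forall>\<mu>\<in>K. measure \<mu> A - \<epsilon> \<le> real n * measure \<mu> B \<and>
                    real n * measure \<mu> B \<le> measure \<mu> A)))"

definition self_homeomorphism :: "('a::topological_space \<Rightarrow> 'a) \<Rightarrow> bool" where
  "self_homeomorphism g \<longleftrightarrow> (\<exists>h. homeomorphism UNIV UNIV g h)"

definition full_orbit :: "('a \<Rightarrow> 'a) \<Rightarrow> 'a \<Rightarrow> 'a set" where
  "full_orbit g x = range (\<lambda>n. (g ^^ n) x) \<union> range (\<lambda>n. (inv g ^^ n) x)"

definition minimal_homeomorphism :: "('a::topological_space \<Rightarrow> 'a) \<Rightarrow> bool" where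
  "minimal_homeomorphism g \<longleftrightarrow>
     self_homeomorphism g \<and> (\<forall>x. closure (full_orbit g x) = UNIV)"

definition invariant_probs :: "('a::topological_space \<Rightarrow> 'a) \<Rightarrow> 'a measure set" where
  "invariant_probs g = {\<mu> \<in> borel_probs. distr \<mu> borel g = \<mu>}"

definition dynamical_simplex :: "'a::topological_space measure set \<Rightarrow> bool" where
  "dynamical_simplex K \<longleftrightarrow> (\<exists>g. minimal_homeomorphism g \<and> invariant_probs g = K)"

end

theory Submission
  imports Defs
begin

text \<open>Call clopen sets equivalent when all measures in \<open>K\<close> agree on them. A back-and-forth argument turns the
  Glasner--Weiss condition into homeomorphisms between equivalent clopen sets that preserve every
  measure in \<open>K\<close>. For divisibility, fix a clopen \<open>U\<close> of tiny measure, cut \<open>A\<close> into pieces smaller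
  than \<open>U\<close>, and map each piece into \<open>U\<close>. Over every point of \<open>U\<close> this stacks finitely many points of
  \<open>A\<close>; taking every \<open>n\<close>-th point of each stack gives \<open>B\<close> with \<open>n \<mu>(B) \<le> \<mu>(A) \<le> n \<mu>(B) + n \<mu>(U)\<close>.

  The minimal homeomorphism is a limit of periodic ones by cutting and stacking. A periodic \<open>g\<close> with
  a clopen transversal \<open>T\<close> is modified by swapping two equivalent disjoint subsets of \<open>T\<close>, after which
  one of them can be dropped from \<open>T\<close>. If \<open>f\<close> is integer valued with positive integral against all of
  \<open>K\<close>, one can stack until all orbit sums of \<open>f\<close> are nonnegative, and this yields a locally constant
  \<open>u\<close> with \<open>u \<circ> g \<le> u + f\<close>, a property that survives in the limit. It forces minimality (take
  \<open>f = M 1\<^sub>A - 1\<close>) and \<open>\<integral> f d\<mu> \<ge> 0\<close> for every invariant \<open>\<mu>\<close>, whence \<open>\<mu> \<in> K\<close> by separation of a point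
  from a compact convex set.\<close>

text \<open>The Glasner--Weiss condition speaks only about inequalities that are strict on all of
  \<open>K\<close>, so every construction has to keep a gap. Compactness of \<open>K\<close> and
  full support turn positivity into uniform lower bounds, and atomlessness makes all deep cylinders
  uniformly small, so that a small set can be held in reserve or left over.

  The orbit function \<open>u\<close> is normalized to vanish on the image of the transversal
  \<open>T\<close> under \<open>g\<close>. Later stages redirect only points of \<open>T\<close> and
  keep that image, so at such points the inequality reads 0 \<le> u + f whatever the new target is;
  this is why it outlives all later changes. Integer values serve two purposes. The finitely many
  orbit sums have a common multiple \<open>L\<close>, so that they can be stacked to the same size;
  and integer combinations of cylinders are countable, so that each can be dealt with at a stage of
  its own. Real coefficients occur only in the separation argument, where scaling and rounding bring
  back integers.\<close>

lemma clopen_Int [simp]: "clopen A \<Longrightarrow> clopen B \<Longrightarrow> clopen (A \<inter> B)"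
  and clopen_Un [simp]: "clopen A \<Longrightarrow> clopen B \<Longrightarrow> clopen (A \<union> B)"
  and clopen_Diff [simp]: "clopen A \<Longrightarrow> clopen B \<Longrightarrow> clopen (A - B)"
  and clopen_Compl [simp]: "clopen A \<Longrightarrow> clopen (- A)"
  and clopen_empty [simp]: "clopen {}"
  and clopen_UNIV [simp]: "clopen UNIV"
  for A B :: "'b::topological_space set"
  by (auto simp: clopen_def)

lemma clopen_UNION [simp]:
  "finite I \<Longrightarrow> (\<And>i. i \<in> I \<Longrightarrow> clopen (A i)) \<Longrightarrow> clopen (\<Union>i\<in>I. A i :: 'b::topological_space set)"
  by (auto simp: clopen_def)

lemma clopen_sets: "clopen (A :: 'b::topological_space set) \<Longrightarrow> A \<in> sets borel"
  by (auto simp: clopen_def)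

section \<open>Coordinates on the Cantor space\<close>

locale cantor_coordinates =
  fixes e :: "'a::topological_space \<Rightarrow> nat \<Rightarrow> bool"
  assumes homeo: "\<exists>e'. homeomorphism UNIV UNIV e e'"
begin

definition agree :: "nat \<Rightarrow> 'a \<Rightarrow> 'a \<Rightarrow> bool" where
  "agree m x y \<longleftrightarrow> (\<forall>i<m. e x i = e y i)"

text \<open>Local constancy in uniform form: by compactness one depth \<open>m\<close> can serve all
  points, and that depth is what compositions and finite tuples are computed with.\<close>

definition locconst :: "('a \<Rightarrow> 'b) \<Rightarrow> bool" where
  "locconst f \<longleftrightarrow> (\<exists>m. \<forall>x y. agree m x y \<longrightarrow> f x = f y)"

text \<open>Words instead of points as indices make the cylinders a countable family; this is used
  both to generate the Borel sets and to enumerate test functions.\<close>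

definition cyl :: "bool list \<Rightarrow> 'a set" where
  "cyl l = {x. \<forall>i<length l. e x i = l ! i}"

lemma agree_refl [simp]: "agree m x x" and agree_sym: "agree m x y \<Longrightarrow> agree m y x"
  and agree_trans: "agree m x y \<Longrightarrow> agree m y z \<Longrightarrow> agree m x z"
  and agree_mono: "agree n x y \<Longrightarrow> m \<le> n \<Longrightarrow> agree m x y"
  by (auto simp: agree_def)

lemma agree_all: assumes "\<And>m. agree m x y" shows "x = y"
proof -
  have "e x = e y" using assms by (auto simp: agree_def fun_eq_iff)
  moreover have "inj e" using homeo by (metis UNIV_I homeomorphism_apply1 inj_on_inverseI)
  ultimately show ?thesis by (simp add: inj_eq)
qed

lemma ball_basis:
  assumes "open U" "x \<in> U" shows "\<exists>m. \<forall>y. agree m x y \<longrightarrow> y \<in> U"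
proof -
  obtain e' where e': "homeomorphism UNIV UNIV e e'" using homeo by blast
  let ?V = "e' -` U"
  have "continuous_on UNIV e'" using e' by (simp add: homeomorphism_def)
  then have "open ?V" using assms by (simp add: continuous_on_open_vimage)
  moreover have "e x \<in> ?V" using e' assms by (simp add: homeomorphism_apply1)
  ultimately obtain X where X: "e x \<in> (\<Pi>\<^sub>E i\<in>UNIV. X i)" "finite {i. X i \<noteq> UNIV}"
      "(\<Pi>\<^sub>E i\<in>UNIV. X i) \<subseteq> ?V"
    using product_topology_open_contains_basis[of "\<lambda>_::nat. euclidean :: bool topology" UNIV ?V "e x"]
    by (auto simp: open_fun_def)
  obtain m where m: "\<forall>i\<in>{i. X i \<noteq> UNIV}. i < m"
    using X(2) by (meson finite_nat_set_iff_bounded)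
  have "y \<in> U" if y: "agree m x y" for y
  proof -
    have "e y \<in> (\<Pi>\<^sub>E i\<in>UNIV. X i)"
    proof (rule PiE_I)
      fix i show "e y i \<in> X i"
      proof (cases "i < m")
        case True then have "e y i = e x i" using y by (auto simp: agree_def)
        then show ?thesis using X(1) by auto
      next
        case False then show ?thesis using m by blast
      qed
    qed auto
    then have "e' (e y) \<in> U" using X(3) by auto
    then show ?thesis using e' by (simp add: homeomorphism_apply1)
  qed
  then show ?thesis by blast
qed

lemma compact_all: "compact (UNIV :: 'a set)"
proof -
  have "compact_space (product_topology (\<lambda>_::nat. euclidean :: bool topology) UNIV)"
    by (subst compact_space_product_topology) (auto simp: compact_space_def compactin_euclidean_iff intro: finite_imp_compact)
  then have "compact (UNIV :: (nat \<Rightarrow> bool) set)"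
    by (simp add: euclidean_product_topology compact_space_def)
  moreover have "(UNIV :: 'a set) homeomorphic (UNIV :: (nat \<Rightarrow> bool) set)"
    using homeo by (auto simp: homeomorphic_def)
  ultimately show ?thesis using homeomorphic_compactness by blast
qed

lemma coord_clopen: "clopen {x. e x i}"
proof -
  have "continuous_on UNIV e" using homeo by (auto simp: homeomorphism_def)
  then have c: "continuous_on UNIV (\<lambda>x. e x i)"
    by (rule continuous_on_product_then_coordinatewise)
  have "{x. e x i} = (\<lambda>x. e x i) -` {True}" by auto
  moreover have "open {True}" "open (- {True})"
  proof -
    \<comment> \<open>\<open>bool\<close> carries its order topology, in which both singletons are
      open rays.\<close>
    have "{True} = {False<..}" "- {True} = {..<True}" by auto
    then show "open {True}" "open (- {True})" using open_greaterThan open_lessThan by metis+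
  qed
  moreover from this have "closed {True}" by (simp add: closed_def)
  ultimately show ?thesis using c by (auto simp: clopen_def intro: open_vimage closed_vimage)
qed

lemma cell_eq: "{y. agree m x y} = cyl (map (e x) [0..<m])"
  by (auto simp: agree_def cyl_def)

lemma cyl_Cons_snoc: "cyl (l @ [b]) = cyl l \<inter> {x. e x (length l) = b}"
  by (auto simp: cyl_def nth_append less_Suc_eq)

lemma cyl_Nil [simp]: "cyl [] = UNIV" by (simp add: cyl_def)

lemma cyl_clopen [simp]: "clopen (cyl l)"
proof (induction l rule: rev_induct)
  case (snoc b l)
  have "{x. e x (length l) = b} = (if b then {x. e x (length l)} else - {x. e x (length l)})" by auto
  then have "clopen {x. e x (length l) = b}" using coord_clopen[of "length l"] by auto
  then show ?case using snoc by (auto simp: cyl_Cons_snoc)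
qed simp

lemma cell_clopen [simp]: "clopen {y. agree m x y}" by (simp add: cell_eq)

lemma finite_code: "finite {l :: bool list. length l = m}"
  using finite_lists_length_eq[of "UNIV :: bool set" m] by simp

text \<open>A Lebesgue number argument: finitely many of the cells cover the space, and
  \<open>mono\<close> lets the largest of their depths serve every point.\<close>

lemma cover_cell:
  assumes "\<And>x. P x (m x)" and mono: "\<And>x y m n. P x m \<Longrightarrow> m \<le> n \<Longrightarrow> agree m x y \<Longrightarrow> P y n"
  shows "\<exists>n. \<forall>x. P x n"
proof -
  have "UNIV \<subseteq> (\<Union>x\<in>UNIV. {y. agree (m x) x y})" by auto
  then obtain C where C: "finite C" "UNIV \<subseteq> (\<Union>x\<in>C. {y. agree (m x) x y})"
    using compactE_image[OF compact_all, of UNIV "\<lambda>x. {y. agree (m x) x y}"] cell_clopen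
    by (auto simp: clopen_def)
  have "P y (Max (m ` C))" for y
  proof -
    obtain x where "x \<in> C" "agree (m x) x y" using C by blast
    then show ?thesis using mono[OF assms(1), of x "Max (m ` C)" y] C(1) by auto
  qed
  then show ?thesis by blast
qed

lemma clopen_iff: "clopen A \<longleftrightarrow> locconst (\<lambda>x. x \<in> A)"
proof
  assume A: "clopen A"
  have "\<exists>m. \<forall>y. agree m x y \<longrightarrow> (y \<in> A \<longleftrightarrow> x \<in> A)" for x
    using ball_basis[of A x] ball_basis[of "- A" x] A
    by (cases "x \<in> A") (auto simp: clopen_def)
  then obtain m where m: "\<And>x y. agree (m x) x y \<Longrightarrow> (y \<in> A \<longleftrightarrow> x \<in> A)" by metis
  have "\<exists>n. \<forall>x. \<forall>y. agree n x y \<longrightarrow> (y \<in> A \<longleftrightarrow> x \<in> A)"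
    by (rule cover_cell[where m = m and P = "\<lambda>x n. \<forall>y. agree n x y \<longrightarrow> (y \<in> A \<longleftrightarrow> x \<in> A)"])
      (use m agree_trans agree_mono in blast)+
  then show "locconst (\<lambda>x. x \<in> A)" unfolding locconst_def by blast
next
  assume "locconst (\<lambda>x. x \<in> A)"
  then obtain m where m: "\<And>x y. agree m x y \<Longrightarrow> (x \<in> A \<longleftrightarrow> y \<in> A)" unfolding locconst_def by blast
  have "A = (\<Union>l\<in>{l. length l = m \<and> cyl l \<subseteq> A}. cyl l)"
  proof (intro subset_antisym subsetI)
    fix x assume "x \<in> A"
    then have "{y. agree m x y} \<subseteq> A" "x \<in> {y. agree m x y}" using m by auto
    then show "x \<in> (\<Union>l\<in>{l. length l = m \<and> cyl l \<subseteq> A}. cyl l)"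
      unfolding cell_eq by (intro UN_I[of "map (e x) [0..<m]"]) auto
  qed auto
  moreover have "finite {l. length l = m \<and> cyl l \<subseteq> A}"
    by (rule finite_subset[OF _ finite_code[of m]]) auto
  ultimately show "clopen A" by (metis (no_types, lifting) clopen_UNION cyl_clopen)
qed

lemma locconst_const [simp]: "locconst (\<lambda>x. c)" by (auto simp: locconst_def)

lemma locconst_op:
  assumes "locconst f" "locconst g" shows "locconst (\<lambda>x. F (f x) (g x))"
proof -
  obtain m n where "\<And>x y. agree m x y \<Longrightarrow> f x = f y" "\<And>x y. agree n x y \<Longrightarrow> g x = g y"
    using assms unfolding locconst_def by blast
  then have "agree (max m n) x y \<Longrightarrow> F (f x) (g x) = F (f y) (g y)" for x y
    by (metis agree_mono max.cobounded1 max.cobounded2)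
  then show ?thesis unfolding locconst_def by blast
qed

lemma locconst_fun: "locconst f \<Longrightarrow> locconst (\<lambda>x. F (f x))"
  using locconst_op[of f f "\<lambda>a _. F a"] by simp

lemma locconst_if: "clopen A \<Longrightarrow> locconst f \<Longrightarrow> locconst g \<Longrightarrow> locconst (\<lambda>x. if x \<in> A then f x else g x)"
  using locconst_op[of "\<lambda>x. x \<in> A" "\<lambda>x. (f x, g x)" "\<lambda>b p. if b then fst p else snd p"]
    locconst_op[of f g Pair] by (simp add: clopen_iff if_distrib[of fst] cong: if_cong)

lemma locconst_clopen: "locconst f \<Longrightarrow> clopen {x. P (f x)}"
  using locconst_fun[of f P] by (simp add: clopen_iff)

lemma locconst_all:
  assumes "\<And>i. i < (n::nat) \<Longrightarrow> locconst (f i)" shows "locconst (\<lambda>x. \<lambda>i. if i < n then f i x else c i)"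
  using assms
proof (induction n)
  case (Suc n)
  have "(\<lambda>x i. if i < Suc n then f i x else c i) =
      (\<lambda>x. (\<lambda>a b. a(n := b)) (\<lambda>i. if i < n then f i x else c i) (f n x))"
    by (auto simp: fun_eq_iff less_Suc_eq)
  moreover have "locconst (\<lambda>x. \<lambda>i. if i < n then f i x else c i)" using Suc by auto
  ultimately show ?case using locconst_op[where F = "\<lambda>a b. a(n := b)" and g = "f n"] Suc.prems[of n]
    by (simp only: lessI simp_thms)
qed auto

lemma locconst_comp:
  assumes u: "locconst u" and g: "\<And>A. clopen A \<Longrightarrow> clopen (g -` A)" shows "locconst (\<lambda>x. u (g x))"
proof -
  obtain m where m: "\<And>x y. agree m x y \<Longrightarrow> u x = u y" using u unfolding locconst_def by blast
  have "locconst (\<lambda>x. e (g x) i)" for i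
    using g[OF coord_clopen[of i]] by (simp add: clopen_iff)
  \<comment> \<open>The value \<open>False\<close> beyond \<open>m\<close> truncates the sequence,
    so equality of these functions says exactly that the images agree to depth
    \<open>m\<close>.\<close>
  then have "locconst (\<lambda>x. \<lambda>i. if i < m then e (g x) i else False)" by (intro locconst_all)
  then obtain n where n: "\<And>x y. agree n x y \<Longrightarrow>
      (\<lambda>i. if i < m then e (g x) i else False) = (\<lambda>i. if i < m then e (g y) i else False)"
    unfolding locconst_def by blast
  have "u (g x) = u (g y)" if "agree n x y" for x y
    by (rule m) (use n[OF that] in \<open>auto simp: agree_def fun_eq_iff\<close>, metis+)
  then show ?thesis unfolding locconst_def by blast
qed

lemma locconst_finite_range: assumes "locconst f" shows "finite (range f)"
proof -
  obtain m where m: "\<And>x y. agree m x y \<Longrightarrow> f x = f y" using assms unfolding locconst_def by blast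
  have "range f \<subseteq> (\<lambda>l. f (SOME x. x \<in> cyl l)) ` {l. length l = m}"
  proof clarify
    fix x
    let ?l = "map (e x) [0..<m]"
    have "x \<in> cyl ?l" by (auto simp flip: cell_eq)
    then have "(SOME x. x \<in> cyl ?l) \<in> cyl ?l" by (rule someI)
    then have "f x = f (SOME x. x \<in> cyl ?l)" using m unfolding cell_eq[symmetric] by blast
    then show "f x \<in> (\<lambda>l. f (SOME x. x \<in> cyl l)) ` {l. length l = m}" by (intro image_eqI) auto
  qed
  then show ?thesis using finite_code finite_surj by blast
qed

lemma clopen_nested:
  assumes "\<And>n. clopen (F n)" "\<And>n. F n \<noteq> {}" "\<And>n. F (Suc n) \<subseteq> F n"
  shows "\<exists>x::'a. \<forall>n. x \<in> F n"
proof (rule ccontr)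
  assume "\<not> ?thesis"
  then have "UNIV \<subseteq> (\<Union>n. - F n)" by auto
  moreover have "open (- F n)" for n using assms(1) by (auto simp: clopen_def)
  ultimately obtain N where N: "finite N" "UNIV \<subseteq> (\<Union>n\<in>N. - F n)"
    by (metis compactE_image[OF compact_all, of UNIV "\<lambda>n. - F n"])
  obtain b where b: "\<forall>n\<in>N. n \<le> b" using N(1) unfolding finite_nat_set_iff_bounded_le by auto
  have "F b \<subseteq> F n" if "n \<le> b" for n
    using lift_Suc_antimono_le[of F n b] assms(3) that by auto
  moreover obtain z where "z \<in> F b" using assms(2) by (meson ex_in_conv)
  moreover obtain n where "n \<in> N" "z \<notin> F n" using N(2) by auto
  ultimately show False using b by auto
qed

lemma continuous_of_clopen:
  assumes "\<And>A. clopen A \<Longrightarrow> clopen (g -` A)" shows "continuous_on UNIV (g :: 'a \<Rightarrow> 'a)"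
proof (subst continuous_on_open_vimage[OF open_UNIV], intro allI impI)
  fix U :: "'a set" assume U: "open U"
  have "g -` U \<inter> UNIV = (\<Union>l\<in>{l. cyl l \<subseteq> U}. g -` cyl l)"
  proof (intro subset_antisym subsetI)
    fix x assume "x \<in> g -` U \<inter> UNIV"
    then obtain m where "\<forall>y. agree m (g x) y \<longrightarrow> y \<in> U" using ball_basis[OF U] by auto
    then show "x \<in> (\<Union>l\<in>{l. cyl l \<subseteq> U}. g -` cyl l)"
      by (intro UN_I[of "map (e (g x)) [0..<m]"]) (auto simp flip: cell_eq)
  qed auto
  then show "open (g -` U \<inter> UNIV)" using assms[OF cyl_clopen] by (simp add: clopen_def open_UN)
qed

lemma measure_eq_cyl:
  assumes "\<mu> \<in> borel_probs" "\<nu> \<in> borel_probs" "\<And>l. measure \<mu> (cyl l) = measure \<nu> (cyl l)"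
  shows "\<mu> = \<nu>"
proof -
  interpret \<mu>: prob_space \<mu> using assms by (simp add: borel_probs_def)
  interpret \<nu>: prob_space \<nu> using assms by (simp add: borel_probs_def)
  have s: "sets \<mu> = sets borel" "sets \<nu> = sets borel" using assms by (auto simp: borel_probs_def)
  \<comment> \<open>Two cylinders with a common point \<open>z\<close> are both cells around
    \<open>z\<close>, so the deeper one is the intersection.\<close>
  have int: "\<exists>l. cyl a \<inter> cyl b = cyl l" if ne: "cyl a \<inter> cyl b \<noteq> {}" for a b
  proof -
    obtain z where z: "z \<in> cyl a" "z \<in> cyl b" using ne by auto
    have "cyl a = {y. agree (length a) z y}" "cyl b = {y. agree (length b) z y}"
      using z by (auto simp: cyl_def agree_def)
    then have "cyl a \<inter> cyl b = {y. agree (max (length a) (length b)) z y}"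
      by (auto simp: agree_def less_max_iff_disj)
    then show ?thesis unfolding cell_eq by blast
  qed
  \<comment> \<open>Disjoint cylinders meet in the empty set, which has to be added for stability
    under intersection.\<close>
  let ?E = "insert {} (range cyl)"
  have op: "U \<in> sigma_sets UNIV ?E" if U: "open U" for U
  proof -
    have "U = (\<Union>l\<in>{l. cyl l \<subseteq> U}. cyl l)"
    proof (intro subset_antisym subsetI)
      fix x assume "x \<in> U"
      then obtain m where "\<forall>y. agree m x y \<longrightarrow> y \<in> U" using ball_basis[OF U] by auto
      then show "x \<in> (\<Union>l\<in>{l. cyl l \<subseteq> U}. cyl l)"
        by (intro UN_I[of "map (e x) [0..<m]"]) (auto simp flip: cell_eq)
    qed auto
    moreover have "(\<Union>l\<in>{l. cyl l \<subseteq> U}. cyl l) \<in> sigma_sets UNIV ?E"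
    proof -
      interpret sigma_algebra UNIV "sigma_sets UNIV ?E" by (rule sigma_algebra_sigma_sets) auto
      show ?thesis by (rule countable_UN') auto
    qed
    ultimately show ?thesis by simp
  qed
  have gen: "sets borel = sigma_sets UNIV ?E"
  proof (rule subset_antisym)
    show "sets borel \<subseteq> sigma_sets UNIV ?E"
      unfolding borel_def using op by (subst sets_measure_of) (auto intro!: sigma_sets_mono)
    have "?E \<subseteq> sets borel" using clopen_sets[OF cyl_clopen] by auto
    then show "sigma_sets UNIV ?E \<subseteq> sets borel"
      by (metis sets.sigma_sets_subset space_borel)
  qed
  show ?thesis
  proof (rule measure_eqI_generator_eq[where E = ?E and \<Omega> = UNIV and A = "\<lambda>_. UNIV"])
    show "Int_stable ?E"
      unfolding Int_stable_def
    proof (intro ballI)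
      fix a b assume ab: "a \<in> ?E" "b \<in> ?E"
      show "a \<inter> b \<in> ?E"
      proof (cases "a \<inter> b = {}")
        case False
        then obtain k l where "a = cyl k" "b = cyl l" using ab by blast
        then show ?thesis using int[of k l] False by auto
      qed simp
    qed
    show "emeasure \<mu> X = emeasure \<nu> X" if "X \<in> ?E" for X
      using that assms(3) by (auto simp: \<mu>.emeasure_eq_measure \<nu>.emeasure_eq_measure)
    show "range (\<lambda>_. UNIV) \<subseteq> ?E" using rangeI[of cyl "[]"] by simp
    show "emeasure \<mu> UNIV \<noteq> \<infinity>" for i :: nat using \<mu>.emeasure_finite by simp
  qed (use s gen in auto)
qed

end

section \<open>Homeomorphisms between equivalent clopen sets\<close>

text \<open>\<open>K\<close> must be nonempty because every homeomorphism of a nonempty compact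
  metrizable space has an invariant probability measure, so the empty set is never a dynamical
  simplex.\<close>

locale gw_measures = cantor_coordinates e
  for e :: "'a::topological_space \<Rightarrow> nat \<Rightarrow> bool" +
  fixes K :: "'a measure set"
  assumes K_sub: "K \<subseteq> borel_probs"
    and K_compact: "compactin prob_topology K"
    and K_nonempty: "K \<noteq> {}"
    and K_support: "\<And>\<nu>. \<nu> \<in> K \<Longrightarrow> atomless \<nu> \<and> full_support \<nu>"
    and K_gw: "glasner_weiss K"
begin

definition eqv :: "'a set \<Rightarrow> 'a set \<Rightarrow> bool" where
  "eqv A B \<longleftrightarrow> (\<forall>\<nu>\<in>K. measure \<nu> A = measure \<nu> B)"

text \<open>Continuity in both directions and preservation of \<open>K\<close> are expressed on
  clopen sets alone, which determine the topology and the Borel measures. Asking for images as well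
  as preimages keeps the notion symmetric without mentioning the inverse map.\<close>

definition khomeo :: "('a \<Rightarrow> 'a) \<Rightarrow> 'a set \<Rightarrow> 'a set \<Rightarrow> bool" where
  "khomeo h A B \<longleftrightarrow> bij_betw h A B \<and>
     (\<forall>C. clopen C \<and> C \<subseteq> A \<longrightarrow> clopen (h ` C) \<and> eqv (h ` C) C) \<and>
     (\<forall>D. clopen D \<and> D \<subseteq> B \<longrightarrow> clopen (A \<inter> h -` D) \<and> eqv (A \<inter> h -` D) D)"

section \<open>Measures of clopen sets over K, and uniformity from compactness\<close>

lemma K_prob: "\<nu> \<in> K \<Longrightarrow> prob_space \<nu>" and K_sets: "\<nu> \<in> K \<Longrightarrow> sets \<nu> = sets borel"
  using K_sub by (auto simp: borel_probs_def)

lemma K_space: "\<nu> \<in> K \<Longrightarrow> space \<nu> = UNIV"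
  using sets_eq_imp_space_eq[OF K_sets] by simp

lemma K_finite: "\<nu> \<in> K \<Longrightarrow> finite_measure \<nu>"
  using K_prob by (simp add: prob_space_def)

lemma K_measurable: "\<nu> \<in> K \<Longrightarrow> clopen A \<Longrightarrow> A \<in> sets \<nu>"
  by (simp add: K_sets clopen_sets)

lemma K_UNIV: "\<nu> \<in> K \<Longrightarrow> measure \<nu> UNIV = 1"
  using prob_space.prob_space[OF K_prob] K_space by metis

lemma K_pos: "\<nu> \<in> K \<Longrightarrow> clopen A \<Longrightarrow> A \<noteq> {} \<Longrightarrow> 0 < measure \<nu> A"
  using K_support by (auto simp: full_support_def clopen_def)

lemma K_Un: "\<nu> \<in> K \<Longrightarrow> clopen A \<Longrightarrow> clopen B \<Longrightarrow> A \<inter> B = {} \<Longrightarrow>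
    measure \<nu> (A \<union> B) = measure \<nu> A + measure \<nu> B"
  by (simp add: K_measurable finite_measure.finite_measure_Union K_finite)

lemma K_mono: "\<nu> \<in> K \<Longrightarrow> clopen B \<Longrightarrow> A \<subseteq> B \<Longrightarrow> measure \<nu> A \<le> measure \<nu> B"
  by (simp add: K_measurable finite_measure.finite_measure_mono K_finite)

lemma K_Diff: "\<nu> \<in> K \<Longrightarrow> clopen A \<Longrightarrow> clopen B \<Longrightarrow> B \<subseteq> A \<Longrightarrow>
    measure \<nu> (A - B) = measure \<nu> A - measure \<nu> B"
  by (simp add: K_measurable finite_measure.finite_measure_Diff K_finite)

lemma K_UNION: "\<nu> \<in> K \<Longrightarrow> finite I \<Longrightarrow> (\<And>i. i \<in> I \<Longrightarrow> clopen (A i)) \<Longrightarrow> disjoint_family_on A I \<Longrightarrow>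
    measure \<nu> (\<Union>i\<in>I. A i) = (\<Sum>i\<in>I. measure \<nu> (A i))"
  by (rule finite_measure.finite_measure_finite_Union) (auto simp: K_finite K_measurable)

lemma openin_measure: "clopen A \<Longrightarrow> open U \<Longrightarrow> openin prob_topology {\<mu> \<in> borel_probs. measure \<mu> A \<in> U}"
  unfolding prob_topology_def by (rule topology_generated_by_Basis) auto

lemma continuous_measure: "clopen A \<Longrightarrow> continuous_map prob_topology euclideanreal (\<lambda>\<mu>. measure \<mu> A)"
  by (auto simp: continuous_map_def topspace_prob_topology openin_measure)

lemma K_attains:
  assumes "continuous_map prob_topology euclideanreal F"
  shows "\<exists>\<nu>0\<in>K. \<forall>\<nu>\<in>K. F \<nu>0 \<le> F \<nu>"
proof -
  have "compact (F ` K)" using image_compactin[OF K_compact assms] by simp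
  then have "\<exists>s\<in>F ` K. \<forall>t\<in>F ` K. s \<le> t" using K_nonempty by (intro compact_attains_inf) auto
  then show ?thesis by auto
qed

text \<open>Compactness of \<open>K\<close> in the form needed later, for uniformly small cells and
  for passing from finitely many cylinders to all of them.\<close>

lemma K_cover:
  assumes "\<And>i::nat. clopen (A i)" "\<And>i. open (U i)" "\<And>\<nu>. \<nu> \<in> K \<Longrightarrow> \<exists>i. measure \<nu> (A i) \<in> U i"
  shows "\<exists>N. \<forall>\<nu>\<in>K. \<exists>i<N. measure \<nu> (A i) \<in> U i"
proof -
  let ?V = "\<lambda>i. {\<mu> \<in> borel_probs. measure \<mu> (A i) \<in> U i}"
  have "K \<subseteq> \<Union> (range ?V)" using K_sub assms(3) by blast
  moreover have "\<forall>V\<in>range ?V. openin prob_topology V" by (auto intro: openin_measure[OF assms(1,2)])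
  ultimately have "\<exists>\<F>. finite \<F> \<and> \<F> \<subseteq> range ?V \<and> K \<subseteq> \<Union> \<F>"
    by (intro compactinD[OF K_compact]) blast+
  then obtain \<F> where F: "finite \<F>" "\<F> \<subseteq> range ?V" "K \<subseteq> \<Union> \<F>" by blast
  obtain I where I: "finite I" "\<F> = ?V ` I" using finite_subset_image[OF F(1,2)] by auto
  obtain N where N: "\<forall>i\<in>I. i < N" using I(1) finite_nat_set_iff_bounded by auto
  have "\<exists>i<N. measure \<nu> (A i) \<in> U i" if "\<nu> \<in> K" for \<nu>
  proof -
    from that have "\<nu> \<in> \<Union> \<F>" using F(3) by blast
    then show ?thesis using N I(2) by auto
  qed
  then show ?thesis by blast
qed

lemma K_lower: assumes "clopen A" "A \<noteq> {}" shows "\<exists>\<delta>>0. \<forall>\<nu>\<in>K. \<delta> \<le> measure \<nu> A"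
  using K_attains[OF continuous_measure[OF assms(1)]] K_pos[OF _ assms] by blast

lemma K_singleton: assumes "\<nu> \<in> K" shows "measure \<nu> {x} = 0"
proof (rule ccontr)
  interpret finite_measure \<nu> using K_finite assms .
  assume n: "measure \<nu> {x} \<noteq> 0"
  \<comment> \<open>\<open>measure\<close> is 0 on nonmeasurable sets, so a nonzero value already
    yields measurability.\<close>
  then have "{x} \<in> sets \<nu>" by (metis measure_notin_sets)
  moreover have "measure \<nu> B = 0 \<or> measure \<nu> B = measure \<nu> {x}" if "B \<subseteq> {x}" for B
    using that by (auto simp: subset_singleton_iff)
  ultimately have "atom \<nu> {x}" using n by (simp add: atom_def zero_less_measure_iff)
  then show False using K_support[OF assms] by (auto simp: atomless_def)
qed

text \<open>Cells around \<open>x\<close> decrease to the null set \<open>{x}\<close>. Compactness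
  of \<open>K\<close> makes the depth uniform in the measure, as in Dini's theorem, and
  \<open>cover_cell\<close> makes it uniform in the point.\<close>

lemma small_cells: assumes "\<delta> > 0" shows "\<exists>m. \<forall>x. \<forall>\<nu>\<in>K. measure \<nu> {y. agree m x y} < \<delta>"
proof -
  have "\<exists>m. \<forall>\<nu>\<in>K. measure \<nu> {y. agree m x y} < \<delta>" for x
  proof -
    let ?A = "\<lambda>i. {y. agree i x y}"
    have "\<exists>i. measure \<nu> (?A i) \<in> {..<\<delta>}" if n: "\<nu> \<in> K" for \<nu>
    proof -
      have "(\<Inter>i. ?A i) = {x}" using agree_all by auto
      moreover have "(\<lambda>i. measure \<nu> (?A i)) \<longlonglongrightarrow> measure \<nu> (\<Inter>i. ?A i)"
        using K_measurable[OF n] cell_clopen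
        by (intro finite_measure.finite_Lim_measure_decseq K_finite n)
           (auto simp: decseq_def intro: agree_mono)
      ultimately have "(\<lambda>i. measure \<nu> (?A i)) \<longlonglongrightarrow> 0" using K_singleton[OF n] by simp
      from order_tendstoD(2)[OF this assms] show ?thesis by (auto simp: eventually_sequentially)
    qed
    then obtain N where N: "\<forall>\<nu>\<in>K. \<exists>i<N. measure \<nu> (?A i) \<in> {..<\<delta>}"
      using K_cover[of ?A "\<lambda>_. {..<\<delta>}"] cell_clopen by auto
    have "measure \<nu> (?A N) < \<delta>" if n: "\<nu> \<in> K" for \<nu>
    proof -
      obtain i where i: "i < N" "measure \<nu> (?A i) < \<delta>" using N n by auto
      have "measure \<nu> (?A N) \<le> measure \<nu> (?A i)"
        by (rule K_mono[OF n cell_clopen]) (use i in \<open>auto intro: agree_mono\<close>)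
      then show ?thesis using i by simp
    qed
    then show ?thesis by blast
  qed
  then obtain m where m: "\<And>x. \<forall>\<nu>\<in>K. measure \<nu> {y. agree (m x) x y} < \<delta>" by metis
  show ?thesis
  proof (rule cover_cell[where m = m])
    show "\<forall>\<nu>\<in>K. measure \<nu> {y. agree (m x) x y} < \<delta>" for x by (rule m)
    fix x y k n assume k: "\<forall>\<nu>\<in>K. measure \<nu> {y. agree k x y} < \<delta>" "k \<le> n" "agree k x y"
    have "measure \<nu> {z. agree n y z} \<le> measure \<nu> {y. agree k x y}" if "\<nu> \<in> K" for \<nu>
      by (rule K_mono[OF that cell_clopen]) (use k agree_mono agree_trans in blast)
    then show "\<forall>\<nu>\<in>K. measure \<nu> {z. agree n y z} < \<delta>" using k(1) by force
  qed
qed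

section \<open>Matched finite partitions and their refinement\<close>

lemma gw_split:
  assumes "clopen C" "clopen D" "eqv C D" "clopen U"
  shows "\<exists>D'. clopen D' \<and> D' \<subseteq> D \<and> eqv (C \<inter> U) D' \<and> eqv (C - U) (D - D')"
\<comment> \<open>A strict inequality between the measures of \<open>C \<inter> U\<close> and
  \<open>D\<close> is required. Full support provides it if \<open>C - U\<close> is nonempty;
  otherwise all of \<open>D\<close> is the partner.\<close>
proof (cases "C - U = {}")
  case True
  then have "C \<inter> U = C" by auto
  then show ?thesis using assms True by (intro exI[of _ D]) (simp add: True eqv_def del: Diff_eq_empty_iff)
next
  case False
  have s: "measure \<nu> C = measure \<nu> (C \<inter> U) + measure \<nu> (C - U)" if "\<nu> \<in> K" for \<nu>
  proof -
    have "measure \<nu> ((C \<inter> U) \<union> (C - U)) = measure \<nu> (C \<inter> U) + measure \<nu> (C - U)"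
      by (rule K_Un[OF that]) (use assms in auto)
    then show ?thesis by (simp add: Int_Diff_Un)
  qed
  have "measure \<nu> (C \<inter> U) < measure \<nu> D" if "\<nu> \<in> K" for \<nu>
    using s[OF that] K_pos[OF that _ False] assms that by (simp add: eqv_def clopen_Diff)
  then obtain D' where D: "clopen D'" "D' \<subseteq> D" "\<forall>\<nu>\<in>K. measure \<nu> (C \<inter> U) = measure \<nu> D'"
    using K_gw[unfolded glasner_weiss_def, rule_format, of "C \<inter> U" D] assms by auto
  have "measure \<nu> (C - U) = measure \<nu> (D - D')" if "\<nu> \<in> K" for \<nu>
    using s[OF that] D that assms K_Diff[OF that assms(2) D(1,2)] by (simp add: eqv_def)
  then show ?thesis using D unfolding eqv_def by blast
qed

text \<open>A measure-preserving correspondence between finite clopen partitions of \<open>A\<close>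
  and \<open>B\<close>, stored as a set of pairs so that \<open>prod.swap\<close> turns it into its
  inverse.\<close>

definition matched :: "'a set \<Rightarrow> 'a set \<Rightarrow> ('a set \<times> 'a set) set \<Rightarrow> bool" where
  "matched A B P \<longleftrightarrow> finite P \<and>
     (\<forall>(C, D)\<in>P. clopen C \<and> clopen D \<and> C \<subseteq> A \<and> D \<subseteq> B \<and> eqv C D) \<and>
     (\<forall>x\<in>A. \<exists>!p. p \<in> P \<and> x \<in> fst p) \<and> (\<forall>y\<in>B. \<exists>!p. p \<in> P \<and> y \<in> snd p)"

definition finer :: "('a set \<times> 'a set) set \<Rightarrow> ('a set \<times> 'a set) set \<Rightarrow> bool" where
  "finer Q P \<longleftrightarrow> (\<forall>q\<in>Q. \<exists>p\<in>P. fst q \<subseteq> fst p \<and> snd q \<subseteq> snd p)"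

lemma matchedD:
  "matched A B P \<Longrightarrow> p \<in> P \<Longrightarrow>
    clopen (fst p) \<and> clopen (snd p) \<and> fst p \<subseteq> A \<and> snd p \<subseteq> B \<and> eqv (fst p) (snd p)"
  unfolding matched_def by (elim conjE) (drule (1) bspec, simp add: case_prod_beta)

lemma eqv_sym: "eqv A B \<Longrightarrow> eqv B A" by (auto simp: eqv_def)

text \<open>Unique existence is split into bounded quantifiers because these pass through images,
  which is how \<open>ex1_swap\<close> is obtained.\<close>

lemma ex1_ball:
  "(\<exists>!q. q \<in> A \<and> Q q) \<longleftrightarrow> (\<exists>q\<in>A. Q q) \<and> (\<forall>q\<in>A. \<forall>q'\<in>A. Q q \<longrightarrow> Q q' \<longrightarrow> q = q')"
  by (simp only: ex1_iff_ex_Uniq Uniq_def) blast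

lemma ex1_swap:
  fixes P :: "('b \<times> 'c) set"
  shows "(\<exists>!q. q \<in> prod.swap ` P \<and> Q q) \<longleftrightarrow> (\<exists>!p. p \<in> P \<and> Q (prod.swap p))"
proof -
  have "prod.swap p = prod.swap q \<longleftrightarrow> p = q" for p q :: "'b \<times> 'c" by (cases p; cases q) auto
  moreover have "(\<exists>q\<in>f ` A. R q) \<longleftrightarrow> (\<exists>p\<in>A. R (f p))" "(\<forall>q\<in>f ` A. R q) \<longleftrightarrow> (\<forall>p\<in>A. R (f p))"
    for f :: "'b \<times> 'c \<Rightarrow> 'c \<times> 'b" and A R by blast+
  ultimately show ?thesis unfolding ex1_ball by (simp only:)
qed

lemma matched_swap: "matched A B P \<Longrightarrow> matched B A (prod.swap ` P)"
proof -
  assume m: "matched A B P"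
  have "(\<exists>!q. q \<in> prod.swap ` P \<and> x \<in> fst q) \<longleftrightarrow> (\<exists>!p. p \<in> P \<and> x \<in> snd p)"
    "(\<exists>!q. q \<in> prod.swap ` P \<and> x \<in> snd q) \<longleftrightarrow> (\<exists>!p. p \<in> P \<and> x \<in> fst p)" for x
    using ex1_swap[of P "\<lambda>q. x \<in> fst q"] ex1_swap[of P "\<lambda>q. x \<in> snd q"] by simp_all
  moreover have "case q of (C, D) \<Rightarrow> clopen C \<and> clopen D \<and> C \<subseteq> B \<and> D \<subseteq> A \<and> eqv C D"
    if q: "q \<in> prod.swap ` P" for q
  proof -
    obtain p where "p \<in> P" "q = prod.swap p" using q by auto
    then show ?thesis using matchedD[OF m] eqv_sym by (auto simp: prod.swap_def)
  qed
  ultimately show ?thesis using m unfolding matched_def by simp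
qed

lemma finer_swap: "finer Q P \<Longrightarrow> finer (prod.swap ` Q) (prod.swap ` P)"
  unfolding finer_def by (metis (no_types, lifting) imageE imageI fst_swap snd_swap)

lemma finer_trans: "finer R Q \<Longrightarrow> finer Q P \<Longrightarrow> finer R P"
  unfolding finer_def by (meson subset_trans)

text \<open>The forth step. Every pair is cut along \<open>U\<close> on the left, and
  \<open>gw_split\<close> cuts its partner into pieces of the same measures; the new pairs are the
  inner and the outer halves.\<close>

lemma matched_refine:
  assumes m: "matched A B P" and U: "clopen U"
  shows "\<exists>Q. matched A B Q \<and> finer Q P \<and> (\<forall>q\<in>Q. fst q \<subseteq> U \<or> fst q \<inter> U = {})"
proof -
  have P: "clopen (fst p) \<and> clopen (snd p) \<and> fst p \<subseteq> A \<and> snd p \<subseteq> B \<and> eqv (fst p) (snd p)" if "p \<in> P" for p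
    using matchedD[OF m that] .
  have "\<forall>p\<in>P. \<exists>D'. clopen D' \<and> D' \<subseteq> snd p \<and> eqv (fst p \<inter> U) D' \<and> eqv (fst p - U) (snd p - D')"
    using gw_split[OF _ _ _ U] P by auto
  then obtain d where d: "\<And>p. p \<in> P \<Longrightarrow>
      clopen (d p) \<and> d p \<subseteq> snd p \<and> eqv (fst p \<inter> U) (d p) \<and> eqv (fst p - U) (snd p - d p)" by metis
  define Q where "Q = (\<lambda>p. (fst p \<inter> U, d p)) ` P \<union> (\<lambda>p. (fst p - U, snd p - d p)) ` P"
  have "matched A B Q" unfolding matched_def
  proof (intro conjI ballI)
    show "finite Q" using m by (auto simp: Q_def matched_def)
    show "case q of (C, D) \<Rightarrow> clopen C \<and> clopen D \<and> C \<subseteq> A \<and> D \<subseteq> B \<and> eqv C D" if "q \<in> Q" for q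
      using that P d U unfolding Q_def by fastforce
    show "\<exists>!q. q \<in> Q \<and> x \<in> fst q" if x: "x \<in> A" for x
    proof -
      obtain p where p: "p \<in> P" "x \<in> fst p" and u: "\<And>p'. p' \<in> P \<Longrightarrow> x \<in> fst p' \<Longrightarrow> p' = p"
        using m x unfolding matched_def by metis
      show ?thesis
      proof (rule ex1I[of _ "if x \<in> U then (fst p \<inter> U, d p) else (fst p - U, snd p - d p)"])
        fix q assume "q \<in> Q \<and> x \<in> fst q"
        then show "q = (if x \<in> U then (fst p \<inter> U, d p) else (fst p - U, snd p - d p))"
          using u unfolding Q_def by auto
      qed (use p in \<open>auto simp: Q_def\<close>)
    qed
    show "\<exists>!q. q \<in> Q \<and> y \<in> snd q" if y: "y \<in> B" for y
    proof -
      obtain p where p: "p \<in> P" "y \<in> snd p" and u: "\<And>p'. p' \<in> P \<Longrightarrow> y \<in> snd p' \<Longrightarrow> p' = p"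
        using m y unfolding matched_def by metis
      show ?thesis
      proof (rule ex1I[of _ "if y \<in> d p then (fst p \<inter> U, d p) else (fst p - U, snd p - d p)"])
        fix q assume q: "q \<in> Q \<and> y \<in> snd q"
        then obtain p' where p': "p' \<in> P" "q = (fst p' \<inter> U, d p') \<or> q = (fst p' - U, snd p' - d p')"
          unfolding Q_def by auto
        then have "y \<in> snd p'" using d[OF p'(1)] q by auto
        then have "p' = p" using u p' by auto
        then show "q = (if y \<in> d p then (fst p \<inter> U, d p) else (fst p - U, snd p - d p))"
          using q p' by auto
      qed (use p in \<open>auto simp: Q_def\<close>)
    qed
  qed
  moreover have "finer Q P" unfolding finer_def
  proof
    fix q assume "q \<in> Q"
    then obtain p where p: "p \<in> P" "q = (fst p \<inter> U, d p) \<or> q = (fst p - U, snd p - d p)"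
      unfolding Q_def by auto
    then show "\<exists>p\<in>P. fst q \<subseteq> fst p \<and> snd q \<subseteq> snd p"
      using d[OF p(1)] by (intro bexI[of _ p]) auto
  qed
  moreover have "\<forall>q\<in>Q. fst q \<subseteq> U \<or> fst q \<inter> U = {}" unfolding Q_def by auto
  ultimately show ?thesis by blast
qed

text \<open>Back as well as forth: the second refinement is the first one applied to the swapped
  pairs. Passing to a finer matching keeps the left sides inside or outside
  \<open>U\<close>.\<close>

lemma matched_refine2:
  assumes m: "matched A B P" and U: "clopen U"
  shows "\<exists>Q. matched A B Q \<and> finer Q P \<and>
    (\<forall>q\<in>Q. (fst q \<subseteq> U \<or> fst q \<inter> U = {}) \<and> (snd q \<subseteq> U \<or> snd q \<inter> U = {}))"
proof -
  obtain Q where Q: "matched A B Q" "finer Q P" "\<forall>q\<in>Q. fst q \<subseteq> U \<or> fst q \<inter> U = {}"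
    using matched_refine[OF assms] by blast
  obtain R where R: "matched B A R" "finer R (prod.swap ` Q)" "\<forall>q\<in>R. fst q \<subseteq> U \<or> fst q \<inter> U = {}"
    using matched_refine[OF matched_swap[OF Q(1)] U] by blast
  have f: "finer (prod.swap ` R) Q" using finer_swap[OF R(2)] by (simp add: image_comp o_def)
  show ?thesis
  proof (intro exI conjI ballI)
    show "matched A B (prod.swap ` R)" using matched_swap[OF R(1)] .
    show "finer (prod.swap ` R) P" using finer_trans[OF f Q(2)] .
    fix q assume q: "q \<in> prod.swap ` R"
    then obtain p where "p \<in> Q" "fst q \<subseteq> fst p" using f unfolding finer_def by blast
    then show "fst q \<subseteq> U \<or> fst q \<inter> U = {}" using Q(3) by blast
    show "snd q \<subseteq> U \<or> snd q \<inter> U = {}" using q R(3) by fastforce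
  qed
qed

section \<open>The limit of a sequence of matched partitions\<close>

definition matching :: "'a set \<Rightarrow> 'a set \<Rightarrow> (nat \<Rightarrow> ('a set \<times> 'a set) set) \<Rightarrow> bool" where
  "matching A B P \<longleftrightarrow> (\<forall>n. matched A B (P n) \<and> finer (P (Suc n)) (P n) \<and>
     (\<forall>q\<in>P (Suc n). (fst q \<subseteq> {x. e x n} \<or> fst q \<inter> {x. e x n} = {}) \<and>
        (snd q \<subseteq> {x. e x n} \<or> snd q \<inter> {x. e x n} = {})))"

text \<open>The limit is kept as a relation since swapping the pairs transposes it; facts about the
  inverse map then follow through \<open>limrel_swap\<close>.\<close>

definition limrel :: "(nat \<Rightarrow> ('a set \<times> 'a set) set) \<Rightarrow> 'a \<Rightarrow> 'a \<Rightarrow> bool" where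
  "limrel P x y \<longleftrightarrow> (\<forall>n. \<exists>p\<in>P n. x \<in> fst p \<and> y \<in> snd p)"

lemma matching_swap: assumes m: "matching A B P" shows "matching B A (\<lambda>n. prod.swap ` P n)"
  unfolding matching_def
proof (intro allI conjI ballI)
  fix n
  show "matched B A (prod.swap ` P n)" "finer (prod.swap ` P (Suc n)) (prod.swap ` P n)"
    using m matched_swap finer_swap unfolding matching_def by metis+
  fix q assume "q \<in> prod.swap ` P (Suc n)"
  then obtain p where "p \<in> P (Suc n)" "fst q = snd p" "snd q = fst p" by auto
  then show "fst q \<subseteq> {x. e x n} \<or> fst q \<inter> {x. e x n} = {}"
      "snd q \<subseteq> {x. e x n} \<or> snd q \<inter> {x. e x n} = {}"
    using m unfolding matching_def by metis+
qed

lemma limrel_swap: "limrel (\<lambda>n. prod.swap ` P n) x y \<longleftrightarrow> limrel P y x"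
proof -
  have "(\<exists>p\<in>prod.swap ` P n. x \<in> fst p \<and> y \<in> snd p) \<longleftrightarrow> (\<exists>p\<in>P n. y \<in> fst p \<and> x \<in> snd p)" for n
  proof
    assume "\<exists>p\<in>P n. y \<in> fst p \<and> x \<in> snd p"
    then obtain p where "p \<in> P n" "y \<in> fst p" "x \<in> snd p" by blast
    then show "\<exists>p\<in>prod.swap ` P n. x \<in> fst p \<and> y \<in> snd p"
      by (intro bexI[of _ "prod.swap p"]) auto
  qed auto
  then show ?thesis unfolding limrel_def by simp
qed

lemma matching_exists:
  assumes "clopen A" "clopen B" "eqv A B" shows "\<exists>P. matching A B P"
proof -
  have "\<exists>P. \<forall>n. matched A B (P n) \<and> finer (P (Suc n)) (P n) \<and>
     (\<forall>q\<in>P (Suc n). (fst q \<subseteq> {x. e x n} \<or> fst q \<inter> {x. e x n} = {}) \<and>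
        (snd q \<subseteq> {x. e x n} \<or> snd q \<inter> {x. e x n} = {}))"
  proof (rule dependent_nat_choice)
    show "\<exists>P. matched A B P"
      by (rule exI[of _ "{(A, B)}"]) (use assms in \<open>auto simp: matched_def\<close>)
  qed (rule matched_refine2[OF _ coord_clopen])
  then show ?thesis by (simp add: matching_def)
qed

lemma matching_agree:
  assumes "matching A B P" "p \<in> P n" "y \<in> snd p" "y' \<in> snd p" shows "agree n y y'"
  using assms(2-4)
proof (induction n arbitrary: p)
  case (Suc n)
  then obtain q where "q \<in> P n" "snd p \<subseteq> snd q" using assms(1) unfolding matching_def finer_def by metis
  then have "agree n y y'" using Suc by blast
  moreover have "e y n = e y' n" using Suc.prems assms(1) unfolding matching_def by blast
  ultimately show ?case by (auto simp: agree_def less_Suc_eq)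
qed (auto simp: agree_def)

text \<open>The left pieces around \<open>x\<close> are nested, hence so are their partners. These
  are nonempty because their measures equal positive ones, so compactness gives a common point
  \<open>y\<close>, and splitting along all coordinates leaves only one.\<close>

lemma limrel_ex1:
  assumes m: "matching A B P" and x: "x \<in> A" shows "\<exists>!y. limrel P x y"
proof -
  have mn: "matched A B (P n)" for n using m by (simp add: matching_def)
  have "\<exists>!p. p \<in> P n \<and> x \<in> fst p" for n using mn[of n] x unfolding matched_def by simp
  then obtain p where p: "\<And>n. p n \<in> P n" "\<And>n. x \<in> fst (p n)"
      and u: "\<And>n p'. p' \<in> P n \<Longrightarrow> x \<in> fst p' \<Longrightarrow> p' = p n" by metis
  have c: "clopen (snd (p n))" "clopen (fst (p n))" "eqv (fst (p n)) (snd (p n))" for n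
    using matchedD[OF mn p(1)[of n]] by auto
  have "\<exists>y. \<forall>n. y \<in> snd (p n)"
  proof (rule clopen_nested)
    show "snd (p n) \<noteq> {}" for n
    proof -
      obtain \<nu> where n: "\<nu> \<in> K" using K_nonempty by auto
      have "measure \<nu> (snd (p n)) > 0" using K_pos[OF n c(2)[of n]] p(2)[of n] c(3)[of n] n by (auto simp: eqv_def)
      then show ?thesis by auto
    qed
    show "snd (p (Suc n)) \<subseteq> snd (p n)" for n
    proof -
      obtain q where "q \<in> P n" "fst (p (Suc n)) \<subseteq> fst q" "snd (p (Suc n)) \<subseteq> snd q"
        using m p(1)[of "Suc n"] unfolding matching_def finer_def by blast
      then show ?thesis using u[of q n] p(2)[of "Suc n"] by blast
    qed
  qed (rule c)
  then obtain y where y: "\<And>n. y \<in> snd (p n)" by blast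
  show ?thesis
  proof (rule ex1I[of _ y])
    show "limrel P x y" unfolding limrel_def using p y by blast
    fix y' assume "limrel P x y'"
    then have "y' \<in> snd (p n)" for n unfolding limrel_def using u by blast
    then show "y' = y" using matching_agree[OF m p(1) _ y] agree_all by blast
  qed
qed

lemma limrel_in: "matching A B P \<Longrightarrow> limrel P x y \<Longrightarrow> x \<in> A \<and> y \<in> B"
proof -
  assume m: "matching A B P" and l: "limrel P x y"
  have "\<forall>n. \<exists>p\<in>P n. x \<in> fst p \<and> y \<in> snd p" using l by (simp add: limrel_def)
  then have "\<exists>p\<in>P 0. x \<in> fst p \<and> y \<in> snd p" by simp
  then obtain p where p: "p \<in> P 0" "x \<in> fst p" "y \<in> snd p" by (elim bexE conjE)
  have "matched A B (P 0)" using m unfolding matching_def by (elim allE conjE)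
  from matchedD[OF this p(1)] p show ?thesis by auto
qed

text \<open>At a level where every left piece lies inside or outside \<open>C\<close>, the image of
  \<open>C\<close> is the finite union of the partners of the inner pieces.\<close>

lemma limrel_image:
  assumes m: "matching A B P" and C: "clopen C" "C \<subseteq> A"
  shows "clopen {y. \<exists>x\<in>C. limrel P x y} \<and> eqv {y. \<exists>x\<in>C. limrel P x y} C"
proof -
  obtain n where n: "\<And>x y. agree n x y \<Longrightarrow> (x \<in> C \<longleftrightarrow> y \<in> C)"
    using C(1) unfolding clopen_iff locconst_def by blast
  define Q where "Q = {p \<in> P n. fst p \<inter> C \<noteq> {}}"
  have mn: "matched A B (P n)" using m unfolding matching_def by blast
  have P: "clopen (fst p) \<and> clopen (snd p) \<and> fst p \<subseteq> A \<and> snd p \<subseteq> B \<and> eqv (fst p) (snd p)" if "p \<in> P n" for p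
    using matchedD[OF mn that] .
  have fin: "finite Q" using mn unfolding matched_def Q_def by auto
  have sub: "fst p \<subseteq> C" if p: "p \<in> Q" for p
  proof
    fix x assume x: "x \<in> fst p"
    obtain z where z: "z \<in> fst p" "z \<in> C" using p unfolding Q_def by blast
    have "agree n z x"
      by (rule matching_agree[OF matching_swap[OF m], of "prod.swap p"]) (use p x z in \<open>auto simp: Q_def\<close>)
    then show "x \<in> C" using n z by blast
  qed
  have img: "{y. \<exists>x\<in>C. limrel P x y} = (\<Union>p\<in>Q. snd p)"
  proof (intro subset_antisym subsetI)
    fix y assume "y \<in> {y. \<exists>x\<in>C. limrel P x y}"
    then show "y \<in> (\<Union>p\<in>Q. snd p)" unfolding limrel_def Q_def by blast
  next
    fix y assume "y \<in> (\<Union>p\<in>Q. snd p)"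
    then obtain p where p: "p \<in> Q" "y \<in> snd p" by blast
    then have yB: "y \<in> B" using P unfolding Q_def by blast
    then obtain x where x: "limrel P x y"
      using limrel_ex1[OF matching_swap[OF m]] unfolding limrel_swap by blast
    then obtain p' where p': "p' \<in> P n" "x \<in> fst p'" "y \<in> snd p'" unfolding limrel_def by blast
    then have "p' = p" using mn yB p unfolding matched_def Q_def by blast
    then show "y \<in> {y. \<exists>x\<in>C. limrel P x y}" using x p' sub p by blast
  qed
  have src: "C = (\<Union>p\<in>Q. fst p)"
  proof (intro subset_antisym subsetI)
    fix x assume x: "x \<in> C"
    then obtain p where "p \<in> P n" "x \<in> fst p" using mn C unfolding matched_def by blast
    then show "x \<in> (\<Union>p\<in>Q. fst p)" using x unfolding Q_def by blast
  qed (use sub in blast)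
  have "eqv (\<Union>p\<in>Q. snd p) (\<Union>p\<in>Q. fst p)" unfolding eqv_def
  proof
    fix \<nu> assume \<nu>: "\<nu> \<in> K"
    have "disjoint_family_on fst Q"
      unfolding disjoint_family_on_def Q_def using mn P unfolding matched_def by blast
    moreover have "disjoint_family_on snd Q"
      unfolding disjoint_family_on_def Q_def using mn P unfolding matched_def by blast
    ultimately have "measure \<nu> (\<Union>p\<in>Q. snd p) = (\<Sum>p\<in>Q. measure \<nu> (snd p))"
        "measure \<nu> (\<Union>p\<in>Q. fst p) = (\<Sum>p\<in>Q. measure \<nu> (fst p))"
      using P K_UNION[OF \<nu> fin] unfolding Q_def by auto
    then show "measure \<nu> (\<Union>p\<in>Q. snd p) = measure \<nu> (\<Union>p\<in>Q. fst p)"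
      using P \<nu> unfolding Q_def eqv_def by (simp cong: sum.cong_simp)
  qed
  moreover have "clopen (\<Union>p\<in>Q. snd p)" using fin P unfolding Q_def by (intro clopen_UNION) auto
  ultimately show ?thesis using img src by simp
qed

lemma khomeo_exists:
  assumes "clopen A" "clopen B" "eqv A B" shows "\<exists>h. khomeo h A B"
proof -
  obtain P where m: "matching A B P" using matching_exists[OF assms] by blast
  note m' = matching_swap[OF m]
  define h where "h = (\<lambda>x. THE y. limrel P x y)"
  have hx: "limrel P x y \<longleftrightarrow> h x = y" if "x \<in> A" for x y
  proof
    show "limrel P x y \<Longrightarrow> h x = y" unfolding h_def by (rule the1_equality[OF limrel_ex1[OF m that]])
    show "h x = y \<Longrightarrow> limrel P x y" unfolding h_def using theI'[OF limrel_ex1[OF m that]] by simp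
  qed
  have ex: "\<exists>!x. limrel P x y" if "y \<in> B" for y using limrel_ex1[OF m' that] by (simp add: limrel_swap)
  have im: "h ` C = {y. \<exists>x\<in>C. limrel P x y}" if "C \<subseteq> A" for C
  proof -
    have "\<exists>x\<in>C. h x = y \<Longrightarrow> \<exists>x\<in>C. limrel P x y" "\<exists>x\<in>C. limrel P x y \<Longrightarrow> \<exists>x\<in>C. h x = y" for y
      using hx that by (metis subsetD)+
    then show ?thesis by blast
  qed
  have pre: "A \<inter> h -` D = {x. \<exists>y\<in>D. limrel P x y}" for D
  proof -
    have "x \<in> A \<and> h x \<in> D \<longleftrightarrow> (\<exists>y\<in>D. limrel P x y)" for x
      using hx[of x] limrel_in[OF m, of x] by metis
    then show ?thesis by blast
  qed
  have "bij_betw h A B" unfolding bij_betw_def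
  proof
    show "inj_on h A"
    proof (rule inj_onI)
      fix x x' assume x: "x \<in> A" "x' \<in> A" "h x = h x'"
      then have "limrel P x (h x)" "limrel P x' (h x)" using hx by auto
      then show "x = x'" using ex limrel_in[OF m] by metis
    qed
    show "h ` A = B" unfolding im[OF subset_refl]
    proof (intro subset_antisym subsetI)
      fix y assume "y \<in> B"
      then obtain x where "limrel P x y" using ex by metis
      then show "y \<in> {y. \<exists>x\<in>A. limrel P x y}" using limrel_in[OF m] by auto
    qed (use limrel_in[OF m] in auto)
  qed
  then have "khomeo h A B" unfolding khomeo_def
    using limrel_image[OF m] limrel_image[OF m', unfolded limrel_swap] by (auto simp: im pre)
  then show ?thesis by blast
qed

section \<open>Composing and swapping measure-preserving homeomorphisms\<close>

lemma khomeo_id: "khomeo (\<lambda>x. x) UNIV UNIV"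
  by (simp add: khomeo_def eqv_def bij_betw_def)

lemma khomeoD:
  assumes "khomeo h A B"
  shows "bij_betw h A B" "clopen C \<Longrightarrow> C \<subseteq> A \<Longrightarrow> clopen (h ` C)" "clopen C \<Longrightarrow> C \<subseteq> A \<Longrightarrow> eqv (h ` C) C"
    "clopen D \<Longrightarrow> D \<subseteq> B \<Longrightarrow> clopen (A \<inter> h -` D)" "clopen D \<Longrightarrow> D \<subseteq> B \<Longrightarrow> eqv (A \<inter> h -` D) D"
  using assms unfolding khomeo_def by (elim conjE; simp)+

lemma khomeo_UNIVD:
  assumes "khomeo h UNIV UNIV"
  shows "bij h" "clopen C \<Longrightarrow> clopen (h ` C)" "clopen C \<Longrightarrow> eqv (h ` C) C"
    "clopen C \<Longrightarrow> clopen (h -` C)" "clopen C \<Longrightarrow> eqv (h -` C) C"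
  using khomeoD[OF assms] by simp_all

lemma khomeo_comp:
  assumes g: "khomeo g UNIV UNIV" and h: "khomeo h UNIV UNIV" shows "khomeo (\<lambda>x. g (h x)) UNIV UNIV"
proof -
  note g = khomeo_UNIVD[OF g] and h = khomeo_UNIVD[OF h]
  have "bij (\<lambda>x. g (h x))" using bij_comp[OF h(1) g(1)] by (simp add: o_def)
  moreover have "clopen ((\<lambda>x. g (h x)) ` C) \<and> eqv ((\<lambda>x. g (h x)) ` C) C" if "clopen C" for C
    using g(2,3)[OF h(2)[OF that]] h(3)[OF that] by (simp add: image_image eqv_def)
  moreover have "clopen ((\<lambda>x. g (h x)) -` C) \<and> eqv ((\<lambda>x. g (h x)) -` C) C" if "clopen C" for C
    using h(4,5)[OF g(4)[OF that]] g(5)[OF that] by (simp add: vimage_def eqv_def)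
  ultimately show ?thesis unfolding khomeo_def by simp
qed

text \<open>Glue a homeomorphism from \<open>T1\<close> to \<open>T2\<close> with its inverse. The
  result is an involution, for which images and preimages coincide, so one half of
  \<open>khomeo\<close> implies the other.\<close>

lemma swap_exists:
  assumes T: "clopen T1" "clopen T2" "T1 \<inter> T2 = {}" "eqv T1 T2"
  shows "\<exists>s. khomeo s UNIV UNIV \<and> (\<forall>x. s (s x) = x) \<and> s ` T1 = T2 \<and> (\<forall>x. x \<notin> T1 \<union> T2 \<longrightarrow> s x = x)"
proof -
  obtain h where h: "khomeo h T1 T2" using khomeo_exists[OF T(1,2,4)] by blast
  note h = khomeoD[OF h]
  define s where "s = (\<lambda>x. if x \<in> T1 then h x else if x \<in> T2 then inv_into T1 h x else x)"
  have hT: "h x \<in> T2" if "x \<in> T1" for x using h(1) that by (auto simp: bij_betw_def)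
  have iT: "inv_into T1 h y \<in> T1" "h (inv_into T1 h y) = y" if "y \<in> T2" for y
    using h(1) that by (auto simp: bij_betw_def inv_into_into f_inv_into_f)
  have ih: "inv_into T1 h (h x) = x" if "x \<in> T1" for x
    using h(1) that by (auto simp: bij_betw_def)
  have inv: "s (s x) = x" for x
    using hT[of x] iT[of x] ih[of x] T(3) unfolding s_def by auto
  have im: "s ` C = s -` C" for C
  proof (intro set_eqI iffI)
    fix x assume "x \<in> s -` C"
    then have "s x \<in> C" "x = s (s x)" using inv by auto
    then show "x \<in> s ` C" by blast
  qed (use inv in auto)
  have bij: "bij s" by (rule involuntory_imp_bij) (rule inv)
  have img: "s ` T1 = T2" using h(1) unfolding s_def bij_betw_def by auto
  have key: "clopen (s -` D) \<and> eqv (s -` D) D" if D: "clopen D" for D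
  proof -
    have d: "clopen (D \<inter> T1)" "clopen (D \<inter> T2)" "clopen (D - (T1 \<union> T2))" using D T by auto
    have eq: "s -` D = ((T1 \<inter> h -` (D \<inter> T2)) \<union> h ` (D \<inter> T1)) \<union> (D - (T1 \<union> T2))"
    proof (intro set_eqI)
      fix x
      show "x \<in> s -` D \<longleftrightarrow> x \<in> ((T1 \<inter> h -` (D \<inter> T2)) \<union> h ` (D \<inter> T1)) \<union> (D - (T1 \<union> T2))"
      proof (cases "x \<in> T1")
        case True
        then have "x \<notin> h ` (D \<inter> T1)" using hT T(3) by blast
        then show ?thesis using True hT by (auto simp: s_def)
      next
        case F: False
        show ?thesis
        proof (cases "x \<in> T2")
          case True
          then have "x \<in> h ` (D \<inter> T1) \<longleftrightarrow> inv_into T1 h x \<in> D"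
            using iT[OF True] ih by force
          then show ?thesis using True F by (auto simp: s_def)
        next
          case False then have "x \<notin> h ` (D \<inter> T1)" using hT by blast
          then show ?thesis using F False by (auto simp: s_def)
        qed
      qed
    qed
    have c: "clopen (T1 \<inter> h -` (D \<inter> T2))" "eqv (T1 \<inter> h -` (D \<inter> T2)) (D \<inter> T2)"
      "clopen (h ` (D \<inter> T1))" "eqv (h ` (D \<inter> T1)) (D \<inter> T1)"
      using h(4,5)[OF d(2) Int_lower2] h(2,3)[OF d(1) Int_lower2] by (simp_all del: vimage_Int)
    have "measure \<nu> (s -` D) = measure \<nu> D" if n: "\<nu> \<in> K" for \<nu>
    proof -
      have hs: "h ` (D \<inter> T1) \<subseteq> T2" using hT by blast
      have "measure \<nu> (s -` D) = measure \<nu> ((T1 \<inter> h -` (D \<inter> T2)) \<union> h ` (D \<inter> T1)) + measure \<nu> (D - (T1 \<union> T2))"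
        unfolding eq by (rule K_Un[OF n _ d(3)]) (use c hs in auto)
      also have "measure \<nu> ((T1 \<inter> h -` (D \<inter> T2)) \<union> h ` (D \<inter> T1)) =
          measure \<nu> (T1 \<inter> h -` (D \<inter> T2)) + measure \<nu> (h ` (D \<inter> T1))"
        by (rule K_Un[OF n c(1,3)]) (use hs T(3) in auto)
      also have "\<dots> = measure \<nu> (D \<inter> T2) + measure \<nu> (D \<inter> T1)"
        using c n by (simp add: eqv_def)
      also have "\<dots> = measure \<nu> ((D \<inter> T2) \<union> (D \<inter> T1))"
        by (rule K_Un[OF n d(2,1), symmetric]) (use T(3) in auto)
      also have "\<dots> + measure \<nu> (D - (T1 \<union> T2)) = measure \<nu> (((D \<inter> T2) \<union> (D \<inter> T1)) \<union> (D - (T1 \<union> T2)))"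
        by (rule K_Un[OF n _ d(3), symmetric]) (use d in auto)
      also have "((D \<inter> T2) \<union> (D \<inter> T1)) \<union> (D - (T1 \<union> T2)) = D" by blast
      finally show ?thesis .
    qed
    moreover have "clopen (s -` D)" unfolding eq using c d by simp
    ultimately show ?thesis by (simp add: eqv_def)
  qed
  have "khomeo s UNIV UNIV" unfolding khomeo_def using bij key by (simp add: im)
  moreover have "\<forall>x. x \<notin> T1 \<union> T2 \<longrightarrow> s x = x" by (simp add: s_def)
  ultimately show ?thesis using inv img by blast
qed

section \<open>Approximate divisibility\<close>

lemma has_integral_le:
  fixes a b :: real
  assumes "has_bochner_integral M f a" "has_bochner_integral M g b" "\<And>x. f x \<le> g x"
  shows "a \<le> b"
  using integral_mono[of M f g] assms by (auto simp: has_bochner_integral_iff)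

lemma has_integral_indicators:
  assumes n: "\<nu> \<in> K" and "finite I" "\<And>i. i \<in> I \<Longrightarrow> clopen (A i)"
  shows "has_bochner_integral \<nu> (\<lambda>u. \<Sum>i\<in>I. a i * indicator (A i) u :: real) (\<Sum>i\<in>I. a i * measure \<nu> (A i))"
proof (intro has_bochner_integral_sum)
  fix i assume i: "i \<in> I"
  have "emeasure \<nu> (A i) < \<infinity>" using finite_measure.emeasure_finite[OF K_finite[OF n]] by (simp add: less_top)
  then show "has_bochner_integral \<nu> (\<lambda>u. a i * indicator (A i) u) (a i * measure \<nu> (A i))"
    using K_measurable[OF n assms(3)[OF i]]
    by (intro has_bochner_integral_mult_right has_bochner_integral_real_indicator) auto
qed

text \<open>Cells of one sufficiently large depth are smaller than the positive lower bound of the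
  measures of \<open>U\<close>. Each piece then fits into \<open>U\<close> by the Glasner--Weiss
  condition.\<close>

lemma small_partition:
  assumes A: "clopen A" and U: "clopen U" "U \<noteq> {}"
  shows "\<exists>(k::nat) E. (\<forall>i<k. clopen (E i) \<and> (\<forall>\<nu>\<in>K. measure \<nu> (E i) < measure \<nu> U)) \<and>
    disjoint_family_on E {..<k} \<and> (\<Union>i<k. E i) = A"
proof -
  obtain \<delta> where \<delta>: "\<delta> > 0" "\<forall>\<nu>\<in>K. \<delta> \<le> measure \<nu> U" using K_lower[OF U] by blast
  obtain m where m: "\<And>x \<nu>. \<nu> \<in> K \<Longrightarrow> measure \<nu> {y. agree m x y} < \<delta>" using small_cells[OF \<delta>(1)] by blast
  define S where "S = {l :: bool list. length l = m}"
  define k where "k = card S"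
  obtain f where f: "bij_betw f {0..<k} S"
    using ex_bij_betw_nat_finite[OF finite_code, of m] unfolding S_def k_def by blast
  have inj: "inj_on f {0..<k}" and img: "f ` {0..<k} = S" using f by (simp_all add: bij_betw_def)
  let ?E = "\<lambda>i. A \<inter> cyl (f i)"
  have fS: "length (f i) = m" if "i < k" for i using img that by (auto simp: S_def)
  have "measure \<nu> (?E i) < measure \<nu> U" if "i < k" "\<nu> \<in> K" for i \<nu>
  proof (cases "cyl (f i) = {}")
    case True then show ?thesis using \<delta> that(2) by force
  next
    case False
    then obtain x where x: "x \<in> cyl (f i)" by blast
    have "cyl (f i) = {y. agree m x y}" using x fS[OF that(1)] by (auto simp: cyl_def agree_def)
    then have "measure \<nu> (cyl (f i)) < \<delta>" using m[OF that(2)] by simp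
    moreover have "measure \<nu> (?E i) \<le> measure \<nu> (cyl (f i))" by (rule K_mono[OF that(2)]) auto
    ultimately show ?thesis using \<delta>(2) that(2) by force
  qed
  moreover have "disjoint_family_on ?E {..<k}" unfolding disjoint_family_on_def
  proof (intro ballI impI)
    fix i j assume ij: "i \<in> {..<k}" "j \<in> {..<k}" "i \<noteq> j"
    then have "f i \<noteq> f j" using inj_onD[OF inj, of i j] by auto
    then have "cyl (f i) \<inter> cyl (f j) = {}"
      using fS ij by (auto simp: cyl_def list_eq_iff_nth_eq)
    then show "?E i \<inter> ?E j = {}" by blast
  qed
  moreover have "(\<Union>i<k. ?E i) = A"
  proof (intro subset_antisym subsetI)
    fix x assume "x \<in> A"
    moreover have "map (e x) [0..<m] \<in> f ` {0..<k}" unfolding img by (simp add: S_def)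
    then obtain i where "i < k" "map (e x) [0..<m] = f i" by auto
    moreover have "x \<in> cyl (map (e x) [0..<m])" by (simp flip: cell_eq)
    ultimately show "x \<in> (\<Union>i<k. ?E i)" by auto
  qed auto
  ultimately show ?thesis using A by (intro exI[of _ k] exI[of _ ?E]) auto
qed

text \<open>Selecting a member of a stack when the number of its predecessors is n - 1 modulo n
  picks the n-th, 2n-th, ... one, that is, one from each complete block of \<open>n\<close>.\<close>

lemma count_div:
  fixes n k :: nat
  notes sum_of_bool_eq [simp del]
  assumes "n > 0"
  shows "(\<Sum>i<k. of_bool (b i \<and> (\<Sum>j<i. of_bool (b j) :: nat) mod n = n - 1) :: nat) = (\<Sum>j<k. of_bool (b j)) div n"
proof (induction k)
  case (Suc k)
  then show ?case using assms by (cases "b k") (auto simp: div_Suc mod_Suc Suc_eq_plus1[symmetric])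
qed simp

lemma divide:
  notes sum_of_bool_eq [simp del]
  assumes A: "clopen A" and n: "0 < (n::nat)" and \<epsilon>: "0 < (\<epsilon>::real)"
  shows "\<exists>B. clopen B \<and> B \<subseteq> A \<and>
    (\<forall>\<nu>\<in>K. measure \<nu> A - \<epsilon> \<le> real n * measure \<nu> B \<and> real n * measure \<nu> B \<le> measure \<nu> A)"
proof -
  \<comment> \<open>Each stack loses fewer than \<open>n\<close> points to its incomplete last
    block, so the total loss is at most n times the measure of \<open>U\<close>; this dictates
    \<epsilon> / n.\<close>
  obtain m where m: "\<And>x \<nu>. \<nu> \<in> K \<Longrightarrow> measure \<nu> {y. agree m x y} < \<epsilon> / n"
    using small_cells[of "\<epsilon> / n"] n \<epsilon> by auto
  define U where "U = {y. agree m undefined y}"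
  have U: "clopen U" "U \<noteq> {}" by (auto simp: U_def intro: exI[of _ undefined])
  have Um: "real n * measure \<nu> U \<le> \<epsilon>" if "\<nu> \<in> K" for \<nu>
    using m[OF that, of undefined] n by (simp add: U_def field_simps)
  obtain k :: nat and E where E: "\<And>i. i < k \<Longrightarrow> clopen (E i)"
      "\<And>i \<nu>. i < k \<Longrightarrow> \<nu> \<in> K \<Longrightarrow> measure \<nu> (E i) < measure \<nu> U"
      and disj: "disjoint_family_on E {..<k}" and AE: "(\<Union>i<k. E i) = A"
    using small_partition[OF A U] by blast
  have "\<exists>C. clopen C \<and> C \<subseteq> U \<and> eqv (E i) C" if "i < k" for i
    using K_gw[unfolded glasner_weiss_def, rule_format, of "E i" U] E that U unfolding eqv_def by auto
  then have "\<forall>i\<in>{..<k}. \<exists>C. clopen C \<and> C \<subseteq> U \<and> eqv (E i) C" by simp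
  from bchoice[OF this] obtain C where
    C: "\<And>i. i < k \<Longrightarrow> clopen (C i)" "\<And>i. i < k \<Longrightarrow> C i \<subseteq> U" "\<And>i. i < k \<Longrightarrow> eqv (E i) (C i)"
    by auto
  have "\<forall>i\<in>{..<k}. \<exists>h. khomeo h (E i) (C i)" using khomeo_exists E(1) C by simp
  from bchoice[OF this] obtain h where h: "\<And>i. i < k \<Longrightarrow> khomeo (h i) (E i) (C i)" by auto
  \<comment> \<open>\<open>c i u\<close> counts the points of the stack over \<open>u\<close> below
    level \<open>i\<close>, and \<open>D i\<close> is the part of level \<open>i\<close> that
    completes a block of \<open>n\<close>.\<close>
  define c where "c = (\<lambda>i u. \<Sum>j<i. of_bool (u \<in> C j) :: nat)"
  define D where "D = (\<lambda>i. {u \<in> C i. c i u mod n = n - 1})"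
  define B where "B = (\<Union>i<k. E i \<inter> h i -` D i)"
  have lc: "locconst (c i)" if "i \<le> k" for i
    using that
  proof (induction i)
    case (Suc i)
    have "locconst (\<lambda>u. of_bool (u \<in> C i) :: nat)"
      using locconst_fun[of "\<lambda>u. u \<in> C i" of_bool] C(1)[of i] Suc.prems by (simp add: clopen_iff)
    from locconst_op[OF _ this, of "c i" "(+)"] have "locconst (\<lambda>u. c i u + of_bool (u \<in> C i))"
      using Suc by simp
    then show ?case by (simp add: c_def)
  qed (simp add: c_def)
  have D: "clopen (D i)" if "i < k" for i
  proof -
    have "D i = C i \<inter> {u. c i u mod n = n - 1}" by (auto simp: D_def)
    then show ?thesis
      using clopen_Int[OF C(1)[OF that] locconst_clopen[OF lc, of i "\<lambda>c. c mod n = n - 1"]] that by simp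
  qed
  have DC: "D i \<subseteq> C i" for i by (auto simp: D_def)
  have Bi: "clopen (E i \<inter> h i -` D i)" "eqv (E i \<inter> h i -` D i) (D i)" if "i < k" for i
    using khomeoD(4,5)[OF h[OF that] D[OF that] DC] by auto
  have "measure \<nu> A - \<epsilon> \<le> real n * measure \<nu> B \<and> real n * measure \<nu> B \<le> measure \<nu> A" if \<nu>: "\<nu> \<in> K" for \<nu>
  proof -
    have mA: "measure \<nu> A = (\<Sum>i<k. 1 * measure \<nu> (C i))"
      unfolding AE[symmetric] using K_UNION[OF \<nu>, of "{..<k}" E] E disj C(3) \<nu> by (simp add: eqv_def)
    have "disjoint_family_on (\<lambda>i. E i \<inter> h i -` D i) {..<k}"
      using disj unfolding disjoint_family_on_def by blast
    then have mB: "measure \<nu> B = (\<Sum>i<k. measure \<nu> (D i))"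
      unfolding B_def using K_UNION[OF \<nu>, of "{..<k}" "\<lambda>i. E i \<inter> h i -` D i"] Bi \<nu> by (simp add: eqv_def)
    \<comment> \<open>Everything is now compared over \<open>U\<close>: the stack height integrates
      to the measure of \<open>A\<close>, the selected levels to that of \<open>B\<close>, and the
      pointwise bounds below are those of division with remainder.\<close>
    have iC: "has_bochner_integral \<nu> (\<lambda>u. \<Sum>i<k. 1 * indicator (C i) u) (measure \<nu> A)"
      unfolding mA by (rule has_integral_indicators[OF \<nu>]) (use C in auto)
    have iD: "has_bochner_integral \<nu> (\<lambda>u. \<Sum>i<k. real n * indicator (D i) u) (real n * measure \<nu> B)"
      unfolding mB sum_distrib_left by (rule has_integral_indicators[OF \<nu>]) (use D in auto)
    have iU: "has_bochner_integral \<nu> (\<lambda>u. \<Sum>i<(1::nat). real n * indicator U u) (real n * measure \<nu> U)"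
      using has_integral_indicators[OF \<nu>, of "{..<1::nat}" "\<lambda>_. U" "\<lambda>_. real n"] U by simp
    have sC: "(\<Sum>i<k. 1 * indicator (C i) u) = real (c k u)" for u
      by (auto simp: c_def indicator_def of_bool_def intro!: sum.cong)
    have sD: "(\<Sum>i<k. real n * indicator (D i) u) = real n * real (c k u div n)" for u
    proof -
      have "(\<Sum>i<k. real n * indicator (D i) u) =
          real n * real (\<Sum>i<k. of_bool (u \<in> C i \<and> (\<Sum>j<i. of_bool (u \<in> C j) :: nat) mod n = n - 1))"
        unfolding sum_distrib_left[symmetric] of_nat_sum
        by (intro arg_cong[where f = "\<lambda>x. real n * x"] sum.cong) (auto simp: D_def c_def)
      then show ?thesis unfolding count_div[OF n] c_def .
    qed
    have c0: "c k u = 0" if "u \<notin> U" for u using C(2) that by (auto simp: c_def)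
    have 1: "(\<Sum>i<k. real n * indicator (D i) u) \<le> (\<Sum>i<k. 1 * indicator (C i) u :: real)" for u
      unfolding sC sD using div_times_less_eq_dividend[of "c k u" n]
      by (metis mult.commute of_nat_le_iff of_nat_mult)
    have 2: "(\<Sum>i<k. 1 * indicator (C i) u :: real) \<le>
        (\<Sum>i<k. real n * indicator (D i) u) + (\<Sum>i<(1::nat). real n * indicator U u)" for u
    proof (cases "u \<in> U")
      case True
      have "c k u \<le> n * (c k u div n) + n"
        using mult_div_mod_eq[of n "c k u"] mod_less_divisor[OF n, of "c k u"] by linarith
      then have "real (c k u) \<le> real n * real (c k u div n) + real n"
        by (metis of_nat_add of_nat_le_iff of_nat_mult)
      then show ?thesis unfolding sC sD using True by simp
    next
      case False then show ?thesis unfolding sC sD using c0 by simp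
    qed
    have "real n * measure \<nu> B \<le> measure \<nu> A"
      by (rule has_integral_le[OF iD iC 1])
    moreover have "measure \<nu> A \<le> real n * measure \<nu> B + real n * measure \<nu> U"
      by (rule has_integral_le[OF iC has_bochner_integral_add[OF iD iU] 2])
    ultimately show ?thesis using Um[OF \<nu>] by linarith
  qed
  moreover have "clopen B" unfolding B_def by (rule clopen_UNION) (use Bi in simp_all)
  moreover have "B \<subseteq> A" unfolding B_def AE[symmetric] by auto
  ultimately show ?thesis by blast
qed

text \<open>\<open>divide\<close> supplies the measure of one copy, and the Glasner--Weiss condition
  the copies themselves. The latter needs strict inequality at every step, even the last one; the
  cell \<open>Z\<close>, of measure below \<epsilon> / 2, is reserved for this.\<close>

lemma copies:
  assumes A: "clopen A" and n: "0 < (n::nat)" and \<epsilon>: "0 < (\<epsilon>::real)"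
  shows "\<exists>B. (\<forall>i<n. clopen (B i) \<and> B i \<subseteq> A \<and> eqv (B 0) (B i)) \<and> disjoint_family_on B {..<n} \<and>
    (\<forall>\<nu>\<in>K. measure \<nu> (A - (\<Union>i<n. B i)) \<le> \<epsilon>)"
proof (cases "A = {}")
  case True
  then show ?thesis using \<epsilon> by (intro exI[of _ "\<lambda>_. {}"]) (auto simp: eqv_def disjoint_family_on_def)
next
  case False
  then obtain x where x: "x \<in> A" by blast
  obtain m where m: "\<And>\<nu>. \<nu> \<in> K \<Longrightarrow> measure \<nu> {y. agree m x y} < \<epsilon> / 2"
    using small_cells[of "\<epsilon> / 2"] \<epsilon> by auto
  define Z where "Z = A \<inter> {y. agree m x y}"
  have Z: "clopen Z" "Z \<noteq> {}" "Z \<subseteq> A" using A x by (auto simp: Z_def)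
  obtain B0 where B0: "clopen B0" "B0 \<subseteq> A - Z"
      "\<And>\<nu>. \<nu> \<in> K \<Longrightarrow> measure \<nu> (A - Z) - \<epsilon> / 2 \<le> real n * measure \<nu> B0"
      "\<And>\<nu>. \<nu> \<in> K \<Longrightarrow> real n * measure \<nu> B0 \<le> measure \<nu> (A - Z)"
    using divide[of "A - Z" n "\<epsilon> / 2"] A Z n \<epsilon> by auto
  have lt: "real n * measure \<nu> B0 < measure \<nu> A" if "\<nu> \<in> K" for \<nu>
    using B0(4)[OF that] K_Diff[OF that A Z(1,3)] K_pos[OF that Z(1,2)] by simp
  have rem: "measure \<nu> (A - (\<Union>i<k. B i)) = measure \<nu> A - real k * measure \<nu> B0"
    if "\<nu> \<in> K" and B: "\<And>i. i < k \<Longrightarrow> clopen (B i) \<and> B i \<subseteq> A \<and> eqv B0 (B i)" "disjoint_family_on B {..<k}"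
    for \<nu> B k
  proof -
    have "measure \<nu> (\<Union>i<k. B i) = (\<Sum>i<k. measure \<nu> (B i))"
      by (rule K_UNION[OF that(1)]) (use B in auto)
    also have "\<dots> = (\<Sum>i<k. measure \<nu> B0)" using B(1) that(1) by (intro sum.cong) (auto simp: eqv_def)
    finally have "measure \<nu> (\<Union>i<k. B i) = real k * measure \<nu> B0" by simp
    moreover have "measure \<nu> (A - (\<Union>i<k. B i)) = measure \<nu> A - measure \<nu> (\<Union>i<k. B i)"
      by (rule K_Diff[OF that(1) A clopen_UNION]) (use B in auto)
    ultimately show ?thesis by simp
  qed
  have "\<exists>B. (\<forall>i<k. clopen (B i) \<and> B i \<subseteq> A \<and> eqv B0 (B i)) \<and> disjoint_family_on B {..<k}" if "k \<le> n" for k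
    using that
  proof (induction k)
    case (Suc k)
    then obtain B where B: "\<And>i. i < k \<Longrightarrow> clopen (B i) \<and> B i \<subseteq> A \<and> eqv B0 (B i)" "disjoint_family_on B {..<k}"
      by auto
    have "measure \<nu> B0 < measure \<nu> (A - (\<Union>i<k. B i))" if "\<nu> \<in> K" for \<nu>
    proof -
      have "real (Suc k) * measure \<nu> B0 \<le> real n * measure \<nu> B0"
        using Suc.prems by (intro mult_right_mono) auto
      then show ?thesis using rem[OF that B] lt[OF that] by (simp add: algebra_simps)
    qed
    moreover have "clopen (A - (\<Union>i<k. B i))" using A B by (intro clopen_Diff clopen_UNION) auto
    ultimately obtain C where C: "clopen C" "C \<subseteq> A - (\<Union>i<k. B i)" "eqv B0 C"
      using K_gw[unfolded glasner_weiss_def, rule_format, of B0 "A - (\<Union>i<k. B i)"] B0(1) unfolding eqv_def by auto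
    show ?case
    proof (intro exI[of _ "B(k := C)"] conjI allI impI)
      fix i assume "i < Suc k"
      then show "clopen ((B(k := C)) i)" "(B(k := C)) i \<subseteq> A" "eqv B0 ((B(k := C)) i)"
        using B(1)[of i] C by (auto simp: less_Suc_eq)
    next
      show "disjoint_family_on (B(k := C)) {..<Suc k}"
        using B(2) C(2) unfolding disjoint_family_on_def by (auto simp: less_Suc_eq; blast)
    qed
  qed (simp add: disjoint_family_on_def)
  from this[OF order_refl] obtain B where
    B: "\<And>i. i < n \<Longrightarrow> clopen (B i) \<and> B i \<subseteq> A \<and> eqv B0 (B i)" "disjoint_family_on B {..<n}"
    by auto
  have "measure \<nu> (A - (\<Union>i<n. B i)) \<le> \<epsilon>" if "\<nu> \<in> K" for \<nu>
  proof -
    have "measure \<nu> Z \<le> measure \<nu> {y. agree m x y}" by (rule K_mono[OF that]) (auto simp: Z_def)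
    then show ?thesis
      using rem[OF that B] B0(3)[OF that] K_Diff[OF that A Z(1,3)] m[OF that] by linarith
  qed
  moreover have "eqv (B 0) (B i)" if "i < n" for i using B(1)[OF n] B(1)[OF that] by (auto simp: eqv_def)
  ultimately show ?thesis using B by blast
qed

section \<open>Cutting and stacking\<close>

text \<open>The value does not mention \<open>g\<close>. Comparing with the instance for the
  identity gives invariance of the integral under \<open>g\<close>.\<close>

lemma has_integral_comp:
  assumes n: "\<nu> \<in> K" and f: "locconst (f :: 'a \<Rightarrow> real)" and g: "khomeo g UNIV UNIV"
  shows "has_bochner_integral \<nu> (\<lambda>x. f (g x)) (\<Sum>v\<in>range f. v * measure \<nu> (f -` {v}))"
proof -
  have c: "clopen (f -` {v})" for v using locconst_clopen[OF f, of "\<lambda>y. y = v"] by (simp add: vimage_def)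
  note g = khomeo_UNIVD(4,5)[OF g c]
  have fin: "finite (range f)" by (rule locconst_finite_range[OF f])
  have "has_bochner_integral \<nu> (\<lambda>x. \<Sum>v\<in>range f. v * indicator (g -` (f -` {v})) x)
      (\<Sum>v\<in>range f. v * measure \<nu> (g -` (f -` {v})))"
    by (rule has_integral_indicators[OF n fin]) (use g in simp)
  moreover have "(\<Sum>v\<in>range f. v * indicator (g -` (f -` {v})) x) = f (g x)" for x
  proof -
    have "(\<Sum>v\<in>range f. v * indicator (g -` (f -` {v})) x) = (\<Sum>v\<in>range f. if v = f (g x) then v else 0)"
      by (intro sum.cong) (auto simp: indicator_def)
    then show ?thesis using fin by simp
  qed
  moreover have "measure \<nu> (g -` (f -` {v})) = measure \<nu> (f -` {v})" for v
    using g n by (simp add: eqv_def)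
  ultimately show ?thesis by simp
qed

lemmas has_integral_locconst = has_integral_comp[OF _ _ khomeo_id]

text \<open>A locally constant function takes finitely many values on clopen level sets, so its
  integral is continuous on \<open>K\<close> and attains a minimum.\<close>

lemma integral_lower:
  assumes f: "locconst (f :: 'a \<Rightarrow> real)" and pos: "\<And>\<nu>. \<nu> \<in> K \<Longrightarrow> 0 < integral\<^sup>L \<nu> f"
  shows "\<exists>\<delta>>0. \<forall>\<nu>\<in>K. \<delta> \<le> integral\<^sup>L \<nu> f"
proof -
  let ?F = "\<lambda>\<nu>. \<Sum>v\<in>range f. v * measure \<nu> (f -` {v})"
  have c: "clopen (f -` {v})" for v using locconst_clopen[OF f, of "\<lambda>y. y = v"] by (simp add: vimage_def)
  have F: "integral\<^sup>L \<nu> f = ?F \<nu>" if "\<nu> \<in> K" for \<nu>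
    using has_bochner_integral_integral_eq[OF has_integral_locconst[OF that f]] .
  have "continuous_map prob_topology euclideanreal ?F"
    by (intro continuous_map_sum locconst_finite_range f continuous_map_real_mult_left continuous_measure c)
  from K_attains[OF this] obtain \<nu>0 where "\<nu>0 \<in> K" "\<forall>\<nu>\<in>K. ?F \<nu>0 \<le> ?F \<nu>" by blast
  then show ?thesis using pos[of \<nu>0] F by (intro exI[of _ "?F \<nu>0"]) simp
qed

text \<open>\<open>g\<close> is periodic with transversal \<open>T\<close>, \<open>g ` T\<close> being the set of first points of the orbits, and
  \<open>\<tau>\<close> sends a point to the element of \<open>T\<close> on its orbit. Then \<open>u x\<close> is the sum of \<open>f\<close> over the points
  preceding \<open>x\<close>, so \<open>u t + f t\<close> is the full orbit sum for \<open>t \<in> T\<close>.\<close>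

definition solves :: "('a \<Rightarrow> 'a) \<Rightarrow> 'a set \<Rightarrow> ('a \<Rightarrow> int) \<Rightarrow> ('a \<Rightarrow> int) \<Rightarrow> bool" where
  "solves g T f u \<longleftrightarrow> locconst u \<and> (\<forall>x\<in>T. u (g x) = 0) \<and> (\<forall>x. x \<notin> T \<longrightarrow> u (g x) = u x + f x)"

text \<open>Periodicity and towers are not recorded explicitly. The constructions use only the
  retraction \<open>\<tau>\<close> along orbits and the fact that every locally constant integer
  function can be summed along them.\<close>

definition stage :: "('a \<Rightarrow> 'a) \<Rightarrow> 'a set \<Rightarrow> ('a \<Rightarrow> 'a) \<Rightarrow> bool" where
  "stage g T \<tau> \<longleftrightarrow> khomeo g UNIV UNIV \<and> clopen T \<and> (\<forall>A. clopen A \<longrightarrow> clopen (\<tau> -` A)) \<and>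
     (\<forall>x. \<tau> x \<in> T \<and> \<tau> (g x) = \<tau> x) \<and> (\<forall>x\<in>T. \<tau> x = x) \<and> (\<forall>f. locconst f \<longrightarrow> (\<exists>u. solves g T f u))"

text \<open>Only points of \<open>T\<close> are redirected, and only among the old targets. Off
  \<open>T\<close> the map is frozen for good, which is what makes a limit exist.\<close>

definition extends :: "('a \<Rightarrow> 'a) \<Rightarrow> 'a set \<Rightarrow> ('a \<Rightarrow> 'a) \<Rightarrow> 'a set \<Rightarrow> bool" where
  "extends g' T' g T \<longleftrightarrow> T' \<subseteq> T \<and> g' ` T = g ` T \<and> (\<forall>x. x \<notin> T \<longrightarrow> g' x = g x)"

lemma stageD:
  assumes "stage g T \<tau>"
  shows "khomeo g UNIV UNIV" "clopen T" "clopen A \<Longrightarrow> clopen (\<tau> -` A)" "\<tau> x \<in> T" "\<tau> (g x) = \<tau> x"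
    "x \<in> T \<Longrightarrow> \<tau> x = x" "locconst f \<Longrightarrow> \<exists>u. solves g T f u"
  using assms unfolding stage_def by (elim conjE; simp)+

lemma solvesD:
  assumes "solves g T f u"
  shows "locconst u" "x \<in> T \<Longrightarrow> u (g x) = 0" "x \<notin> T \<Longrightarrow> u (g x) = u x + f x"
  using assms unfolding solves_def by (elim conjE; simp)+

lemma stage_id: "stage (\<lambda>x. x) UNIV (\<lambda>x. x)"
proof -
  have "solves (\<lambda>x. x) UNIV f (\<lambda>x. 0)" for f by (simp add: solves_def)
  then show ?thesis by (auto simp: stage_def khomeo_id)
qed

lemma extends_refl: "extends g T g T" by (simp add: extends_def)

lemma extends_trans:
  assumes "extends g'' T'' g' T'" "extends g' T' g T" shows "extends g'' T'' g T"
proof -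
  have s: "T'' \<subseteq> T'" "T' \<subseteq> T" "g'' ` T' = g' ` T'" "g' ` T = g ` T"
    and off: "\<And>x. x \<notin> T' \<Longrightarrow> g'' x = g' x" "\<And>x. x \<notin> T \<Longrightarrow> g' x = g x"
    using assms by (auto simp: extends_def)
  have "g'' ` T = g'' ` T' \<union> g'' ` (T - T')" using s(2) by blast
  also have "g'' ` (T - T') = g' ` (T - T')" using off(1) by (intro image_cong) auto
  also have "g'' ` T' \<union> g' ` (T - T') = g' ` T" using s(2,3) by blast
  finally have "g'' ` T = g ` T" using s(4) by simp
  moreover have "g'' x = g x" if "x \<notin> T" for x using that off s(2) by (metis subsetD)
  ultimately show ?thesis using s(1,2) by (simp add: extends_def)
qed

text \<open>The orbits ending in \<open>T1\<close> are stacked below those ending in \<open>T2\<close>, so orbit sums get added.\<close>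

lemma merge:
  assumes st: "stage g T \<tau>" and T1: "clopen T1" "T1 \<subseteq> T" and T2: "clopen T2" "T2 \<subseteq> T"
    and dj: "T1 \<inter> T2 = {}" and eq: "eqv T1 T2"
  shows "\<exists>g' \<tau>' s. stage g' (T - T1) \<tau>' \<and> extends g' (T - T1) g T \<and> g' ` (T - T1) = g ` (T - T2) \<and>
    s ` T2 = T1 \<and>
    (\<forall>f u. locconst f \<longrightarrow> solves g T f u \<longrightarrow> (\<exists>u'. solves g' (T - T1) f u' \<and>
      (\<forall>t\<in>T - T1. u' t + f t = u t + f t + (if t \<in> T2 then u (s t) + f (s t) else 0))))"
proof -
  obtain s where s: "khomeo s UNIV UNIV" and ss: "\<And>x. s (s x) = x" and s12: "s ` T1 = T2"
      and sid: "\<And>x. x \<notin> T1 \<union> T2 \<Longrightarrow> s x = x"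
    using swap_exists[OF T1(1) T2(1) dj eq] by metis
  note st = stageD[OF st]
  have s21: "s ` T2 = T1" unfolding s12[symmetric] image_image ss by simp
  have sT1: "s x \<in> T2" if "x \<in> T1" for x using s12 that by blast
  have sT2: "s x \<in> T1" if "x \<in> T2" for x using s21 that by blast
  have sT: "s x \<in> T \<longleftrightarrow> x \<in> T" for x
  proof (cases "x \<in> T1 \<union> T2")
    case True then show ?thesis using sT1[of x] sT2[of x] T1(2) T2(2) by auto
  next
    case False then show ?thesis using sid by simp
  qed
  \<comment> \<open>From \<open>t \<in> T1\<close> the new map goes to \<open>g (s t)\<close>, the
    start of the orbit ending at \<open>s t \<in> T2\<close>, whose end in turn leads back to
    \<open>g t\<close>. Thus two orbits become one, ending in \<open>T2\<close>.\<close>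
  define g' where "g' = (\<lambda>x. g (s x))"
  define \<tau>' where "\<tau>' = (\<lambda>x. if \<tau> x \<in> T1 then s (\<tau> x) else \<tau> x)"
  \<comment> \<open>A point whose orbit ends in \<open>T2\<close> now has the whole orbit ending at
    \<open>s (\<tau> x)\<close> in front of it, so that orbit sum is added.\<close>
  have sol: "solves g' (T - T1) f (\<lambda>x. u x + (if \<tau> x \<in> T2 then u (s (\<tau> x)) + f (s (\<tau> x)) else 0))"
    if f: "locconst f" and so: "solves g T f u" for f u
  proof -
    note u = solvesD[OF so]
    have "locconst (\<lambda>x. u x + f x)" by (rule locconst_op[OF u(1) f])
    then have "locconst (\<lambda>y. u (s y) + f (s y))"
      using locconst_comp[of "\<lambda>x. u x + f x" s] khomeo_UNIVD(4)[OF s] by simp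
    then have "locconst (\<lambda>y. if y \<in> T2 then u (s y) + f (s y) else 0)"
      using T2(1) by (intro locconst_if) simp_all
    from locconst_comp[OF this st(3)]
    have "locconst (\<lambda>x. if \<tau> x \<in> T2 then u (s (\<tau> x)) + f (s (\<tau> x)) else 0)" by simp
    from locconst_op[OF u(1) this, of "(+)"]
    have 1: "locconst (\<lambda>x. u x + (if \<tau> x \<in> T2 then u (s (\<tau> x)) + f (s (\<tau> x)) else 0))" .
    have tg: "\<tau> (g' x) = \<tau> (s x)" for x by (simp add: g'_def st(5))
    have 2: "u (g' x) + (if \<tau> (g' x) \<in> T2 then u (s (\<tau> (g' x))) + f (s (\<tau> (g' x))) else 0) = 0"
      if x: "x \<in> T - T1" for x
    proof -
      have "s x \<in> T" "s x \<notin> T2" using x sT sT1[of "s x"] sT2[of "s x"] dj ss[of x] by auto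
      then have "u (g' x) = 0" "\<tau> (g' x) \<notin> T2" using u(2) st(6) by (simp_all add: tg, simp add: g'_def)
      then show ?thesis by simp
    qed
    have 3: "u (g' x) + (if \<tau> (g' x) \<in> T2 then u (s (\<tau> (g' x))) + f (s (\<tau> (g' x))) else 0) =
        u x + (if \<tau> x \<in> T2 then u (s (\<tau> x)) + f (s (\<tau> x)) else 0) + f x"
      if x: "x \<notin> T - T1" for x
    proof (cases "x \<in> T")
      case True
      then have x1: "x \<in> T1" using x by blast
      then have "s x \<in> T2" "s x \<in> T" using sT1 T2(2) by blast+
      then have a: "\<tau> (g' x) = s x" "u (g' x) = 0" using st(6) u(2) by (simp_all add: tg, simp add: g'_def)
      have "\<tau> x = x" "x \<notin> T2" using True st(6) x1 dj by auto
      then show ?thesis using a \<open>s x \<in> T2\<close> by (simp add: ss)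
    next
      case False
      then have "s x = x" using sid T1(2) T2(2) by blast
      then show ?thesis using tg[of x] u(3)[OF False] by (simp add: g'_def)
    qed
    show ?thesis unfolding solves_def using 1 2 3 by blast
  qed
  have kg: "khomeo g' UNIV UNIV" unfolding g'_def by (rule khomeo_comp[OF st(1) s])
  have "stage g' (T - T1) \<tau>'" unfolding stage_def
  proof (intro conjI allI ballI impI)
    show "clopen (T - T1)" using st(2) T1 by simp
    show "clopen (\<tau>' -` A)" if A: "clopen A" for A
    proof -
      have "\<tau>' -` A = (\<tau> -` T1 \<inter> \<tau> -` (s -` A)) \<union> (\<tau> -` A - \<tau> -` T1)"
        by (auto simp: \<tau>'_def split: if_splits)
      moreover have "clopen (\<tau> -` T1)" "clopen (\<tau> -` (s -` A))" "clopen (\<tau> -` A)"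
        using st(3) T1(1) A khomeo_UNIVD(4)[OF s A] by simp_all
      ultimately show ?thesis by (simp only: clopen_Un clopen_Int clopen_Diff)
    qed
    fix x
    show "\<tau>' x \<in> T - T1" using st(4)[of x] sT1[of "\<tau> x"] T2(2) dj by (auto simp: \<tau>'_def)
    show "\<tau>' (g' x) = \<tau>' x"
    proof (cases "x \<in> T1 \<union> T2")
      case True
      then have "x \<in> T" "s x \<in> T" using T1(2) T2(2) sT by auto
      then have "\<tau> (g' x) = s x" "\<tau> x = x" using st(5,6) by (simp_all add: g'_def)
      then show ?thesis using True sT1[of x] sT2[of x] dj ss[of x] by (auto simp: \<tau>'_def)
    next
      case False then show ?thesis using sid st(5) by (simp add: g'_def \<tau>'_def)
    qed
  next
    fix x assume "x \<in> T - T1"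
    then show "\<tau>' x = x" using st(6) by (simp add: \<tau>'_def)
  next
    fix f :: "'a \<Rightarrow> int" assume f: "locconst f"
    then obtain u where "solves g T f u" using st(7) by blast
    from sol[OF f this] show "\<exists>u. solves g' (T - T1) f u" by blast
  qed (rule kg)
  moreover have "extends g' (T - T1) g T" unfolding extends_def
  proof (intro conjI allI impI)
    have "s ` T = T"
    proof (intro set_eqI iffI)
      fix x assume "x \<in> T" then have "s x \<in> T" using sT by simp
      then show "x \<in> s ` T" using ss[of x] by (metis imageI)
    qed (use sT in auto)
    then show "g' ` T = g ` T" unfolding g'_def by (metis image_image)
    show "g' x = g x" if "x \<notin> T" for x
    proof -
      have "x \<notin> T1 \<union> T2" using that T1(2) T2(2) by blast
      then show ?thesis using sid by (simp add: g'_def)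
    qed
  qed simp
  moreover have "g' ` (T - T1) = g ` (T - T2)"
  proof -
    have "s ` (T - T1) = T - T2"
    proof (intro set_eqI iffI)
      fix x assume "x \<in> s ` (T - T1)"
      then obtain y where y: "y \<in> T" "y \<notin> T1" "x = s y" by blast
      then have "s x = y" using ss by simp
      then show "x \<in> T - T2" using y sT sT2[of x] by auto
    next
      fix x assume x: "x \<in> T - T2"
      then have "s x \<in> T - T1" using sT sT1[of "s x"] ss[of x] by auto
      then show "x \<in> s ` (T - T1)" using ss[of x] by (metis imageI)
    qed
    then show ?thesis unfolding g'_def by (metis image_image)
  qed
  moreover have "\<forall>f u. locconst f \<longrightarrow> solves g T f u \<longrightarrow> (\<exists>u'. solves g' (T - T1) f u' \<and>
      (\<forall>t\<in>T - T1. u' t + f t = u t + f t + (if t \<in> T2 then u (s t) + f (s t) else 0)))"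
  proof (intro allI impI)
    fix f u assume "locconst f" "solves g T f u"
    from sol[OF this] show "\<exists>u'. solves g' (T - T1) f u' \<and>
      (\<forall>t\<in>T - T1. u' t + f t = u t + f t + (if t \<in> T2 then u (s t) + f (s t) else 0))"
      by (intro exI conjI) (assumption, simp add: st(6))
  qed
  ultimately show ?thesis using s21 by blast
qed

lemma merge_solved:
  assumes "stage g T \<tau>" "clopen T1" "T1 \<subseteq> T" "clopen T2" "T2 \<subseteq> T" "T1 \<inter> T2 = {}" "eqv T1 T2"
    "locconst f" "solves g T f u"
  shows "\<exists>g' \<tau>' u' s. stage g' (T - T1) \<tau>' \<and> extends g' (T - T1) g T \<and> solves g' (T - T1) f u' \<and>
    s ` T2 = T1 \<and>
    (\<forall>t\<in>T - T1. u' t + f t = u t + f t + (if t \<in> T2 then u (s t) + f (s t) else 0))"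
proof -
  from merge[OF assms(1-7)] obtain g' \<tau>' s where a: "stage g' (T - T1) \<tau>'" "extends g' (T - T1) g T" "s ` T2 = T1"
    and b: "\<forall>f u. locconst f \<longrightarrow> solves g T f u \<longrightarrow> (\<exists>u'. solves g' (T - T1) f u' \<and>
      (\<forall>t\<in>T - T1. u' t + f t = u t + f t + (if t \<in> T2 then u (s t) + f (s t) else 0)))"
    by (elim exE conjE)
  have "\<exists>u'. solves g' (T - T1) f u' \<and>
    (\<forall>t\<in>T - T1. u' t + f t = u t + f t + (if t \<in> T2 then u (s t) + f (s t) else 0))"
    by (rule b[rule_format, OF assms(8,9)])
  then show ?thesis using a by (elim exE) (intro exI conjI, auto)
qed

text \<open>One level is added at a time: the stack ending in \<open>B n\<close> goes below the
  orbits ending in \<open>B (Suc n)\<close>. There are n + 1 copies but only n of them leave the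
  transversal, so the last one carries weight (n + 1) p.\<close>

lemma stack:
  assumes st: "stage g T \<tau>" and f: "locconst f" and so: "solves g T f u"
    and B: "\<And>i. i \<le> n \<Longrightarrow> clopen (B i) \<and> B i \<subseteq> T \<and> eqv (B 0) (B i)" "disjoint_family_on B {..n}"
    and p: "\<And>i t. i \<le> n \<Longrightarrow> t \<in> B i \<Longrightarrow> u t + f t = p"
  shows "\<exists>g' \<tau>' u'. stage g' (T - (\<Union>i<n. B i)) \<tau>' \<and> extends g' (T - (\<Union>i<n. B i)) g T \<and>
    solves g' (T - (\<Union>i<n. B i)) f u' \<and>
    (\<forall>t\<in>T - (\<Union>i<n. B i). u' t + f t = (if t \<in> B n then int (Suc n) * p else u t + f t))"
  using B p
proof (induction n)
  case 0
  show ?case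
    by (intro exI[of _ g] exI[of _ \<tau>] exI[of _ u]) (use st so extends_refl "0.prems"(3) in auto)
next
  case (Suc n)
  let ?T = "T - (\<Union>i<n. B i)"
  have sub: "disjoint_family_on B {..n}"
    by (rule disjoint_family_on_mono[OF _ Suc.prems(2)]) auto
  have dj: "B i \<inter> B j = {}" if "i \<le> Suc n" "j \<le> Suc n" "i \<noteq> j" for i j
    using Suc.prems(2) that unfolding disjoint_family_on_def by simp
  have "\<exists>g' \<tau>' u'. stage g' ?T \<tau>' \<and> extends g' ?T g T \<and> solves g' ?T f u' \<and>
    (\<forall>t\<in>?T. u' t + f t = (if t \<in> B n then int (Suc n) * p else u t + f t))"
  proof (rule Suc.IH[OF _ sub])
    show "clopen (B i) \<and> B i \<subseteq> T \<and> eqv (B 0) (B i)" if "i \<le> n" for i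
      using Suc.prems(1)[of i] that by simp
    show "u t + f t = p" if "i \<le> n" "t \<in> B i" for i t using Suc.prems(3)[of i t] that by simp
  qed
  then obtain g' \<tau>' u' where g': "stage g' ?T \<tau>'" "extends g' ?T g T" "solves g' ?T f u'"
    and w': "\<forall>t\<in>?T. u' t + f t = (if t \<in> B n then int (Suc n) * p else u t + f t)"
    by (elim exE conjE)
  have B1: "clopen (B n)" "B n \<subseteq> T" "eqv (B 0) (B n)" using Suc.prems(1)[of n] by auto
  have B2: "clopen (B (Suc n))" "B (Suc n) \<subseteq> T" "eqv (B 0) (B (Suc n))" using Suc.prems(1)[of "Suc n"] by auto
  have s1: "B n \<subseteq> ?T" using B1(2) dj[of n] by (auto simp: disjoint_iff)
  have s2: "B (Suc n) \<subseteq> ?T" using B2(2) dj[of "Suc n"] by (auto simp: disjoint_iff)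
  have d: "B n \<inter> B (Suc n) = {}" by (rule dj) auto
  have eqn: "eqv (B n) (B (Suc n))" using B1 B2 by (simp add: eqv_def)
  obtain g'' \<tau>'' u'' s where r: "stage g'' (?T - B n) \<tau>''" "extends g'' (?T - B n) g' ?T"
    "solves g'' (?T - B n) f u''" "s ` B (Suc n) = B n"
    "\<forall>t\<in>?T - B n. u'' t + f t = u' t + f t + (if t \<in> B (Suc n) then u' (s t) + f (s t) else 0)"
    using merge_solved[OF g'(1) B1(1) s1 B2(1) s2 d eqn f g'(3)] by (elim exE conjE)
  have eq: "?T - B n = T - (\<Union>i<Suc n. B i)" by (auto simp: lessThan_Suc)
  have "u'' t + f t = (if t \<in> B (Suc n) then int (Suc (Suc n)) * p else u t + f t)" if t: "t \<in> ?T - B n" for t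
  proof (cases "t \<in> B (Suc n)")
    case True
    then have "s t \<in> B n" using r(4) by blast
    then have "u' (s t) + f (s t) = int (Suc n) * p" using w' s1 by auto
    moreover have "u' t + f t = p" using w' t Suc.prems(3)[OF _ True] by auto
    ultimately show ?thesis using bspec[OF r(5) t] True by (simp add: algebra_simps)
  next
    case False
    then show ?thesis using bspec[OF r(5) t] w' t by auto
  qed
  then show ?case using r(1,3) extends_trans[OF r(2) g'(2)] unfolding eq by blast
qed

text \<open>Stacking \<open>L / \<bar>p\<bar>\<close> copies of the level set of weight \<open>p\<close> makes all weights \<open>\<plusminus> L\<close>, outside a small
  remainder \<open>R\<close>.\<close>

lemma equalize:
  assumes st: "stage g T \<tau>" and f: "locconst f" and so: "solves g T f u" and \<epsilon>: "\<epsilon> > (0::real)" and L: "0 < (L::nat)"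
    and S: "finite S" "0 \<notin> S" "\<forall>p\<in>S. p dvd int L"
  defines "w \<equiv> \<lambda>t. u t + f t"
  shows "\<exists>g' T' \<tau>' u' R. stage g' T' \<tau>' \<and> extends g' T' g T \<and> solves g' T' f u' \<and> clopen R \<and>
    R \<subseteq> {t \<in> T'. w t \<in> S} \<and> (\<forall>\<nu>\<in>K. measure \<nu> R \<le> real (card S) * \<epsilon>) \<and> (\<forall>t\<in>R. u' t + f t = w t) \<and>
    {t \<in> T. w t \<notin> S} \<subseteq> T' \<and> (\<forall>t\<in>T'. w t \<notin> S \<longrightarrow> u' t + f t = w t) \<and>
    (\<forall>t\<in>T' - R. w t \<in> S \<longrightarrow> u' t + f t = int L * sgn (w t))"
  using S
proof (induction S)
  case empty
  show ?case
    by (intro exI[of _ g] exI[of _ T] exI[of _ \<tau>] exI[of _ u] exI[of _ "{}"])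
      (use st so extends_refl in \<open>auto simp: w_def\<close>)
next
  case (insert p S)
  have "0 \<notin> S" using insert.prems(1) by simp
  have dvdS: "\<forall>p\<in>S. p dvd int L" using insert.prems(2) by simp
  from insert.IH[OF \<open>0 \<notin> S\<close> dvdS] obtain g' T' \<tau>' u' R where g': "stage g' T' \<tau>'" "extends g' T' g T" "solves g' T' f u'"
    and R: "clopen R" "R \<subseteq> {t \<in> T'. w t \<in> S}" "\<forall>\<nu>\<in>K. measure \<nu> R \<le> real (card S) * \<epsilon>"
      "\<forall>t\<in>R. u' t + f t = w t"
    and T': "{t \<in> T. w t \<notin> S} \<subseteq> T'" "\<forall>t\<in>T'. w t \<notin> S \<longrightarrow> u' t + f t = w t"
      "\<forall>t\<in>T' - R. w t \<in> S \<longrightarrow> u' t + f t = int L * sgn (w t)"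
    by (elim exE conjE)
  have lw: "locconst w" unfolding w_def by (rule locconst_op[OF solvesD(1)[OF so] f])
  define W where "W = T \<inter> {t. w t = p}"
  have W: "clopen W" unfolding W_def using stageD(2)[OF st] locconst_clopen[OF lw, of "\<lambda>y. y = p"] by simp
  have WT: "W \<subseteq> T'" using T'(1) insert.hyps unfolding W_def by auto
  have T'T: "T' \<subseteq> T" using g'(2) by (simp add: extends_def)
  have p0: "p \<noteq> 0" "p dvd int L" using insert.prems by auto
  then obtain q where q: "int L = p * q" by (auto simp: dvd_def)
  \<comment> \<open>From L = p q, the \<bar>q\<bar> copies of weight \<open>p\<close> sum to
    \<bar>q\<bar> p = L sgn p. The copies in \<open>stack\<close> are numbered from 0, hence one
    less.\<close>
  define n where "n = nat (\<bar>q\<bar> - 1)"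
  have q0: "q \<noteq> 0" using q L by auto
  have nq: "int (Suc n) = \<bar>q\<bar>" using q0 by (simp add: n_def)
  have np: "int (Suc n) * p = int L * sgn p"
  proof -
    have "int L = \<bar>p\<bar> * \<bar>q\<bar>" using q by (metis abs_mult abs_of_nat)
    then have "int L * sgn p = \<bar>q\<bar> * (sgn p * \<bar>p\<bar>)" by (simp add: mult_ac)
    then show ?thesis unfolding nq by (simp only: sgn_mult_abs)
  qed
  obtain B where B: "\<And>i. i < Suc n \<Longrightarrow> clopen (B i) \<and> B i \<subseteq> W \<and> eqv (B 0) (B i)" "disjoint_family_on B {..<Suc n}"
     "\<And>\<nu>. \<nu> \<in> K \<Longrightarrow> measure \<nu> (W - (\<Union>i<Suc n. B i)) \<le> \<epsilon>"
    using copies[OF W zero_less_Suc \<epsilon>, of n] by auto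
  have wB: "u' t + f t = p" if "t \<in> W" for t
  proof -
    have "t \<in> T'" "w t = p" using that WT by (auto simp: W_def)
    then show ?thesis using T'(2) insert.hyps by auto
  qed
  let ?T = "T' - (\<Union>i<n. B i)"
  have "\<exists>g'' \<tau>'' u''. stage g'' ?T \<tau>'' \<and> extends g'' ?T g' T' \<and> solves g'' ?T f u'' \<and>
    (\<forall>t\<in>?T. u'' t + f t = (if t \<in> B n then int (Suc n) * p else u' t + f t))"
  proof (rule stack[OF g'(1) f g'(3)])
    show "clopen (B i) \<and> B i \<subseteq> T' \<and> eqv (B 0) (B i)" if "i \<le> n" for i using B(1)[of i] that WT by auto
    show "disjoint_family_on B {..n}" using B(2) by (simp add: lessThan_Suc_atMost)
    show "u' t + f t = p" if "i \<le> n" "t \<in> B i" for i t using wB B(1)[of i] that by auto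
  qed
  then obtain g'' \<tau>'' u'' where g'': "stage g'' ?T \<tau>''" "extends g'' ?T g' T'" "solves g'' ?T f u''"
    and w'': "\<forall>t\<in>?T. u'' t + f t = (if t \<in> B n then int (Suc n) * p else u' t + f t)"
    by (elim exE conjE)
  \<comment> \<open>What the copies leave uncovered keeps weight \<open>p\<close>, has measure at
    most \<epsilon>, and joins the remainder; hence one \<epsilon> for each element of
    \<open>S\<close>.\<close>
  define V where "V = W - (\<Union>i<Suc n. B i)"
  have V: "clopen V" unfolding V_def using B(1) by (intro clopen_Diff W clopen_UNION) auto
  have BW: "B i \<subseteq> W" if "i \<le> n" for i using B(1)[of i] that by simp
  have Rw: "w t \<in> S" "t \<in> T'" if "t \<in> R" for t using R(2) that by auto
  have RW: "R \<inter> W = {}" using Rw insert.hyps(2) unfolding W_def by auto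
  have ext: "extends g'' ?T g T" by (rule extends_trans[OF g''(2) g'(2)])
  have inT: "t \<in> ?T" if "t \<in> T'" "t \<notin> W" for t
  proof -
    have "t \<notin> B i" if "i < n" for i using BW[of i] that \<open>t \<notin> W\<close> by auto
    then show ?thesis using that(1) by auto
  qed
  have VT: "V \<subseteq> ?T" using WT unfolding V_def by auto
  have Ww: "w t = p" if "t \<in> W" for t using that by (simp add: W_def)
  have wW: "t \<in> W" if "t \<in> T'" "w t = p" for t using that T'T by (auto simp: W_def)
  have same: "u'' t + f t = u' t + f t" if "t \<in> ?T" "t \<notin> W" for t
    using w'' that BW[of n] by (auto split: if_splits)
  show ?case
  proof (intro exI conjI ballI impI)
    show "stage g'' ?T \<tau>''" "extends g'' ?T g T" "solves g'' ?T f u''" by fact+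
    show "clopen (R \<union> V)" using R(1) V by simp
    show "R \<union> V \<subseteq> {t \<in> ?T. w t \<in> insert p S}"
    proof
      fix t assume "t \<in> R \<union> V"
      then show "t \<in> {t \<in> ?T. w t \<in> insert p S}"
      proof
        assume t: "t \<in> R"
        then have "t \<notin> W" using RW by blast
        then show ?thesis using inT[of t] Rw[OF t] by simp
      next
        assume t: "t \<in> V"
        then show ?thesis using VT Ww[of t] by (auto simp: V_def)
      qed
    qed
    show "measure \<nu> (R \<union> V) \<le> real (card (insert p S)) * \<epsilon>" if "\<nu> \<in> K" for \<nu>
    proof -
      have "measure \<nu> (R \<union> V) = measure \<nu> R + measure \<nu> V"
        by (rule K_Un[OF that R(1) V]) (use RW in \<open>auto simp: V_def\<close>)
      then show ?thesis using bspec[OF R(3) that] B(3)[OF that] insert.hyps by (simp add: V_def algebra_simps)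
    qed
    show "u'' t + f t = w t" if "t \<in> R \<union> V" for t
    proof (cases "t \<in> R")
      case True
      then have "t \<notin> W" using RW by blast
      then show ?thesis using same[OF inT] Rw[OF True] R(4) True by simp
    next
      case False
      then have t: "t \<in> V" using that by blast
      then have tW: "t \<in> W" "t \<notin> B n" by (auto simp: V_def)
      have "t \<in> ?T" using t VT by blast
      then show ?thesis using w'' tW wB Ww by simp
    qed
    show "{t \<in> T. w t \<notin> insert p S} \<subseteq> ?T"
    proof
      fix t assume t: "t \<in> {t \<in> T. w t \<notin> insert p S}"
      then have "t \<in> T'" "t \<notin> W" using T'(1) Ww by auto
      then show "t \<in> ?T" by (rule inT)
    qed
    show "u'' t + f t = w t" if "t \<in> ?T" "w t \<notin> insert p S" for t
    proof -
      have "t \<notin> W" using that(2) Ww by auto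
      then show ?thesis using same[OF that(1)] T'(2) that by simp
    qed
    show "u'' t + f t = int L * sgn (w t)" if t: "t \<in> ?T - (R \<union> V)" "w t \<in> insert p S" for t
    proof (cases "w t = p")
      case True
      then have "t \<in> W" using t wW by blast
      then have "t \<in> B n" using t by (auto simp: V_def lessThan_Suc)
      then show ?thesis using w'' t np True by auto
    next
      case False
      then have "t \<notin> W" using Ww by blast
      then show ?thesis using same[of t] t False T'(3) by auto
    qed
  qed
qed

section \<open>Domination of a function along orbits\<close>

definition dominated :: "('a \<Rightarrow> 'a) \<Rightarrow> 'a set \<Rightarrow> ('a \<Rightarrow> int) \<Rightarrow> bool" where
  "dominated g T f \<longleftrightarrow> (\<exists>u. locconst u \<and> (\<forall>x\<in>T. u (g x) = 0) \<and> (\<forall>x. u (g x) \<le> u x + f x))"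

text \<open>For \<open>x \<in> T\<close> the new image still lies in the image of \<open>T\<close>
  under \<open>g\<close>, where \<open>u\<close> vanishes. So the inequality at \<open>x\<close> is
  0 \<le> u x + f x, independently of the target.\<close>

lemma dominated_extends:
  assumes d: "dominated g T f" and e: "extends g' T' g T" shows "dominated g' T' f"
proof -
  obtain u where u: "locconst u" "\<And>x. x \<in> T \<Longrightarrow> u (g x) = 0" "\<And>x. u (g x) \<le> u x + f x"
    using d unfolding dominated_def by auto
  have T: "T' \<subseteq> T" "g' ` T = g ` T" and off: "\<And>x. x \<notin> T \<Longrightarrow> g' x = g x"
    using e unfolding extends_def by auto
  have z: "u (g' x) = 0" if "x \<in> T" for x
  proof -
    have "g' x \<in> g ` T" using that T(2) by blast
    then show ?thesis using u(2) by auto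
  qed
  have "u (g' x) \<le> u x + f x" for x
    using z[of x] u(2)[of x] u(3)[of x] off[of x] by (cases "x \<in> T") auto
  then show ?thesis unfolding dominated_def using u(1) z T(1) by (intro exI[of _ u]) auto
qed

text \<open>The function f + u - u \<circ> g vanishes off \<open>T\<close> and equals u + f on
  \<open>T\<close>; the two terms in \<open>u\<close> have equal integrals by
  \<open>has_integral_comp\<close>.\<close>

lemma integral_solves:
  assumes \<nu>: "\<nu> \<in> K" and g: "khomeo g UNIV UNIV" and f: "locconst f" and so: "solves g T f u"
  shows "has_bochner_integral \<nu> (\<lambda>x. if x \<in> T then real_of_int (u x + f x) else 0)
    (integral\<^sup>L \<nu> (\<lambda>x. real_of_int (f x)))"
proof -
  note u = solvesD[OF so]
  have lf: "locconst (\<lambda>x. real_of_int (f x))" and lu: "locconst (\<lambda>x. real_of_int (u x))"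
    using locconst_fun[OF f, of real_of_int] locconst_fun[OF u(1), of real_of_int] .
  note F = has_integral_locconst[OF \<nu> lf]
  have "has_bochner_integral \<nu> (\<lambda>x. real_of_int (f x) + real_of_int (u x) - real_of_int (u (g x)))
      (integral\<^sup>L \<nu> (\<lambda>x. real_of_int (f x)))"
    using has_bochner_integral_diff[OF has_bochner_integral_add[OF F has_integral_locconst[OF \<nu> lu]]
        has_integral_comp[OF \<nu> lu g]] has_bochner_integral_integral_eq[OF F] by simp
  moreover have "real_of_int (f x) + real_of_int (u x) - real_of_int (u (g x)) =
      (if x \<in> T then real_of_int (u x + f x) else 0)" for x
    using u(2,3)[of x] by auto
  ultimately show ?thesis by simp
qed

text \<open>Once the weights are \<open>\<plusminus> L\<close>, positivity of the integral says that the negative part is smaller than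
  the positive part, hence can be stacked onto it.\<close>

lemma make_dominated:
  assumes st: "stage g T \<tau>" and f: "locconst f"
    and pos: "\<And>\<nu>. \<nu> \<in> K \<Longrightarrow> 0 < integral\<^sup>L \<nu> (\<lambda>x. real_of_int (f x))"
  shows "\<exists>g' T' \<tau>'. stage g' T' \<tau>' \<and> extends g' T' g T \<and> dominated g' T' f"
proof -
  have "locconst (\<lambda>x. real_of_int (f x))" using locconst_fun[OF f, of real_of_int] .
  from integral_lower[OF this] pos obtain \<delta> where \<delta>: "\<delta> > 0"
    "\<forall>\<nu>\<in>K. \<delta> \<le> integral\<^sup>L \<nu> (\<lambda>x. real_of_int (f x))" by auto
  obtain u where so: "solves g T f u" using stageD(7)[OF st f] by blast
  define w where "w = (\<lambda>t. u t + f t)"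
  have lw: "locconst w" unfolding w_def by (rule locconst_op[OF solvesD(1)[OF so] f])
  define M where "M = nat (Max ((\<lambda>t. \<bar>w t\<bar>) ` UNIV)) + 1"
  have "finite (range (\<lambda>t. \<bar>w t\<bar>))"
    using locconst_finite_range[OF locconst_fun[OF lw, of abs]] .
  then have mx: "\<bar>w t\<bar> \<le> Max (range (\<lambda>t. \<bar>w t\<bar>))" for t by (rule Max_ge) simp
  have wM: "\<bar>w t\<bar> \<le> int M" for t using mx[of t] unfolding M_def by linarith
  \<comment> \<open>The factorial is divisible by every nonzero weight, all of which lie between -M
    and M.\<close>
  define L where "L = (fact M :: nat)"
  define S where "S = {- int M..int M} - {0}"
  have M1: "1 \<le> M" by (simp add: M_def)
  have L0: "0 < L" by (simp add: L_def)
  have M_le: "M \<le> L" unfolding L_def by (rule fact_ge_self)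
  have dvd: "\<forall>p\<in>S. p dvd int L"
  proof
    fix p assume p: "p \<in> S"
    then have "nat \<bar>p\<bar> dvd L" unfolding L_def S_def by (intro dvd_fact) auto
    then show "p dvd int L" by (simp add: int_dvd_int_iff[symmetric])
  qed
  have cS: "real (card S) \<le> 2 * real M"
  proof -
    have "card S = card {- int M..int M} - 1" unfolding S_def by (subst card_Diff_singleton) auto
    then show ?thesis by simp
  qed
  \<comment> \<open>There are at most 2 M nonzero weights, so \<open>R\<close> will have measure at
    most 2 M \<epsilon> = \<delta> / (4 L), and 2 L times that is \<delta> / 2.\<close>
  define \<epsilon> where "\<epsilon> = \<delta> / (8 * real L * real M)"
  have \<epsilon>: "\<epsilon> > 0" using \<delta>(1) L0 M1 by (simp add: \<epsilon>_def)
  have S: "finite S" "0 \<notin> S" by (simp_all add: S_def)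
  have wt: "u t + f t = w t" for t by (simp add: w_def)
  obtain g' T' \<tau>' u' R where g': "stage g' T' \<tau>'" "extends g' T' g T" "solves g' T' f u'"
    and R: "clopen R" "R \<subseteq> {t \<in> T'. w t \<in> S}" "\<forall>\<nu>\<in>K. measure \<nu> R \<le> real (card S) * \<epsilon>"
      "\<forall>t\<in>R. u' t + f t = w t"
    and T': "\<forall>t\<in>T'. w t \<notin> S \<longrightarrow> u' t + f t = w t"
      "\<forall>t\<in>T' - R. w t \<in> S \<longrightarrow> u' t + f t = int L * sgn (w t)"
    using equalize[OF st f so \<epsilon> L0 S dvd] unfolding wt by (elim exE conjE)
  define w' where "w' = (\<lambda>t. u' t + f t)"
  have lw': "locconst w'" unfolding w'_def by (rule locconst_op[OF solvesD(1)[OF g'(3)] f])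
  have cT': "clopen T'" by (rule stageD(2)[OF g'(1)])
  have val: "w' t = int L \<or> w' t = - int L \<or> w' t = 0" if "t \<in> T'" "t \<notin> R" for t
  proof (cases "w t \<in> S")
    case True
    then have "w' t = int L * sgn (w t)" using T'(2) that by (simp add: w'_def)
    then show ?thesis by (auto simp: sgn_if)
  next
    case False
    then have "w t = 0" using wM[of t] unfolding S_def by auto
    then show ?thesis using T'(1) that False by (simp add: w'_def)
  qed
  have valR: "\<bar>w' t\<bar> \<le> int L" if "t \<in> R" for t using R(4) wM[of t] M_le that by (auto simp: w'_def)
  \<comment> \<open>\<open>P\<close> leaves out \<open>R\<close>, while \<open>N\<close> includes
    the negative part of \<open>R\<close>, since every negative orbit sum has to be
    absorbed.\<close>
  define P where "P = T' \<inter> {t. w' t = int L} - R"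
  define N where "N = T' \<inter> {t. w' t < 0}"
  have P: "clopen P" "P \<subseteq> T'" unfolding P_def
    using cT' R(1) locconst_clopen[OF lw', of "\<lambda>y. y = int L"] by (simp, blast)
  have N: "clopen N" "N \<subseteq> T'" unfolding N_def
    using cT' locconst_clopen[OF lw', of "\<lambda>y. y < 0"] by (simp, blast)
  have PN: "N \<inter> P = {}" unfolding P_def N_def by auto
  have less: "measure \<nu> N < measure \<nu> P" if \<nu>: "\<nu> \<in> K" for \<nu>
  proof -
    let ?A = "\<lambda>i::nat. if i = 0 then P else if i = 1 then N else R"
    \<comment> \<open>The coefficient 2 L on \<open>R\<close> outweighs the -L charged where
      \<open>R\<close> meets \<open>N\<close> and still leaves the bound \<open>L\<close> for the
      weight.\<close>
    let ?a = "\<lambda>i::nat. if i = 0 then real L else if i = 1 then - real L else 2 * real L"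
    have eq3: "(\<Sum>i<3. h i) = h 0 + h 1 + h 2" for h :: "nat \<Rightarrow> real" by (simp add: eval_nat_numeral)
    have A: "has_bochner_integral \<nu> (\<lambda>x. \<Sum>i<3. ?a i * indicator (?A i) x) (\<Sum>i<3. ?a i * measure \<nu> (?A i))"
      by (rule has_integral_indicators[OF \<nu>]) (use P N R in auto)
    have "integral\<^sup>L \<nu> (\<lambda>x. real_of_int (f x)) \<le> (\<Sum>i<3. ?a i * measure \<nu> (?A i))"
    proof (rule has_integral_le[OF integral_solves[OF \<nu> stageD(1)[OF g'(1)] f g'(3)] A])
      fix x
      have "(if x \<in> T' then real_of_int (w' x) else 0) \<le>
          real L * indicator P x - real L * indicator N x + 2 * real L * indicator R x"
      proof (cases "x \<in> T'")
        case xT: True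
        show ?thesis
        proof (cases "x \<in> R")
          case True
          then have "x \<notin> P" "\<bar>w' x\<bar> \<le> int L" using valR by (auto simp: P_def)
          then have "real_of_int (w' x) \<le> real L" by linarith
          then show ?thesis using True xT \<open>x \<notin> P\<close> L0
            by (cases "x \<in> N") (auto simp: N_def)
        next
          case False
          then show ?thesis using val[OF xT False] xT L0 by (auto simp: P_def N_def)
        qed
      next
        case False
        then show ?thesis using P(2) N(2) R(2) by (auto simp: indicator_def)
      qed
      then show "(if x \<in> T' then real_of_int (u' x + f x) else 0) \<le> (\<Sum>i<3. ?a i * indicator (?A i) x)"
        unfolding eq3 by (simp add: w'_def split: if_splits)
    qed
    then have "\<delta> \<le> real L * measure \<nu> P - real L * measure \<nu> N + 2 * real L * measure \<nu> R"
      using bspec[OF \<delta>(2) \<nu>] unfolding eq3 by simp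
    moreover have "2 * real L * measure \<nu> R \<le> \<delta> / 2"
    proof -
      have "measure \<nu> R \<le> 2 * real M * \<epsilon>"
        using bspec[OF R(3) \<nu>] mult_right_mono[OF cS, of \<epsilon>] \<epsilon> by linarith
      then have "2 * real L * measure \<nu> R \<le> 2 * real L * (2 * real M * \<epsilon>)"
        by (intro mult_left_mono) auto
      also have "\<dots> = \<delta> / 2" using L0 M1 by (simp add: \<epsilon>_def field_simps)
      finally show ?thesis .
    qed
    ultimately have "real L * measure \<nu> N < real L * measure \<nu> P" using \<delta>(1) by linarith
    then show ?thesis using L0 by simp
  qed
  then obtain C where C: "clopen C" "C \<subseteq> P" "eqv N C"
    using K_gw[unfolded glasner_weiss_def, rule_format, of N P] P N unfolding eqv_def by auto
  have CT: "C \<subseteq> T'" "N \<inter> C = {}" using C P(2) PN by blast+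
  obtain g'' \<tau>'' u'' s where r: "stage g'' (T' - N) \<tau>''" "extends g'' (T' - N) g' T'"
    "solves g'' (T' - N) f u''" "s ` C = N"
    "\<forall>t\<in>T' - N. u'' t + f t = u' t + f t + (if t \<in> C then u' (s t) + f (s t) else 0)"
    using merge_solved[OF g'(1) N(1,2) C(1) CT(1,2) C(3) f g'(3)] by (elim exE conjE)
  have nn: "0 \<le> u'' t + f t" if t: "t \<in> T' - N" for t
  proof (cases "t \<in> C")
    case True
    then have sN: "s t \<in> N" using r(4) by blast
    have "- int L \<le> w' (s t)"
    proof (cases "s t \<in> R")
      case True then show ?thesis using valR[of "s t"] by linarith
    next
      case False
      have "s t \<in> T'" using sN N(2) by blast
      from val[OF this False] show ?thesis using L0 by auto
    qed
    moreover have "w' t = int L" using True C(2) by (auto simp: P_def)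
    ultimately show ?thesis using bspec[OF r(5) t] True by (simp add: w'_def)
  next
    case False
    then show ?thesis using bspec[OF r(5) t] t by (auto simp: N_def w'_def)
  qed
  have "dominated g'' (T' - N) f" unfolding dominated_def
  proof (intro exI conjI ballI allI)
    note so = solvesD[OF r(3)]
    show "locconst u''" by (rule so(1))
    show "u'' (g'' x) = 0" if "x \<in> T' - N" for x using so(2)[OF that] .
    show "u'' (g'' x) \<le> u'' x + f x" for x
    proof (cases "x \<in> T' - N")
      case True then show ?thesis using so(2)[OF True] nn[OF True] by simp
    next
      case False then show ?thesis using so(3)[OF False] by simp
    qed
  qed
  then show ?thesis using r(1) extends_trans[OF r(2) g'(2)] by blast
qed

section \<open>Shrinking the transversal and its image\<close>

lemma shrink_top:
  assumes st: "stage g T \<tau>" and Y: "clopen Y" "Y \<subseteq> T" "Y \<noteq> {}"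
  shows "\<exists>g' \<tau>'. stage g' Y \<tau>' \<and> extends g' Y g T"
proof -
  have cTY: "clopen (T - Y)" using stageD(2)[OF st] Y(1) by simp
  obtain k :: nat and E where kE: "\<forall>i<k. clopen (E i) \<and> (\<forall>\<nu>\<in>K. measure \<nu> (E i) < measure \<nu> Y)"
      and dj: "disjoint_family_on E {..<k}" and un: "(\<Union>i<k. E i) = T - Y"
    using small_partition[OF cTY Y(1,3)] by (elim exE conjE)
  have E: "clopen (E i)" "\<nu> \<in> K \<Longrightarrow> measure \<nu> (E i) < measure \<nu> Y" if "i < k" for i \<nu>
    using kE that by auto
  have "\<exists>g' \<tau>'. stage g' (T - (\<Union>i<j. E i)) \<tau>' \<and> extends g' (T - (\<Union>i<j. E i)) g T" if "j \<le> k" for j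
    using that
  proof (induction j)
    case 0
    then show ?case using st extends_refl by auto
  next
    case (Suc j)
    let ?T = "T - (\<Union>i<j. E i)"
    obtain g' \<tau>' where g': "stage g' ?T \<tau>'" "extends g' ?T g T"
      using Suc.IH[OF Suc_leD[OF Suc.prems]] by (elim exE conjE)
    have j: "j < k" using Suc.prems by simp
    \<comment> \<open>The partners inside \<open>Y\<close> of different pieces may overlap:
      \<open>Y\<close> remains in the transversal, so it can be used in every round.\<close>
    obtain C where C: "clopen C" "C \<subseteq> Y" "eqv (E j) C"
      using K_gw[unfolded glasner_weiss_def, rule_format, of "E j" Y] E[OF j] Y(1) unfolding eqv_def by auto
    have Ek: "E i \<subseteq> T - Y" if "i < k" for i using un that by blast
    have Ej: "E i \<inter> E j = {}" if "i < j" for i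
      using disjoint_family_onD[OF dj, of i j] that j by auto
    have s1: "E j \<subseteq> ?T"
    proof
      fix x assume x: "x \<in> E j"
      then have "x \<notin> E i" if "i < j" for i using Ej[OF that] by auto
      then show "x \<in> ?T" using x Ek[OF j] by auto
    qed
    have s2: "C \<subseteq> ?T"
    proof
      fix x assume x: "x \<in> C"
      then have "x \<notin> E i" if "i < j" for i using Ek[of i] that j C(2) by auto
      then show "x \<in> ?T" using x C(2) Y(2) by auto
    qed
    have d: "E j \<inter> C = {}" using Ek[OF j] C(2) by blast
    obtain g'' \<tau>'' where "stage g'' (?T - E j) \<tau>''" "extends g'' (?T - E j) g' ?T"
      using merge[OF g'(1) E(1)[OF j] s1 C(1) s2 d C(3)] by (elim exE conjE)
    moreover have "?T - E j = T - (\<Union>i<Suc j. E i)" by (auto simp: lessThan_Suc)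
    ultimately show ?case using extends_trans[OF _ g'(2)] by auto
  qed
  from this[OF order_refl] show ?thesis unfolding un using Y(2) by (simp add: double_diff)
qed

text \<open>The counterpart of \<open>shrink_top\<close> for the first points of orbits. In
  \<open>merge\<close> it is the orbits placed on top whose first points are discarded, so the
  orbits starting in \<open>E j\<close> go above some that start in \<open>Y\<close>: here the
  unwanted piece plays \<open>T2\<close>, not \<open>T1\<close>.\<close>

lemma shrink_base:
  assumes st: "stage g T \<tau>" and Y: "clopen Y" "Y \<subseteq> g ` T" "Y \<noteq> {}"
  shows "\<exists>g' T' \<tau>'. stage g' T' \<tau>' \<and> extends g' T' g T \<and> g' ` T' = Y"
proof -
  have cTY: "clopen (g ` T - Y)" using khomeo_UNIVD(2)[OF stageD(1,2)[OF st]] Y(1) by simp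
  obtain k :: nat and E where kE: "\<forall>i<k. clopen (E i) \<and> (\<forall>\<nu>\<in>K. measure \<nu> (E i) < measure \<nu> Y)"
      and dj: "disjoint_family_on E {..<k}" and un: "(\<Union>i<k. E i) = g ` T - Y"
    using small_partition[OF cTY Y(1,3)] by (elim exE conjE)
  have E: "clopen (E i)" "\<nu> \<in> K \<Longrightarrow> measure \<nu> (E i) < measure \<nu> Y" if "i < k" for i \<nu>
    using kE that by auto
  have "\<exists>g' T' \<tau>'. stage g' T' \<tau>' \<and> extends g' T' g T \<and> g' ` T' = g ` T - (\<Union>i<j. E i)" if "j \<le> k" for j
    using that
  proof (induction j)
    case 0
    then show ?case using st extends_refl by auto
  next
    case (Suc j)
    obtain g' T' \<tau>' where g': "stage g' T' \<tau>'" "extends g' T' g T" "g' ` T' = g ` T - (\<Union>i<j. E i)"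
      using Suc.IH[OF Suc_leD[OF Suc.prems]] by (elim exE conjE)
    have j: "j < k" using Suc.prems by simp
    note h = khomeo_UNIVD[OF stageD(1)[OF g'(1)]]
    have inj: "inj g'" using h(1) by (rule bij_is_inj)
    have Ek: "E i \<subseteq> g ` T - Y" if "i < k" for i using un that by blast
    have Ej: "E i \<inter> E j = {}" if "i < j" for i
      using disjoint_family_onD[OF dj, of i j] that j by auto
    have E1: "E j \<subseteq> g' ` T'" unfolding g'(3)
    proof
      fix x assume x: "x \<in> E j"
      then have "x \<notin> E i" if "i < j" for i using Ej[OF that] by auto
      then show "x \<in> g ` T - (\<Union>i<j. E i)" using x Ek[OF j] by auto
    qed
    have Y1: "Y \<subseteq> g' ` T'" unfolding g'(3)
    proof
      fix x assume x: "x \<in> Y"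
      then have "x \<notin> E i" if "i < j" for i using Ek[of i] that j by auto
      then show "x \<in> g ` T - (\<Union>i<j. E i)" using x Y(2) by auto
    qed
    have pre: "g' -` A \<subseteq> T'" if "A \<subseteq> g' ` T'" for A using that inj by (auto dest: injD)
    have lt: "measure \<nu> (g' -` E j) < measure \<nu> (g' -` Y)" if "\<nu> \<in> K" for \<nu>
      using E(2)[OF j that] h(5)[OF E(1)[OF j]] h(5)[OF Y(1)] that by (simp add: eqv_def)
    obtain C where C: "clopen C" "C \<subseteq> g' -` Y" "eqv (g' -` E j) C"
      using K_gw[unfolded glasner_weiss_def, rule_format, of "g' -` E j" "g' -` Y"] lt h(4) E(1)[OF j] Y(1)
      unfolding eqv_def by auto
    have CT: "C \<subseteq> T'" using C(2) pre[OF Y1] by blast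
    have d: "C \<inter> g' -` E j = {}" using C(2) Ek[OF j] by blast
    obtain g'' \<tau>'' where "stage g'' (T' - C) \<tau>''" "extends g'' (T' - C) g' T'"
        "g'' ` (T' - C) = g' ` (T' - g' -` E j)"
      using merge[OF g'(1) C(1) CT h(4)[OF E(1)[OF j]] pre[OF E1] d eqv_sym[OF C(3)]] by (elim exE conjE)
    moreover have "g' ` (T' - g' -` E j) = g ` T - (\<Union>i<Suc j. E i)"
    proof -
      have "g' ` (T' - g' -` E j) = g' ` T' - E j" by auto
      then show ?thesis unfolding g'(3) by (auto simp: lessThan_Suc)
    qed
    ultimately show ?case using extends_trans[OF _ g'(2)] by metis
  qed
  from this[OF order_refl] show ?thesis unfolding un using Y(2) by (simp add: double_diff)
qed

text \<open>Domination survives every extension, so it is arranged before the shrinking. Both the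
  transversal and its image must become small: in the limit they determine the one exceptional point
  and its value.\<close>

lemma next_stage:
  assumes st: "stage g T \<tau>" and f: "locconst f"
  shows "\<exists>g' T' \<tau>'. stage g' T' \<tau>' \<and> extends g' T' g T \<and> (\<forall>x\<in>T'. \<forall>y\<in>T'. agree n x y) \<and>
    (\<forall>x\<in>g' ` T'. \<forall>y\<in>g' ` T'. agree n x y) \<and>
    ((\<forall>\<nu>\<in>K. 0 < integral\<^sup>L \<nu> (\<lambda>x. real_of_int (f x))) \<longrightarrow> dominated g' T' f)"
proof -
  have "\<exists>g1 T1 \<tau>1. stage g1 T1 \<tau>1 \<and> extends g1 T1 g T \<and>
    ((\<forall>\<nu>\<in>K. 0 < integral\<^sup>L \<nu> (\<lambda>x. real_of_int (f x))) \<longrightarrow> dominated g1 T1 f)"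
    using make_dominated[OF st f] st extends_refl by blast
  then obtain g1 T1 \<tau>1 where 1: "stage g1 T1 \<tau>1" "extends g1 T1 g T"
    "(\<forall>\<nu>\<in>K. 0 < integral\<^sup>L \<nu> (\<lambda>x. real_of_int (f x))) \<longrightarrow> dominated g1 T1 f" by (elim exE conjE)
  define t where "t = \<tau>1 undefined"
  have t: "t \<in> T1" unfolding t_def by (rule stageD(4)[OF 1(1)])
  define T2 where "T2 = T1 \<inter> {y. agree n t y}"
  have T2: "clopen T2" "T2 \<subseteq> T1" "T2 \<noteq> {}" using stageD(2)[OF 1(1)] t by (auto simp: T2_def)
  obtain g2 \<tau>2 where 2: "stage g2 T2 \<tau>2" "extends g2 T2 g1 T1" using shrink_top[OF 1(1) T2] by blast
  define b where "b = g2 t"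
  have b: "b \<in> g2 ` T2" using t by (auto simp: b_def T2_def)
  define Y where "Y = g2 ` T2 \<inter> {y. agree n b y}"
  have Y: "clopen Y" "Y \<subseteq> g2 ` T2" "Y \<noteq> {}"
    using khomeo_UNIVD(2)[OF stageD(1,2)[OF 2(1)]] b by (auto simp: Y_def)
  obtain g3 T3 \<tau>3 where 3: "stage g3 T3 \<tau>3" "extends g3 T3 g2 T2" "g3 ` T3 = Y"
    using shrink_base[OF 2(1) Y] by blast
  have e: "extends g3 T3 g1 T1" by (rule extends_trans[OF 3(2) 2(2)])
  have "agree n x y" if "x \<in> T3" "y \<in> T3" for x y
  proof -
    have "x \<in> T2" "y \<in> T2" using that 3(2) by (auto simp: extends_def)
    then show ?thesis using agree_trans[OF agree_sym] by (auto simp: T2_def)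
  qed
  moreover have "agree n x y" if "x \<in> g3 ` T3" "y \<in> g3 ` T3" for x y
    using that agree_trans[OF agree_sym] unfolding 3(3) Y_def by blast
  ultimately show ?thesis using 3(1) extends_trans[OF e 1(2)] dominated_extends[OF _ e] 1(3) by blast
qed

section \<open>The limit homeomorphism and its invariant measures\<close>

text \<open>Test functions are given by syntax, lists over a countable type, so that
  \<open>from_nat\<close> enumerates them; \<open>mass\<close> is the integral written out as a
  finite sum.\<close>

definition simple :: "(int \<times> bool list) list \<Rightarrow> 'a \<Rightarrow> int" where
  "simple s x = (\<Sum>(q, l)\<leftarrow>s. q * of_bool (x \<in> cyl l))"

definition mass :: "'a measure \<Rightarrow> (int \<times> bool list) list \<Rightarrow> real" where
  "mass \<mu> s = (\<Sum>(q, l)\<leftarrow>s. real_of_int q * measure \<mu> (cyl l))"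

lemma simple_locconst: "locconst (simple s)"
proof (induction s)
  case Nil
  have "simple [] = (\<lambda>x. 0)" by (simp add: simple_def fun_eq_iff)
  then show ?case by simp
next
  case (Cons a s)
  obtain q l where a: "a = (q, l)" by (cases a)
  have "locconst (\<lambda>x. x \<in> cyl l)" using cyl_clopen by (simp flip: clopen_iff)
  from locconst_fun[OF this, of "\<lambda>b. q * of_bool b"] have "locconst (\<lambda>x. q * of_bool (x \<in> cyl l))" .
  from locconst_op[OF this Cons, of "(+)"] show ?case by (simp add: simple_def a)
qed

lemma has_integral_simple:
  assumes "\<mu> \<in> borel_probs"
  shows "has_bochner_integral \<mu> (\<lambda>x. real_of_int (simple s x)) (mass \<mu> s)"
proof (induction s)
  case Nil
  show ?case by (simp add: simple_def mass_def has_bochner_integral_zero)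
next
  case (Cons a s)
  interpret prob_space \<mu> using assms by (simp add: borel_probs_def)
  obtain q l where a: "a = (q, l)" by (cases a)
  have m: "cyl l \<in> sets \<mu>" using clopen_sets[OF cyl_clopen] assms by (simp add: borel_probs_def)
  have "has_bochner_integral \<mu> (indicat_real (cyl l)) (measure \<mu> (cyl l))"
    using m by (intro has_bochner_integral_real_indicator) (auto simp: less_top[symmetric])
  then have "has_bochner_integral \<mu> (\<lambda>x. real_of_int q * indicat_real (cyl l) x) (real_of_int q * measure \<mu> (cyl l))"
    by (rule has_bochner_integral_mult_right)
  from has_bochner_integral_add[OF this Cons] show ?case
    by (simp add: a simple_def mass_def indicator_def)
qed

lemma simple_integral: "\<nu> \<in> K \<Longrightarrow> integral\<^sup>L \<nu> (\<lambda>x. real_of_int (simple s x)) = mass \<nu> s"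
  using has_bochner_integral_integral_eq[OF has_integral_simple] K_sub by blast

text \<open>The sets \<open>T n\<close> shrink to a point \<open>p\<close> and their images to a
  point \<open>q\<close>; elsewhere the maps stabilize. A clopen set depending on \<open>m\<close>
  coordinates cannot distinguish points in the image of \<open>T (Suc m)\<close>, so its preimage
  under the limit is its preimage under \<open>G (Suc m)\<close>; similarly for images. All
  properties of clopen sets are thus inherited from finite stages.\<close>

lemma limit_homeomorphism:
  fixes G :: "nat \<Rightarrow> 'a \<Rightarrow> 'a" and T :: "nat \<Rightarrow> 'a set"
  assumes kh: "\<And>n. khomeo (G n) UNIV UNIV" and cT: "\<And>n. clopen (T n)" and ne: "\<And>n. T n \<noteq> {}"
    and ext: "\<And>n. extends (G (Suc n)) (T (Suc n)) (G n) (T n)"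
    and top: "\<And>n x y. x \<in> T (Suc n) \<Longrightarrow> y \<in> T (Suc n) \<Longrightarrow> agree n x y"
    and bot: "\<And>n x y. x \<in> G (Suc n) ` T (Suc n) \<Longrightarrow> y \<in> G (Suc n) ` T (Suc n) \<Longrightarrow> agree n x y"
  shows "\<exists>g. khomeo g UNIV UNIV \<and>
    (\<forall>f n. dominated (G n) (T n) f \<longrightarrow> (\<exists>u. locconst u \<and> (\<forall>x. u (g x) \<le> u x + f x)))"
proof -
  note h = khomeo_UNIVD[OF kh]
  have inj: "inj (G n)" for n using h(1) by (rule bij_is_inj)
  have ex: "extends (G m) (T m) (G n) (T n)" if "n \<le> m" for m n
    using that
  proof (induction m rule: dec_induct)
    case base show ?case by (rule extends_refl)
  next
    case (step m) show ?case by (rule extends_trans[OF ext step.IH])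
  qed
  have off: "G m x = G n x" if "n \<le> m" "x \<notin> T n" for m n x using ex[OF that(1)] that(2) by (simp add: extends_def)
  have img: "G m ` T n = G n ` T n" if "n \<le> m" for m n using ex[OF that] by (simp add: extends_def)
  have sub: "T (Suc n) \<subseteq> T n" for n using ext[of n] by (simp add: extends_def)
  obtain p where p: "\<And>n. p \<in> T n" using clopen_nested[of T] cT ne sub by blast
  have "\<exists>q. \<forall>n. q \<in> G n ` T n"
  proof (rule clopen_nested)
    show "clopen (G n ` T n)" for n by (rule h(2)[OF cT])
    show "G n ` T n \<noteq> {}" for n using ne by simp
    show "G (Suc n) ` T (Suc n) \<subseteq> G n ` T n" for n using sub[of n] img[of n "Suc n"] by auto
  qed
  then obtain q where q: "\<And>n. q \<in> G n ` T n" by blast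
  have up: "x = p" if "\<And>n. x \<in> T n" for x by (rule agree_all) (rule top[OF that p])
  have uq: "x = q" if "\<And>n. x \<in> G n ` T n" for x by (rule agree_all) (rule bot[OF that q])
  \<comment> \<open>By \<open>off\<close>, any index with \<open>x \<notin> T n\<close> gives the
    same value as the least one; \<open>p\<close> is the only point without such an index.\<close>
  define g where "g = (\<lambda>x. if x = p then q else G (LEAST n. x \<notin> T n) x)"
  have gN: "\<exists>N. x \<notin> T N \<and> (\<forall>n. x \<notin> T n \<longrightarrow> N \<le> n) \<and> g x = G N x" if xp: "x \<noteq> p" for x
  proof -
    obtain n where n: "x \<notin> T n" using up xp by blast
    show ?thesis
    proof (intro exI conjI allI impI)
      show "x \<notin> T (LEAST n. x \<notin> T n)" by (rule LeastI[of _ n]) (rule n)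
      show "(LEAST n. x \<notin> T n) \<le> m" if "x \<notin> T m" for m by (rule Least_le) (rule that)
      show "g x = G (LEAST n. x \<notin> T n) x" using xp by (simp add: g_def)
    qed
  qed
  have g_off: "g x = G n x" if x: "x \<notin> T n" for x n
  proof -
    have "x \<noteq> p" using x p by auto
    from gN[OF this] obtain N where "x \<notin> T N" "N \<le> n" "g x = G N x" using x by blast
    then show ?thesis using off[of N n x] by simp
  qed
  have g_on: "g x \<in> G n ` T n" if x: "x \<in> T n" for x n
  proof (cases "x = p")
    case True then show ?thesis using q by (simp add: g_def)
  next
    case False
    then obtain N where N: "x \<notin> T N" "g x = G N x" using gN by blast
    have "n \<le> N"
    proof (rule ccontr)
      assume "\<not> n \<le> N"
      then have "T n \<subseteq> T N" using ex[of N n] by (simp add: extends_def)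
      then show False using x N(1) by blast
    qed
    then show ?thesis using img[of n N] x N(2) by blast
  qed
  have g_iff: "g x \<in> G n ` T n \<longleftrightarrow> x \<in> T n" for x n
    using g_on[of x n] g_off[of x n] inj_image_mem_iff[OF inj, of n x "T n"] by (cases "x \<in> T n") simp_all
  have "inj g"
  proof (rule injI)
    fix x y assume xy: "g x = g y"
    have iff: "x \<in> T n \<longleftrightarrow> y \<in> T n" for n using g_iff[of x n] g_iff[of y n] xy by simp
    show "x = y"
    proof (cases "\<exists>n. x \<notin> T n")
      case True
      then obtain n where "x \<notin> T n" "y \<notin> T n" using iff by blast
      then have "G n x = G n y" using xy g_off[of x n] g_off[of y n] by simp
      then show ?thesis using inj[of n] by (simp add: inj_eq)
    next
      case False
      then have "\<And>n. x \<in> T n" "\<And>n. y \<in> T n" using iff by auto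
      then have "x = p" "y = p" using up by auto
      then show ?thesis by simp
    qed
  qed
  moreover have sur: "\<exists>x. g x = y" for y
  proof (cases "\<exists>n. y \<notin> G n ` T n")
    case True
    then obtain n where n: "y \<notin> G n ` T n" by blast
    obtain x where x: "y = G n x" using bij_is_surj[OF h(1)] by (metis surjD)
    then have "x \<notin> T n" using n by blast
    then show ?thesis using g_off[of x n] x by auto
  next
    case False
    then have "y = q" using uq by blast
    then show ?thesis by (intro exI[of _ p]) (simp add: g_def)
  qed
  ultimately have bij: "bij g" by (metis bijI surjI)
  have pre: "\<exists>n. g -` A = G n -` A" if A: "clopen A" for A
  proof -
    obtain m where m: "\<And>x y. agree m x y \<Longrightarrow> (x \<in> A \<longleftrightarrow> y \<in> A)"
      using A unfolding clopen_iff locconst_def by blast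
    have "g x \<in> A \<longleftrightarrow> G (Suc m) x \<in> A" for x
    proof (cases "x \<in> T (Suc m)")
      case True
      then show ?thesis using m[OF bot[OF g_on[OF True]]] by blast
    next
      case False then show ?thesis using g_off by simp
    qed
    then show ?thesis by (intro exI[of _ "Suc m"]) auto
  qed
  have im: "\<exists>n. g ` A = G n ` A" if A: "clopen A" for A
  proof -
    obtain m where m: "\<And>x y. agree m x y \<Longrightarrow> (x \<in> A \<longleftrightarrow> y \<in> A)"
      using A unfolding clopen_iff locconst_def by blast
    have "y \<in> g ` A \<longleftrightarrow> y \<in> G (Suc m) ` A" for y
    proof -
      obtain x where x: "g x = y" using sur by blast
      obtain z where z: "y = G (Suc m) z" using bij_is_surj[OF h(1)] by (metis surjD)
      have "x \<in> T (Suc m) \<longleftrightarrow> y \<in> G (Suc m) ` T (Suc m)" using g_iff[of x "Suc m"] x by simp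
      also have "\<dots> \<longleftrightarrow> z \<in> T (Suc m)" unfolding z by (rule inj_image_mem_iff[OF inj])
      finally have iff: "x \<in> T (Suc m) \<longleftrightarrow> z \<in> T (Suc m)" .
      have "x \<in> A \<longleftrightarrow> z \<in> A"
      proof (cases "x \<in> T (Suc m)")
        case True then show ?thesis using m[OF top] iff by blast
      next
        case False
        then have "G (Suc m) x = G (Suc m) z" using g_off[OF False] x z by simp
        then show ?thesis using inj[of "Suc m"] by (simp add: inj_eq)
      qed
      moreover have "y \<in> g ` A \<longleftrightarrow> x \<in> A" using inj_image_mem_iff[OF \<open>inj g\<close>, of x A] x by simp
      moreover have "y \<in> G (Suc m) ` A \<longleftrightarrow> z \<in> A" unfolding z by (rule inj_image_mem_iff[OF inj])
      ultimately show ?thesis by simp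
    qed
    then show ?thesis by (intro exI[of _ "Suc m"]) blast
  qed
  have "khomeo g UNIV UNIV" unfolding khomeo_def
  proof (intro conjI allI impI)
    fix C :: "'a set" assume "clopen C \<and> C \<subseteq> UNIV"
    then have C: "clopen C" by simp
    show "clopen (g ` C)" "eqv (g ` C) C" using im[OF C] h(2,3)[OF C] by metis+
    show "clopen (UNIV \<inter> g -` C)" "eqv (UNIV \<inter> g -` C) C" using pre[OF C] h(4,5)[OF C] by (metis Int_UNIV_left)+
  qed (rule bij)
  moreover have "\<exists>u. locconst u \<and> (\<forall>x. u (g x) \<le> u x + f x)" if d: "dominated (G n) (T n) f" for f n
  proof -
    obtain u where u: "locconst u" "\<forall>x\<in>T n. u (G n x) = 0" "\<forall>x. u (G n x) \<le> u x + f x"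
      using d unfolding dominated_def by (elim exE conjE)
    have "u (g x) \<le> u x + f x" for x
    proof (cases "x \<in> T n")
      case True
      have "u (g x) = 0" using g_on[OF True] u(2) by auto
      then show ?thesis using bspec[OF u(2) True] spec[OF u(3), of x] by simp
    next
      case False then show ?thesis using g_off[OF False] spec[OF u(3), of x] by simp
    qed
    then show ?thesis using u(1) by blast
  qed
  ultimately show ?thesis by blast
qed

text \<open>The test function \<open>s\<close> is treated at step \<open>to_nat s\<close> and
  dominated from the next stage on. Positivity of its integrals is a premise inside the recursion,
  so all test functions can be enumerated.\<close>

lemma limit_exists:
  "\<exists>g. khomeo g UNIV UNIV \<and> (\<forall>s. (\<forall>\<nu>\<in>K. 0 < mass \<nu> s) \<longrightarrow>
    (\<exists>u. locconst u \<and> (\<forall>x. u (g x) \<le> u x + simple s x)))"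
proof -
  define fs where "fs = (\<lambda>n. simple (from_nat n))"
  have "\<exists>S. \<forall>n. (case S n of (g, T, \<tau>) \<Rightarrow> stage g T \<tau>) \<and>
    (case (S n, S (Suc n)) of ((g, T, \<tau>), (g', T', \<tau>')) \<Rightarrow> extends g' T' g T \<and>
      (\<forall>x\<in>T'. \<forall>y\<in>T'. agree n x y) \<and> (\<forall>x\<in>g' ` T'. \<forall>y\<in>g' ` T'. agree n x y) \<and>
      ((\<forall>\<nu>\<in>K. 0 < integral\<^sup>L \<nu> (\<lambda>x. real_of_int (fs n x))) \<longrightarrow> dominated g' T' (fs n)))"
  proof (rule dependent_nat_choice)
    show "\<exists>S. case S of (g, T, \<tau>) \<Rightarrow> stage g T \<tau>" using stage_id by auto
    fix S n assume "case S of (g, T, \<tau>) \<Rightarrow> stage g T \<tau>"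
    then obtain g T \<tau> where S: "S = (g, T, \<tau>)" "stage g T \<tau>" by (cases S) auto
    have "locconst (fs n)" unfolding fs_def by (rule simple_locconst)
    from next_stage[OF S(2) this, of n] show "\<exists>S'. (case S' of (g, T, \<tau>) \<Rightarrow> stage g T \<tau>) \<and>
      (case (S, S') of ((g, T, \<tau>), (g', T', \<tau>')) \<Rightarrow> extends g' T' g T \<and>
      (\<forall>x\<in>T'. \<forall>y\<in>T'. agree n x y) \<and> (\<forall>x\<in>g' ` T'. \<forall>y\<in>g' ` T'. agree n x y) \<and>
      ((\<forall>\<nu>\<in>K. 0 < integral\<^sup>L \<nu> (\<lambda>x. real_of_int (fs n x))) \<longrightarrow> dominated g' T' (fs n)))"
      unfolding S(1) split_paired_Ex prod.case .
  qed
  then obtain S where S: "\<forall>n. (case S n of (g, T, \<tau>) \<Rightarrow> stage g T \<tau>) \<and>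
    (case (S n, S (Suc n)) of ((g, T, \<tau>), (g', T', \<tau>')) \<Rightarrow> extends g' T' g T \<and>
      (\<forall>x\<in>T'. \<forall>y\<in>T'. agree n x y) \<and> (\<forall>x\<in>g' ` T'. \<forall>y\<in>g' ` T'. agree n x y) \<and>
      ((\<forall>\<nu>\<in>K. 0 < integral\<^sup>L \<nu> (\<lambda>x. real_of_int (fs n x))) \<longrightarrow> dominated g' T' (fs n)))" by (elim exE)
  define G where "G = (\<lambda>n. fst (S n))"
  define T where "T = (\<lambda>n. fst (snd (S n)))"
  have st: "stage (G n) (T n) (snd (snd (S n)))" for n
    using spec[OF S, of n] unfolding G_def T_def case_prod_beta by (elim conjE)
  have nxc: "extends (G (Suc n)) (T (Suc n)) (G n) (T n) \<and> (\<forall>x\<in>T (Suc n). \<forall>y\<in>T (Suc n). agree n x y) \<and>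
    (\<forall>x\<in>G (Suc n) ` T (Suc n). \<forall>y\<in>G (Suc n) ` T (Suc n). agree n x y) \<and>
    ((\<forall>\<nu>\<in>K. 0 < integral\<^sup>L \<nu> (\<lambda>x. real_of_int (fs n x))) \<longrightarrow> dominated (G (Suc n)) (T (Suc n)) (fs n))" for n
    using spec[OF S, of n] unfolding G_def T_def case_prod_beta fst_conv snd_conv by (rule conjunct2)
  note nx = conjunct1[OF nxc] conjunct1[OF conjunct2[OF nxc]] conjunct1[OF conjunct2[OF conjunct2[OF nxc]]]
    conjunct2[OF conjunct2[OF conjunct2[OF nxc]]]
  have ne: "T n \<noteq> {}" for n using stageD(4)[OF st[of n], of undefined] by auto
  have "\<exists>g. khomeo g UNIV UNIV \<and>
    (\<forall>f n. dominated (G n) (T n) f \<longrightarrow> (\<exists>u. locconst u \<and> (\<forall>x. u (g x) \<le> u x + f x)))"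
    by (rule limit_homeomorphism[of G T, OF stageD(1)[OF st] stageD(2)[OF st] ne nx(1)]) (use nx(2,3) in blast)+
  then obtain g where g: "khomeo g UNIV UNIV"
    "\<forall>f n. dominated (G n) (T n) f \<longrightarrow> (\<exists>u. locconst u \<and> (\<forall>x. u (g x) \<le> u x + f x))" by (elim exE conjE)
  have "\<exists>u. locconst u \<and> (\<forall>x. u (g x) \<le> u x + simple s x)" if s: "\<forall>\<nu>\<in>K. 0 < mass \<nu> s" for s
  proof -
    have fs: "fs (to_nat s) = simple s" by (simp add: fs_def)
    have "\<forall>\<nu>\<in>K. 0 < integral\<^sup>L \<nu> (\<lambda>x. real_of_int (fs (to_nat s) x))"
      unfolding fs using s simple_integral by simp
    then have "dominated (G (Suc (to_nat s))) (T (Suc (to_nat s))) (simple s)"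
      using nx(4)[of "to_nat s"] fs by simp
    then show ?thesis using g(2) by blast
  qed
  then show ?thesis using g(1) by blast
qed

text \<open>Along a forward orbit that misses the cylinder the test function is constantly -1, so
  \<open>u\<close> drops at each step, contrary to its finite range.\<close>

lemma orbits_dense:
  assumes "bij g"
    and dom: "\<And>s. (\<forall>\<nu>\<in>K. 0 < mass \<nu> s) \<Longrightarrow> \<exists>u. locconst u \<and> (\<forall>x. u (g x) \<le> u x + simple s x)"
  shows "closure (full_orbit g x) = UNIV"
proof -
  have "full_orbit g x \<inter> U \<noteq> {}" if U: "open U" "y \<in> U" for U y
  proof
    assume e: "full_orbit g x \<inter> U = {}"
    obtain m where m: "\<forall>z. agree m y z \<longrightarrow> z \<in> U" using ball_basis[OF U] by blast
    define l where "l = map (e y) [0..<m]"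
    have l: "cyl l \<subseteq> U" "cyl l \<noteq> {}" using m unfolding l_def cell_eq[symmetric] by (auto intro: exI[of _ y])
    obtain \<delta> where \<delta>: "\<delta> > 0" "\<forall>\<nu>\<in>K. \<delta> \<le> measure \<nu> (cyl l)" using K_lower[OF cyl_clopen l(2)] by auto
    \<comment> \<open>One \<open>M\<close> with M \<delta> > 1 makes the mass positive on all of
      \<open>K\<close>; the empty word below denotes the whole space.\<close>
    obtain M :: nat where M: "1 < real M * \<delta>" using reals_Archimedean3[OF \<delta>(1)] by blast
    define s where "s = [(int M, l), (- 1, [])]"
    have "0 < mass \<nu> s" if "\<nu> \<in> K" for \<nu>
    proof -
      have "real M * \<delta> \<le> real M * measure \<nu> (cyl l)" using \<delta>(2) that by (intro mult_left_mono) auto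
      then show ?thesis using M K_UNIV[OF that] by (simp add: mass_def s_def)
    qed
    then obtain u where u: "locconst u" "\<forall>x. u (g x) \<le> u x + simple s x" using dom[of s] by blast
    have orb: "(g ^^ n) x \<notin> cyl l" for n using e l(1) unfolding full_orbit_def by blast
    have dec: "u ((g ^^ n) x) \<le> u x - int n" for n
    proof (induction n)
      case (Suc n)
      have "simple s ((g ^^ n) x) = - 1" using orb[of n] by (simp add: simple_def s_def)
      then show ?case using Suc spec[OF u(2), of "(g ^^ n) x"] by simp
    qed simp
    have fin: "finite (range u)" by (rule locconst_finite_range[OF u(1)])
    have "Min (range u) \<le> u ((g ^^ n) x)" for n using fin by simp
    then have "Min (range u) \<le> u x - int n" for n using dec[of n] by (meson order_trans)
    from this[of "nat (u x - Min (range u) + 1)"] show False by linarith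
  qed
  then have "y \<in> closure (full_orbit g x)" for y
    unfolding closure_iff_nhds_not_empty by blast
  then show ?thesis by blast
qed

section \<open>Continuity and invariant measures\<close>

lemma khomeo_continuous:
  assumes "khomeo g UNIV UNIV" shows "continuous_on UNIV g" "homeomorphism UNIV UNIV g (inv g)"
proof -
  note g = khomeo_UNIVD[OF assms]
  show c: "continuous_on UNIV g" by (rule continuous_of_clopen[OF g(4)])
  have "inv g -` A = g ` A" for A using bij_vimage_eq_inv_image[OF bij_imp_bij_inv[OF g(1)], of A] g(1)
    by (simp add: inv_inv_eq)
  then have ci: "continuous_on UNIV (inv g)" using continuous_of_clopen[of "inv g"] g(2) by simp
  have "surj g" "surj (inv g)" using g(1) bij_imp_bij_inv[OF g(1)] by (auto simp: bij_is_surj)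
  then show "homeomorphism UNIV UNIV g (inv g)"
    unfolding homeomorphism_def using c ci g(1) by (auto simp: bij_is_inj surj_f_inv_f)
qed

lemma K_invariant:
  assumes g: "khomeo g UNIV UNIV" shows "K \<subseteq> invariant_probs g"
proof
  fix \<nu> assume \<nu>: "\<nu> \<in> K"
  interpret prob_space \<nu> by (rule K_prob[OF \<nu>])
  have m: "g \<in> measurable \<nu> borel"
    using borel_measurable_continuous_onI[OF khomeo_continuous(1)[OF g]] K_sets[OF \<nu>]
    by (simp cong: measurable_cong_sets)
  have nb: "\<nu> \<in> borel_probs" using \<nu> K_sub by blast
  have "distr \<nu> borel g \<in> borel_probs" using prob_space_distr[OF m] by (simp add: borel_probs_def)
  moreover have "measure (distr \<nu> borel g) (cyl l) = measure \<nu> (cyl l)" for l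
    using measure_distr[OF m clopen_sets[OF cyl_clopen]] K_space[OF \<nu>] khomeo_UNIVD(5)[OF g cyl_clopen, of l] \<nu>
    by (simp add: eqv_def)
  ultimately have "distr \<nu> borel g = \<nu>" using measure_eq_cyl nb by blast
  then show "\<nu> \<in> invariant_probs g" using nb by (simp add: invariant_probs_def)
qed

text \<open>When the inequality is integrated, the two terms in \<open>u\<close> cancel by
  invariance of \<mu>; \<open>u\<close> is integrable because it has finite range.\<close>

lemma invariant_mass:
  assumes g: "khomeo g UNIV UNIV" and \<mu>: "\<mu> \<in> invariant_probs g"
    and u: "locconst u" "\<And>x. u (g x) \<le> u x + simple s x"
  shows "0 \<le> mass \<mu> s"
proof -
  have b: "\<mu> \<in> borel_probs" and inv: "distr \<mu> borel g = \<mu>" using \<mu> by (auto simp: invariant_probs_def)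
  interpret prob_space \<mu> using b by (simp add: borel_probs_def)
  have sets: "sets \<mu> = sets borel" using b by (simp add: borel_probs_def)
  have m: "g \<in> measurable \<mu> borel"
    using borel_measurable_continuous_onI[OF khomeo_continuous(1)[OF g]] sets
    by (simp cong: measurable_cong_sets)
  let ?u = "\<lambda>x. real_of_int (u x)"
  have fin: "finite (range u)" by (rule locconst_finite_range[OF u(1)])
  have mu: "?u \<in> borel_measurable borel"
  proof (rule borel_measurableI)
    fix S :: "real set"
    have "clopen (?u -` S)" using locconst_clopen[OF u(1), of "\<lambda>y. real_of_int y \<in> S"] by (simp add: vimage_def)
    then show "?u -` S \<inter> space borel \<in> sets borel" by (simp add: clopen_sets)
  qed
  have bd: "\<bar>?u x\<bar> \<le> Max ((\<lambda>y. \<bar>real_of_int y\<bar>) ` range u)" for x using fin by (intro Max_ge) auto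
  have mu': "?u \<in> borel_measurable \<mu>" using mu sets by (simp cong: measurable_cong_sets)
  have iu: "integrable \<mu> ?u" by (rule integrable_const_bound[OF _ mu']) (use bd in auto)
  have iug: "integrable \<mu> (\<lambda>x. ?u (g x))"
    by (rule integrable_const_bound[OF _ measurable_compose[OF m mu]]) (use bd in auto)
  have eq: "integral\<^sup>L \<mu> (\<lambda>x. ?u (g x)) = integral\<^sup>L \<mu> ?u"
    using integral_distr[OF m mu] inv by simp
  note s = has_integral_simple[OF b, of s]
  have "integral\<^sup>L \<mu> ?u \<le> integral\<^sup>L \<mu> ?u + mass \<mu> s"
  proof (rule has_integral_le)
    show "has_bochner_integral \<mu> (\<lambda>x. ?u (g x)) (integral\<^sup>L \<mu> ?u)"
      using iug eq by (simp add: has_bochner_integral_iff)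
    show "has_bochner_integral \<mu> (\<lambda>x. ?u x + real_of_int (simple s x)) (integral\<^sup>L \<mu> ?u + mass \<mu> s)"
      by (rule has_bochner_integral_add[OF _ s]) (use iu in \<open>simp add: has_bochner_integral_iff\<close>)
    show "?u (g x) \<le> ?u x + real_of_int (simple s x)" for x using u(2)[of x] by linarith
  qed
  then show ?thesis by simp
qed

section \<open>Separating a measure from K\<close>

lemma measure_mixture:
  assumes "\<mu> \<in> borel_probs" "\<nu> \<in> borel_probs" "clopen A" "0 \<le> t" "t \<le> 1"
  shows "measure (mixture t \<mu> \<nu>) A = t * measure \<mu> A + (1 - t) * measure \<nu> A"
proof -
  interpret \<mu>: prob_space \<mu> using assms by (simp add: borel_probs_def)
  interpret \<nu>: prob_space \<nu> using assms by (simp add: borel_probs_def)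
  have "emeasure (mixture t \<mu> \<nu>) A = ennreal (t * measure \<mu> A + (1 - t) * measure \<nu> A)"
    using assms emeasure_mixture[of \<mu> \<nu> A t] clopen_sets[OF assms(3)]
    by (simp add: borel_probs_def \<mu>.emeasure_eq_measure \<nu>.emeasure_eq_measure ennreal_mult' ennreal_plus)
  then have "measure (mixture t \<mu> \<nu>) A = enn2real (ennreal (t * measure \<mu> A + (1 - t) * measure \<nu> A))"
    by (simp only: measure_def)
  also have "\<dots> = t * measure \<mu> A + (1 - t) * measure \<nu> A"
    by (rule enn2real_ennreal) (use assms(4,5) in simp)
  finally show ?thesis .
qed

text \<open>The variational inequality for the nearest point of a convex set, in the coordinates
  given by the measures of the first \<open>N\<close> sets. A violating direction would decrease the
  squared distance along the segment to \<nu>.\<close>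

lemma nearest_point:
  assumes conv: "convex_measures K" and A: "\<And>i::nat. clopen (A i)"
  shows "\<exists>\<nu>0\<in>K. \<forall>\<nu>\<in>K. 0 \<le> (\<Sum>i<N. (measure \<nu>0 (A i) - p i) * (measure \<nu> (A i) - measure \<nu>0 (A i)))"
proof -
  let ?F = "\<lambda>\<nu>. \<Sum>i<N. (measure \<nu> (A i) - p i)\<^sup>2"
  have "continuous_map prob_topology euclideanreal ?F"
    by (intro continuous_map_sum continuous_map_real_pow continuous_map_diff continuous_measure A) auto
  from K_attains[OF this] obtain \<nu>0 where \<nu>0: "\<nu>0 \<in> K" "\<forall>\<nu>\<in>K. ?F \<nu>0 \<le> ?F \<nu>" by blast
  have "0 \<le> (\<Sum>i<N. (measure \<nu>0 (A i) - p i) * (measure \<nu> (A i) - measure \<nu>0 (A i)))" (is "0 \<le> ?S")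
    if \<nu>: "\<nu> \<in> K" for \<nu>
  proof (rule ccontr)
    assume "\<not> 0 \<le> ?S"
    then have S: "?S < 0" by simp
    let ?Q = "\<Sum>i<N. (measure \<nu> (A i) - measure \<nu>0 (A i))\<^sup>2"
    have Q: "0 \<le> ?Q" by (intro sum_nonneg) simp
    \<comment> \<open>Along the segment the squared distance changes by t (2 S + t Q). The bound t
      \<le> - S / (Q + 1) gives t Q \<le> - S, hence a negative change; adding 1 avoids division by
      zero.\<close>
    define t where "t = min 1 (- ?S / (?Q + 1))"
    have "0 < - ?S / (?Q + 1)" using S Q by (intro divide_pos_pos) auto
    then have t: "0 < t" "t \<le> 1" by (simp_all add: t_def)
    have tQ: "t * ?Q \<le> - ?S"
    proof -
      have "t \<le> - ?S / (?Q + 1)" by (simp add: t_def)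
      then have "t * (?Q + 1) \<le> - ?S" using Q by (simp add: field_simps)
      then show ?thesis using t(1) by (simp add: algebra_simps)
    qed
    have mem: "mixture t \<nu> \<nu>0 \<in> K" using conv \<nu> \<nu>0(1) t unfolding convex_measures_def by auto
    have "?F (mixture t \<nu> \<nu>0) = (\<Sum>i<N. (measure \<nu>0 (A i) - p i)\<^sup>2 +
        2 * t * ((measure \<nu>0 (A i) - p i) * (measure \<nu> (A i) - measure \<nu>0 (A i))) +
        t\<^sup>2 * (measure \<nu> (A i) - measure \<nu>0 (A i))\<^sup>2)"
    proof (rule sum.cong[OF refl])
      fix i
      have mx: "measure (mixture t \<nu> \<nu>0) (A i) = t * measure \<nu> (A i) + (1 - t) * measure \<nu>0 (A i)"
        by (rule measure_mixture) (use K_sub \<nu> \<nu>0(1) A t in auto)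
      show "(measure (mixture t \<nu> \<nu>0) (A i) - p i)\<^sup>2 = (measure \<nu>0 (A i) - p i)\<^sup>2 +
        2 * t * ((measure \<nu>0 (A i) - p i) * (measure \<nu> (A i) - measure \<nu>0 (A i))) +
        t\<^sup>2 * (measure \<nu> (A i) - measure \<nu>0 (A i))\<^sup>2"
        unfolding mx by (simp add: power2_eq_square algebra_simps)
    qed
    also have "\<dots> = ?F \<nu>0 + 2 * t * ?S + t\<^sup>2 * ?Q"
      by (simp only: sum.distrib sum_distrib_left)
    finally have eq: "?F (mixture t \<nu> \<nu>0) = ?F \<nu>0 + 2 * t * ?S + t\<^sup>2 * ?Q" .
    have "2 * t * ?S + t\<^sup>2 * ?Q = t * (2 * ?S + t * ?Q)" by (simp add: power2_eq_square algebra_simps)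
    also have "\<dots> < 0" using t(1) tQ S by (intro mult_pos_neg) auto
    finally show False using eq \<nu>0(2) mem by force
  qed
  then show ?thesis using \<nu>0(1) by blast
qed

text \<open>If the nearest point of \<open>K\<close> differs from \<mu> on these cylinders, the
  hyperplane orthogonal to the difference separates \<open>K\<close> from \<mu> with gap
  \<open>D\<close>. Turned into an integer test function, it would have positive mass on
  \<open>K\<close> and negative mass at \<mu>.\<close>

lemma finite_agreement:
  fixes L :: "nat \<Rightarrow> bool list"
  assumes conv: "convex_measures K" and b: "\<mu> \<in> borel_probs"
    and mass: "\<And>s. (\<forall>\<nu>\<in>K. 0 < mass \<nu> s) \<Longrightarrow> 0 \<le> mass \<mu> s"
  shows "\<exists>\<nu>\<in>K. \<forall>i<N. measure \<nu> (cyl (L i)) = measure \<mu> (cyl (L i))"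
proof -
  interpret prob_space \<mu> using b by (simp add: borel_probs_def)
  have muU: "measure \<mu> UNIV = 1"
    using prob_space b sets_eq_imp_space_eq[of \<mu> borel] by (simp add: borel_probs_def)
  define p where "p = (\<lambda>i. measure \<mu> (cyl (L i)))"
  obtain \<nu>0 where \<nu>0: "\<nu>0 \<in> K"
    and near: "\<forall>\<nu>\<in>K. 0 \<le> (\<Sum>i<N. (measure \<nu>0 (cyl (L i)) - p i) * (measure \<nu> (cyl (L i)) - measure \<nu>0 (cyl (L i))))"
    using nearest_point[OF conv cyl_clopen, where N = N and p = p] by blast
  define c where "c = (\<lambda>i. measure \<nu>0 (cyl (L i)) - p i)"
  define D where "D = (\<Sum>i<N. (c i)\<^sup>2)"
  show ?thesis
  proof (cases "D = 0")
    case True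
    then have "\<forall>i\<in>{..<N}. (c i)\<^sup>2 = 0" unfolding D_def by (subst (asm) sum_nonneg_eq_0_iff) auto
    then show ?thesis using \<nu>0 by (intro bexI[of _ \<nu>0]) (auto simp: c_def p_def)
  next
    case False
    then have D: "0 < D" unfolding D_def using sum_nonneg[of "{..<N}" "\<lambda>i. (c i)\<^sup>2"] by (simp add: order_less_le)
    define P where "P = (\<Sum>i<N. c i * p i)"
    have sep: "P + D \<le> (\<Sum>i<N. c i * measure \<nu> (cyl (L i)))" if "\<nu> \<in> K" for \<nu>
    proof -
      have "0 \<le> (\<Sum>i<N. c i * (measure \<nu> (cyl (L i)) - measure \<nu>0 (cyl (L i))))"
        using bspec[OF near that] by (simp add: c_def)
      moreover have "(\<Sum>i<N. c i * (measure \<nu> (cyl (L i)) - measure \<nu>0 (cyl (L i)))) =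
          (\<Sum>i<N. c i * measure \<nu> (cyl (L i)) - c i * p i - (c i)\<^sup>2)"
        by (intro sum.cong refl) (simp add: c_def power2_eq_square algebra_simps)
      ultimately show ?thesis by (simp add: sum_subtractf P_def D_def)
    qed
    \<comment> \<open>Rounding down \<open>N\<close> coefficients costs at most \<open>N\<close>,
      and \<open>k\<close> exceeds M P by at most N + 1; the scaled gap M D covers both. That
      \<open>k\<close> lies above M P makes the mass of \<mu> negative.\<close>
    obtain M :: nat where M: "2 * real N + 3 < real M * D" using reals_Archimedean3[OF D] by blast
    define q where "q = (\<lambda>i. \<lfloor>real M * c i\<rfloor>)"
    define k where "k = \<lfloor>real M * P\<rfloor> + int N + 1"
    define s where "s = map (\<lambda>i. (q i, L i)) [0..<N] @ [(- k, [])]"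
    have mass_s: "mass \<nu> s = (\<Sum>i<N. real_of_int (q i) * measure \<nu> (cyl (L i))) - real_of_int k"
      if "measure \<nu> UNIV = 1" for \<nu>
      using that by (simp add: mass_def s_def o_def interv_sum_list_conv_sum_set_nat atLeast0LessThan)
    have m01: "0 \<le> measure \<nu> (cyl l)" "measure \<nu> (cyl l) \<le> 1" if "\<nu> \<in> K" for \<nu> l
      using prob_space.prob_le_1[OF K_prob[OF that]] by auto
    have "0 < mass \<nu> s" if \<nu>: "\<nu> \<in> K" for \<nu>
    proof -
      have "(\<Sum>i<N. real M * (c i * measure \<nu> (cyl (L i))) - 1) \<le> (\<Sum>i<N. real_of_int (q i) * measure \<nu> (cyl (L i)))"
      proof (rule sum_mono)
        fix i
        let ?m = "measure \<nu> (cyl (L i))"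
        have "real M * c i - 1 \<le> real_of_int (q i)" unfolding q_def by linarith
        then have "(real M * c i - 1) * ?m \<le> real_of_int (q i) * ?m" using m01[OF \<nu>] by (intro mult_right_mono) auto
        moreover have "real M * (c i * ?m) - 1 \<le> (real M * c i - 1) * ?m" using m01[OF \<nu>, of "L i"] by (simp add: algebra_simps)
        ultimately show "real M * (c i * ?m) - 1 \<le> real_of_int (q i) * ?m" by linarith
      qed
      then have 1: "real M * (\<Sum>i<N. c i * measure \<nu> (cyl (L i))) - real N \<le> (\<Sum>i<N. real_of_int (q i) * measure \<nu> (cyl (L i)))"
        by (simp add: sum_subtractf sum_distrib_left)
      have "real M * (P + D) \<le> real M * (\<Sum>i<N. c i * measure \<nu> (cyl (L i)))"
        using sep[OF \<nu>] by (intro mult_left_mono) auto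
      then have 2: "real M * P + real M * D \<le> real M * (\<Sum>i<N. c i * measure \<nu> (cyl (L i)))"
        by (simp add: distrib_left)
      have "real_of_int k \<le> real M * P + real N + 1" unfolding k_def by simp
      then show ?thesis unfolding mass_s[OF K_UNIV[OF \<nu>]] using 1 2 M by linarith
    qed
    then have "0 \<le> mass \<mu> s" using mass by blast
    moreover have "(\<Sum>i<N. real_of_int (q i) * measure \<mu> (cyl (L i))) \<le> (\<Sum>i<N. real M * (c i * p i))"
    proof (rule sum_mono)
      fix i
      have "real_of_int (q i) \<le> real M * c i" by (simp add: q_def)
      then have "real_of_int (q i) * p i \<le> real M * c i * p i" by (intro mult_right_mono) (auto simp: p_def)
      then show "real_of_int (q i) * measure \<mu> (cyl (L i)) \<le> real M * (c i * p i)" by (simp add: p_def mult.assoc)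
    qed
    moreover have "(\<Sum>i<N. real M * (c i * p i)) = real M * P" by (simp add: P_def sum_distrib_left)
    moreover have "real M * P < real_of_int k" unfolding k_def by linarith
    ultimately show ?thesis unfolding mass_s[OF muU] by linarith
  qed
qed

text \<open>If no element of \<open>K\<close> agreed with \<mu> on all cylinders,
  \<open>K_cover\<close> would bound the first index of disagreement uniformly, against
  \<open>finite_agreement\<close>.\<close>

lemma in_K:
  assumes conv: "convex_measures K" and b: "\<mu> \<in> borel_probs"
    and mass: "\<And>s. (\<forall>\<nu>\<in>K. 0 < mass \<nu> s) \<Longrightarrow> 0 \<le> mass \<mu> s"
  shows "\<mu> \<in> K"
proof -
  let ?L = "\<lambda>i. from_nat i :: bool list"
  have "\<exists>\<nu>\<in>K. \<forall>i. measure \<nu> (cyl (?L i)) = measure \<mu> (cyl (?L i))"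
  proof (rule ccontr)
    assume "\<not> ?thesis"
    then have n: "\<exists>i. measure \<nu> (cyl (?L i)) \<in> - {measure \<mu> (cyl (?L i))}" if "\<nu> \<in> K" for \<nu>
      using that by auto
    have "\<exists>N. \<forall>\<nu>\<in>K. \<exists>i<N. measure \<nu> (cyl (?L i)) \<in> - {measure \<mu> (cyl (?L i))}"
      by (rule K_cover[OF cyl_clopen _ n]) auto
    then obtain N where N: "\<forall>\<nu>\<in>K. \<exists>i<N. measure \<nu> (cyl (?L i)) \<in> - {measure \<mu> (cyl (?L i))}" by blast
    obtain \<nu> where "\<nu> \<in> K" "\<forall>i<N. measure \<nu> (cyl (?L i)) = measure \<mu> (cyl (?L i))"
      using finite_agreement[OF conv b mass, of N ?L] by blast
    then show False using N by auto
  qed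
  then obtain \<nu> where \<nu>: "\<nu> \<in> K" "\<forall>i. measure \<nu> (cyl (?L i)) = measure \<mu> (cyl (?L i))" by blast
  have "measure \<nu> (cyl l) = measure \<mu> (cyl l)" for l using spec[OF \<nu>(2), of "to_nat l"] by simp
  then have "\<nu> = \<mu>" using measure_eq_cyl[of \<nu> \<mu>] \<nu>(1) K_sub b by blast
  then show ?thesis using \<nu>(1) by simp
qed

theorem K_approximately_divisible: "approximately_divisible K"
  unfolding approximately_divisible_def using divide by blast

theorem K_dynamical_simplex:
  assumes conv: "convex_measures K" shows "dynamical_simplex K"
proof -
  obtain g where g: "khomeo g UNIV UNIV"
    and dom: "\<forall>s. (\<forall>\<nu>\<in>K. 0 < mass \<nu> s) \<longrightarrow> (\<exists>u. locconst u \<and> (\<forall>x. u (g x) \<le> u x + simple s x))"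
    using limit_exists by blast
  have "minimal_homeomorphism g"
    unfolding minimal_homeomorphism_def self_homeomorphism_def
    using khomeo_continuous(2)[OF g] orbits_dense[OF khomeo_UNIVD(1)[OF g]] dom by blast
  moreover have "invariant_probs g \<subseteq> K"
  proof
    fix \<mu> assume \<mu>: "\<mu> \<in> invariant_probs g"
    show "\<mu> \<in> K"
    proof (rule in_K[OF conv])
      show "\<mu> \<in> borel_probs" using \<mu> by (simp add: invariant_probs_def)
      show "0 \<le> mass \<mu> s" if "\<forall>\<nu>\<in>K. 0 < mass \<nu> s" for s
        using invariant_mass[OF g \<mu>] dom that by blast
    qed
  qed
  ultimately show ?thesis using K_invariant[OF g] unfolding dynamical_simplex_def by blast
qed

end

theorem mainTheorem1:
  fixes K :: "'a::topological_space measure set"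
  assumes "cantor_space TYPE('a)"
    and "K \<subseteq> borel_probs"
    and "compactin prob_topology K"
    and "convex_measures K"
    and "\<forall>\<mu>\<in>K. atomless \<mu> \<and> full_support \<mu>"
    and "glasner_weiss K"
  shows "approximately_divisible K \<and> (K \<noteq> {} \<longrightarrow> dynamical_simplex K)"
proof (cases "K = {}")
  case True
  have "clopen ({} :: 'a set)" by simp
  then show ?thesis using True unfolding approximately_divisible_def by blast
next
  case False
  obtain e :: "'a \<Rightarrow> nat \<Rightarrow> bool" and e' where "homeomorphism UNIV UNIV e e'"
    using assms(1) unfolding cantor_space_def homeomorphic_def by blast
  then interpret gw_measures e K
    by unfold_locales (use assms False in auto)
  show ?thesis using K_approximately_divisible K_dynamical_simplex[OF assms(4)] by blast
qed

end
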